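(* Let $\mathbf{f}=(f_j)_{j\geq 0}\subset\mathcal{H}_d$ satisfy conditions (A) and (B). Then the sequential system $(\mathbb{P}^k,\mathscr{B},\mathbf{f},\mu_{\mathbf{f}})$ is exact, i.e. the asymptotic $\sigma$-algebra $\mathscr{B}_\infty:=\bigcap_{j\ge0}F_j^{-1}(\mathscr{B})$ is trivial modulo $\mu_{\mathbf{f}}$-null sets: every $A\in\mathscr{B}_\infty$ satisfies $\mu_{\mathbf{f}}(A)\in\{0,1\}$.
   Context: $\mathcal{M}_d\cong\mathbb{P}^N$ is the space of meromorphic self-maps of $\mathbb{P}^k$ of algebraic degree $d\ge2$, $\mathcal{H}_d$ its subset of holomorphic endomorphisms, $\mathcal{M}=\mathcal{M}_d\setminus\mathcal{H}_d$, $\mathrm{dist}$ the Fubini–Study distance on $\mathbb{P}^N$ normalized so $\mathrm{dist}\le1$. Conditions: (A) $\liminf_{n}\frac1n\sum_{j=0}^{n-1}\log\mathrm{dist}(f_j,\mathcal{M})>-\infty$; (B) $\liminf_{j}\frac1j\log\mathrm{dist}(f_j,\mathcal{M})=0$. $F_0=\mathrm{id}$, $F_n:=f_{n-1}\circ\cdots\circ f_0$. $\mathscr{B}$ is the Borel $\sigma$-algebra of $\mathbb{P}^k$. $\mu_{\mathbf{f}}$ is the probability measure with $d^{-nk}F_n^*\nu\to\mu_{\mathbf{f}}$ weakly for every smooth probability measure $\nu$ on $\mathbb{P}^k$. *)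

theory Defs
  imports "HOL-Probability.Probability"
begin

(* P^k is modelled via homogeneous coordinates: complex^'n with CARD('n) = k+1.
   A point of P^k is a ray {c x | c <> 0} of a nonzero vector x. *)

definition pspace :: "(complex^'n::finite) set" where
  "pspace = {x. x \<noteq> 0}"

definition ray :: "complex^'n::finite \<Rightarrow> (complex^'n) set" where
  "ray x = {c *s x | c. c \<noteq> 0}"

(* Borel sigma-algebra of P^k, transported: C*-invariant Borel subsets of C^{k+1}\{0} *)
definition cone_sets :: "(complex^'n::finite) set set" where
  "cone_sets = {A \<in> sets borel. A \<subseteq> pspace \<and> (\<forall>x\<in>A. \<forall>c::complex. c \<noteq> 0 \<longrightarrow> c *s x \<in> A)}"

definition Alpha :: "nat \<Rightarrow> ('n::finite \<Rightarrow> nat) set" where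
  "Alpha d = {\<alpha>. sum \<alpha> UNIV = d}"

(* a (k+1)-tuple of homogeneous polynomials of degree d, given by coefficients
   c i \<alpha> (only the values for \<alpha> \<in> Alpha d matter); this is the lift to C^{k+1} *)
definition hpoly_map :: "nat \<Rightarrow> ('n::finite \<Rightarrow> ('n \<Rightarrow> nat) \<Rightarrow> complex) \<Rightarrow> complex^'n \<Rightarrow> complex^'n" where
  "hpoly_map d c x = (\<chi> i. \<Sum>\<alpha>\<in>Alpha d. c i \<alpha> * (\<Prod>l\<in>UNIV. (x $ l) ^ (\<alpha> l)))"

definition coef_inner :: "nat \<Rightarrow> ('n::finite \<Rightarrow> ('n \<Rightarrow> nat) \<Rightarrow> complex) \<Rightarrow> ('n \<Rightarrow> ('n \<Rightarrow> nat) \<Rightarrow> complex) \<Rightarrow> complex" where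
  "coef_inner d c c' = (\<Sum>i\<in>UNIV. \<Sum>\<alpha>\<in>Alpha d. c i \<alpha> * cnj (c' i \<alpha>))"

definition coef_norm :: "nat \<Rightarrow> ('n::finite \<Rightarrow> ('n \<Rightarrow> nat) \<Rightarrow> complex) \<Rightarrow> real" where
  "coef_norm d c = sqrt (\<Sum>i\<in>UNIV. \<Sum>\<alpha>\<in>Alpha d. (cmod (c i \<alpha>))\<^sup>2)"

definition nonzero_coef :: "nat \<Rightarrow> ('n::finite \<Rightarrow> ('n \<Rightarrow> nat) \<Rightarrow> complex) \<Rightarrow> bool" where
  "nonzero_coef d c \<longleftrightarrow> (\<exists>i. \<exists>\<alpha>\<in>Alpha d. c i \<alpha> \<noteq> 0)"

(* Fubini-Study (geodesic) distance on P^N, normalized by 2/pi so that it is <= 1 *)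
definition fs_dist :: "nat \<Rightarrow> ('n::finite \<Rightarrow> ('n \<Rightarrow> nat) \<Rightarrow> complex) \<Rightarrow> ('n \<Rightarrow> ('n \<Rightarrow> nat) \<Rightarrow> complex) \<Rightarrow> real" where
  "fs_dist d c c' = 2 / pi * arccos (cmod (coef_inner d c c') / (coef_norm d c * coef_norm d c'))"

definition holo :: "nat \<Rightarrow> ('n::finite \<Rightarrow> ('n \<Rightarrow> nat) \<Rightarrow> complex) \<Rightarrow> bool" where
  "holo d c \<longleftrightarrow> nonzero_coef d c \<and> (\<forall>x. hpoly_map d c x = 0 \<longrightarrow> x = 0)"

definition indet :: "nat \<Rightarrow> ('n::finite \<Rightarrow> ('n \<Rightarrow> nat) \<Rightarrow> complex) set" where
  "indet d = {c. nonzero_coef d c \<and> (\<exists>x. x \<noteq> 0 \<and> hpoly_map d c x = 0)}"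

definition dist_M :: "nat \<Rightarrow> ('n::finite \<Rightarrow> ('n \<Rightarrow> nat) \<Rightarrow> complex) \<Rightarrow> real" where
  "dist_M d c = Inf (fs_dist d c ` indet d)"

fun Flift :: "nat \<Rightarrow> (nat \<Rightarrow> 'n::finite \<Rightarrow> ('n \<Rightarrow> nat) \<Rightarrow> complex) \<Rightarrow> nat \<Rightarrow> complex^'n \<Rightarrow> complex^'n" where
  "Flift d c 0 = id"
| "Flift d c (Suc n) = hpoly_map d (c n) \<circ> Flift d c n"

(* C^infinity real functions on an open set, via iterated partial derivatives *)
coinductive smooth_on :: "'a::euclidean_space set \<Rightarrow> ('a \<Rightarrow> real) \<Rightarrow> bool" where
  "f differentiable_on S \<Longrightarrow> (\<forall>b\<in>Basis. smooth_on S (\<lambda>x. frechet_derivative f (at x) b))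
     \<Longrightarrow> smooth_on S f"

definition cont_Pk :: "(complex^'n::finite \<Rightarrow> real) \<Rightarrow> bool" where
  "cont_Pk \<phi> \<longleftrightarrow> continuous_on pspace \<phi> \<and> (\<forall>x\<in>pspace. \<forall>c::complex. c \<noteq> 0 \<longrightarrow> \<phi> (c *s x) = \<phi> x)"

(* Gaussian density: its image on P^k is the normalized Fubini-Study volume omega^k *)
definition gauss :: "complex^'n::finite \<Rightarrow> real" where
  "gauss z = exp (- (norm z)\<^sup>2) / pi ^ CARD('n)"

definition smooth_prob :: "(complex^'n::finite) measure \<Rightarrow> bool" where
  "smooth_prob \<nu> \<longleftrightarrow> prob_space \<nu> \<and> sets \<nu> = cone_sets \<and>
     (\<exists>\<rho>. smooth_on pspace \<rho> \<and> (\<forall>x\<in>pspace. 0 \<le> \<rho> x) \<and>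
        (\<forall>x\<in>pspace. \<forall>c::complex. c \<noteq> 0 \<longrightarrow> \<rho> (c *s x) = \<rho> x) \<and>
        (\<forall>A\<in>cone_sets. emeasure \<nu> A = (\<integral>\<^sup>+ z. ennreal (\<rho> z * gauss z) * indicator A z \<partial>lborel)))"

(* (G_* phi)(y) = sum of phi over the (finitely many) preimage points of y in P^k;
   integral of phi against G^* nu is  integral of G_* phi against nu *)
definition push_fun :: "(complex^'n::finite \<Rightarrow> complex^'n) \<Rightarrow> (complex^'n \<Rightarrow> real) \<Rightarrow> complex^'n \<Rightarrow> real" where
  "push_fun G \<phi> y = (\<Sum>P\<in>{ray x | x. x \<in> pspace \<and> G x \<in> ray y}. \<phi> (SOME x. x \<in> P))"

definition asymp_sets :: "nat \<Rightarrow> (nat \<Rightarrow> 'n::finite \<Rightarrow> ('n \<Rightarrow> nat) \<Rightarrow> complex) \<Rightarrow> (complex^'n) set set" where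
  "asymp_sets d c = {A. \<forall>j. \<exists>B\<in>cone_sets. A = Flift d c j -` B \<inter> pspace}"

end

theory Submission
  imports Defs "HOL-Complex_Analysis.Complex_Analysis"
begin

text \<open>Let \<open>u\<close> be plurisubharmonic on the punctured space with \<open>u (c x) = u x + C ln |c|\<close>. Averaged over
  the fibres of \<open>F\<^sub>n\<close>, it remains plurisubharmonic, with \<open>C\<close> divided by \<open>d\<^sup>n\<close>, so for large \<open>n\<close> it is
  nearly invariant under scaling and the sub-mean value inequality bounds it at every regular value
  by its mean against the Gaussian, up to a vanishing error. Condition (A) provides a Green
  function \<open>G\<close>; the difference \<open>w = u - C G\<close> lives on projective space, and since the Gaussian induces
  the Fubini--Study measure, the means of its fibre averages tend to \<open>\<integral>w d\<mu>\<close>. Pairing this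
  one-sided bound with functions of \<open>F\<^sub>n\<close> gives \<open>\<integral>\<^sub>A w d\<mu> \<le> \<mu>(A) \<integral>w d\<mu>\<close> for every asymptotic set \<open>A\<close>,
  with equality because the complement of \<open>A\<close> is asymptotic too. The differences of such functions
  \<open>u\<close> are closed under maxima and generate the \<open>\<sigma>\<close>-algebra, so \<open>A\<close> is independent of every Borel
  set, in particular of itself.\<close>

no_notation fps_nth (infixl "$" 75)

section \<open>Polynomials in several complex variables\<close>

text \<open>On the lift \<open>complex^'n\<close>, psh functions obey elementary sub-mean
  inequalities on discs, but a scale-invariant one is constant; this forces the logarithmic weight
  \<open>C\<close> and its compensation by \<open>C G\<close>. The compensation is harmless because
  \<open>G\<close> differs from \<open>(ln |F_n| - const) / d^n\<close> by a uniformly vanishing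
  error, so it is nearly constant on each fibre of \<open>F_n\<close>; condition (A) is what makes
  the series defining \<open>G\<close> converge uniformly.

  The main obstacle is ramification: only off the critical values is a fibre sum a sum over
  holomorphic branches. The critical values lie in a proper hypersurface \<open>Q = 0\<close>.
  Adding \<open>\<epsilon> ln |Q|\<close> and truncating from below gives a continuous submean
  function on the whole space, and \<epsilon> is removed at the end. The number of preimages is
  constant because complex lines minus finitely many points are connected, and its growth is read
  off from the convergence to \<mu> tested on the constant 1.\<close>

text \<open>Gaussian elimination: equation \<open>i\<close> is solved for a pivot unknown
  \<open>j0\<close>, which leaves one equation and one unknown fewer. It supplies the linear
  dependence in \<open>critical_value_polynomial\<close>.\<close>

lemma homogeneous_system_nontrivial_solution:
  fixes m :: "'i \<Rightarrow> 'j \<Rightarrow> 'a::field"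
  assumes "finite I" "finite J" "card I < card J"
  shows "\<exists>c. (\<exists>j\<in>J. c j \<noteq> 0) \<and> (\<forall>i\<in>I. (\<Sum>j\<in>J. m i j * c j) = 0)"
  using assms
proof (induction I arbitrary: J m rule: finite_induct)
  case empty
  then obtain j where "j \<in> J" by fastforce
  then show ?case by (intro exI[of _ "\<lambda>_. 1"]) auto
next
  case (insert i I)
  show ?case
  proof (cases "\<forall>j\<in>J. m i j = 0")
    case True
    have "card I < card J" using insert by simp
    from insert.IH[OF insert.prems(1) this, of m] obtain c where
      "\<exists>j\<in>J. c j \<noteq> 0" "\<forall>i\<in>I. (\<Sum>j\<in>J. m i j * c j) = 0" by blast
    moreover have "(\<Sum>j\<in>J. m i j * c j) = 0" using True by simp
    ultimately show ?thesis by blast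
  next
    case False
    then obtain j0 where j0: "j0 \<in> J" "m i j0 \<noteq> 0" by auto
    define J' where "J' = J - {j0}"
    have J: "J = insert j0 J'" "j0 \<notin> J'" "finite J'"
      using j0 insert.prems unfolding J'_def by auto
    have "card I < card J'"
      using insert J by simp
    from insert.IH[OF J(3) this, of "\<lambda>i' j. m i' j - m i' j0 * m i j / m i j0"]
    obtain c' where c': "\<exists>j\<in>J'. c' j \<noteq> 0"
      "\<And>i'. i' \<in> I \<Longrightarrow> (\<Sum>j\<in>J'. (m i' j - m i' j0 * m i j / m i j0) * c' j) = 0" by blast
    define s where "s = - (\<Sum>j\<in>J'. m i j * c' j) / m i j0"
    define c where "c = c'(j0 := s)"
    have cs: "(\<Sum>j\<in>J. m i' j * c j) = m i' j0 * s + (\<Sum>j\<in>J'. m i' j * c' j)" for i'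
    proof -
      have "(\<Sum>j\<in>J'. m i' j * c j) = (\<Sum>j\<in>J'. m i' j * c' j)"
        using J(2) by (intro sum.cong) (auto simp: c_def)
      then show ?thesis using J by (simp add: c_def)
    qed
    have "(\<Sum>j\<in>J. m i j * c j) = 0"
      unfolding cs s_def using j0 by simp
    moreover have "(\<Sum>j\<in>J. m i' j * c j) = 0" if "i' \<in> I" for i'
    proof -
      have "0 = (\<Sum>j\<in>J'. m i' j * c' j) - (\<Sum>j\<in>J'. m i' j0 / m i j0 * (m i j * c' j))"
        using c'(2)[OF that] by (simp add: algebra_simps sum_subtractf)
      also have "\<dots> = (\<Sum>j\<in>J'. m i' j * c' j) + m i' j0 * s"
        unfolding s_def sum_distrib_left[symmetric] by simp
      finally show ?thesis by (simp add: cs add.commute)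
    qed
    moreover have "\<exists>j\<in>J. c j \<noteq> 0" using c'(1) J by (auto simp: c_def)
    ultimately show ?thesis by blast
  qed
qed

text \<open>The degree is bounded in each variable separately, so that the number of exponents is
  exactly a power \<open>(q + 1) ^ CARD('n)\<close>, convenient for comparing dimensions, while
  bounds still add under multiplication.\<close>

definition exps :: "nat \<Rightarrow> ('n::finite \<Rightarrow> nat) set" where
  "exps q = PiE UNIV (\<lambda>_. {..q})"

definition monomial :: "('n::finite \<Rightarrow> nat) \<Rightarrow> complex^'n \<Rightarrow> complex" where
  "monomial \<alpha> x = (\<Prod>l\<in>UNIV. (x $ l) ^ \<alpha> l)"

definition polynomial :: "nat \<Rightarrow> (complex^'n::finite \<Rightarrow> complex) \<Rightarrow> bool" where
  "polynomial q p \<longleftrightarrow> (\<exists>c. \<forall>x. p x = (\<Sum>\<alpha>\<in>exps q. c \<alpha> * monomial \<alpha> x))"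

lemma finite_exps [simp]: "finite (exps q)"
  by (simp add: exps_def finite_PiE)

lemma card_exps: "card (exps q :: ('n::finite \<Rightarrow> nat) set) = (q + 1) ^ CARD('n)"
  by (simp add: exps_def card_PiE)

lemma exps_iff: "\<alpha> \<in> exps q \<longleftrightarrow> (\<forall>l. \<alpha> l \<le> q)"
  by (auto simp: exps_def)

text \<open>With all variables but one frozen, the identity is a one-variable polynomial vanishing
  everywhere, so its coefficients vanish. Exponents are extensional functions on a finite set
  \<open>L\<close> of variables, which allows induction on \<open>L\<close>.\<close>

lemma polynomial_combination_eq_0_imp:
  fixes c :: "('n \<Rightarrow> nat) \<Rightarrow> complex"
  assumes "finite L"
    and "\<And>x::'n\<Rightarrow>complex. (\<Sum>\<alpha>\<in>PiE L (\<lambda>_. {..q}). c \<alpha> * (\<Prod>l\<in>L. x l ^ \<alpha> l)) = 0"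
    and "\<alpha> \<in> PiE L (\<lambda>_. {..q})"
  shows "c \<alpha> = 0"
  using assms
proof (induction L arbitrary: c \<alpha> rule: finite_induct)
  case empty
  then show ?case by simp
next
  case (insert l L)
  let ?P = "PiE L (\<lambda>_. {..q})"
  have inj: "inj_on (\<lambda>(y, g). g(l := y)) ({..q} \<times> ?P)"
    using inj_combinator[of l L "\<lambda>_. {..q}"] insert.hyps by simp
  have eq: "PiE (insert l L) (\<lambda>_. {..q}) = (\<lambda>(y, g). g(l := y)) ` ({..q} \<times> ?P)"
    by (rule PiE_insert_eq)
  have zero: "(\<Sum>g\<in>?P. c (g(l := y)) * (\<Prod>l\<in>L. x l ^ g l)) = 0" if "y \<le> q" for x :: "'n \<Rightarrow> complex" and y
  proof -
    have "(\<Sum>y\<le>q. (\<Sum>g\<in>?P. c (g(l := y)) * (\<Prod>l\<in>L. x l ^ g l)) * t ^ y) = 0" for t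
    proof -
      have "0 = (\<Sum>\<alpha>\<in>PiE (insert l L) (\<lambda>_. {..q}). c \<alpha> * (\<Prod>l'\<in>insert l L. (x(l := t)) l' ^ \<alpha> l'))"
        using insert.prems(1) by simp
      also have "\<dots> = (\<Sum>(y,g)\<in>{..q} \<times> ?P. c (g(l := y)) * (\<Prod>l'\<in>insert l L. (x(l := t)) l' ^ (g(l := y)) l'))"
        unfolding eq by (subst sum.reindex[OF inj]) (auto simp: case_prod_unfold)
      also have "\<dots> = (\<Sum>(y,g)\<in>{..q} \<times> ?P. c (g(l := y)) * (\<Prod>l'\<in>L. x l' ^ g l') * t ^ y)"
      proof (intro sum.cong refl, clarify)
        fix y g
        have "(\<Prod>l'\<in>L. (x(l := t)) l' ^ (g(l := y)) l') = (\<Prod>l'\<in>L. x l' ^ g l')"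
          using insert.hyps by (intro prod.cong) auto
        then show "c (g(l := y)) * (\<Prod>l'\<in>insert l L. (x(l := t)) l' ^ (g(l := y)) l') =
            c (g(l := y)) * (\<Prod>l'\<in>L. x l' ^ g l') * t ^ y"
          using insert.hyps by simp
      qed
      also have "\<dots> = (\<Sum>y\<le>q. (\<Sum>g\<in>?P. c (g(l := y)) * (\<Prod>l\<in>L. x l ^ g l)) * t ^ y)"
        by (simp add: sum.cartesian_product sum_distrib_right)
      finally show ?thesis by simp
    qed
    then show ?thesis using that
      polyfun_eq_0[of "\<lambda>y. \<Sum>g\<in>?P. c (g(l := y)) * (\<Prod>l\<in>L. x l ^ g l)" q] by blast
  qed
  from insert.prems(2) obtain y g where yg: "y \<le> q" "g \<in> ?P" "\<alpha> = g(l := y)"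
    unfolding eq by auto
  show ?case
    using insert.IH[of "\<lambda>g. c (g(l := y))", OF zero[OF yg(1)] yg(2)] yg(3) by (simp only:)
qed

lemma polynomial_eq_0_imp_coeff_eq_0:
  assumes "\<And>x::complex^'n::finite. (\<Sum>\<alpha>\<in>exps q. c \<alpha> * monomial \<alpha> x) = 0" and "\<alpha> \<in> exps q"
  shows "c \<alpha> = 0"
proof (rule polynomial_combination_eq_0_imp[where L = UNIV and q = q and c = c])
  show "(\<Sum>\<alpha>\<in>UNIV \<rightarrow>\<^sub>E {..q}. c \<alpha> * (\<Prod>l\<in>UNIV. x l ^ \<alpha> l)) = 0" for x :: "'n \<Rightarrow> complex"
    using assms(1)[of "\<chi> i. x i"] by (simp add: exps_def monomial_def)
qed (use assms(2) in \<open>auto simp: exps_def\<close>)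

lemma polynomial_mono:
  assumes "polynomial q p" "q \<le> q'" shows "polynomial q' p"
proof -
  obtain c where c: "\<And>x. p x = (\<Sum>\<alpha>\<in>exps q. c \<alpha> * monomial \<alpha> x)"
    using assms by (auto simp: polynomial_def)
  have sub: "exps q \<subseteq> exps q'" using assms(2) by (meson exps_iff order.trans subsetI)
  have "p x = (\<Sum>\<alpha>\<in>exps q'. (if \<alpha> \<in> exps q then c \<alpha> else 0) * monomial \<alpha> x)" for x
    unfolding c by (rule sum.mono_neutral_cong_left) (use sub in auto)
  then show ?thesis unfolding polynomial_def by (intro exI[of _ "\<lambda>\<alpha>. if \<alpha> \<in> exps q then c \<alpha> else 0"]) blast
qed

lemma polynomial_add:
  assumes "polynomial q f" "polynomial q g" shows "polynomial q (\<lambda>x. f x + g x)"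
proof -
  obtain c c' where "\<And>x. f x = (\<Sum>\<alpha>\<in>exps q. c \<alpha> * monomial \<alpha> x)"
    "\<And>x. g x = (\<Sum>\<alpha>\<in>exps q. c' \<alpha> * monomial \<alpha> x)"
    using assms by (auto simp: polynomial_def)
  then have "f x + g x = (\<Sum>\<alpha>\<in>exps q. (c \<alpha> + c' \<alpha>) * monomial \<alpha> x)" for x
    by (simp add: sum.distrib distrib_right)
  then show ?thesis unfolding polynomial_def by (intro exI[of _ "\<lambda>\<alpha>. c \<alpha> + c' \<alpha>"]) blast
qed

lemma polynomial_cmult:
  assumes "polynomial q f" shows "polynomial q (\<lambda>x. a * f x)"
proof -
  obtain c where "\<And>x. f x = (\<Sum>\<alpha>\<in>exps q. c \<alpha> * monomial \<alpha> x)"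
    using assms by (auto simp: polynomial_def)
  then have "a * f x = (\<Sum>\<alpha>\<in>exps q. (a * c \<alpha>) * monomial \<alpha> x)" for x
    by (simp add: sum_distrib_left mult.assoc)
  then show ?thesis unfolding polynomial_def by (intro exI[of _ "\<lambda>\<alpha>. a * c \<alpha>"]) blast
qed

lemma polynomial_monomial:
  assumes "\<alpha> \<in> exps q" shows "polynomial q (monomial \<alpha>)"
  unfolding polynomial_def
  by (intro exI[of _ "\<lambda>\<beta>. if \<beta> = \<alpha> then 1 else 0"]) (use assms in \<open>simp add: if_distrib if_distribR sum.delta cong: if_cong\<close>)

lemma polynomial_const [simp]: "polynomial q (\<lambda>_. a)"
proof -
  have "polynomial q (\<lambda>x. a * monomial (\<lambda>_. 0) x)"
    by (intro polynomial_cmult polynomial_monomial) (simp add: exps_iff)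
  then show ?thesis by (simp add: monomial_def)
qed

lemma polynomial_sum:
  assumes "\<And>i. i \<in> I \<Longrightarrow> polynomial q (f i)" shows "polynomial q (\<lambda>x. \<Sum>i\<in>I. f i x)"
  using assms
proof (induction I rule: infinite_finite_induct)
  case (insert i I)
  then show ?case using polynomial_add[of q "f i" "\<lambda>x. \<Sum>i\<in>I. f i x"] by simp
qed auto

lemma monomial_mult: "monomial \<alpha> x * monomial \<beta> x = monomial (\<lambda>l. \<alpha> l + \<beta> l) x"
  by (simp add: monomial_def power_add prod.distrib)

lemma polynomial_mult:
  assumes "polynomial q f" "polynomial q' g" shows "polynomial (q + q') (\<lambda>x. f x * g x)"
proof -
  obtain c c' where c: "\<And>x. f x = (\<Sum>\<alpha>\<in>exps q. c \<alpha> * monomial \<alpha> x)"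
    "\<And>x. g x = (\<Sum>\<alpha>\<in>exps q'. c' \<alpha> * monomial \<alpha> x)"
    using assms by (auto simp: polynomial_def)
  have "f x * g x = (\<Sum>\<alpha>\<in>exps q. \<Sum>\<beta>\<in>exps q'. (c \<alpha> * c' \<beta>) * monomial (\<lambda>l. \<alpha> l + \<beta> l) x)" for x
    unfolding c sum_product by (simp add: mult_ac flip: monomial_mult)
  then have "(\<lambda>x. f x * g x) = (\<lambda>x. \<Sum>\<alpha>\<in>exps q. \<Sum>\<beta>\<in>exps q'. (c \<alpha> * c' \<beta>) * monomial (\<lambda>l. \<alpha> l + \<beta> l) x)"
    by blast
  then show ?thesis
    by (simp only:) (intro polynomial_sum polynomial_cmult polynomial_monomial, auto simp: exps_iff intro: add_mono)
qed

lemma polynomial_power: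
  assumes "polynomial q f" shows "polynomial (k * q) (\<lambda>x. f x ^ k)"
  by (induction k) (use assms polynomial_mult in auto)

lemma polynomial_prod:
  assumes "finite I" "\<And>i. i \<in> I \<Longrightarrow> polynomial (q i) (f i)"
  shows "polynomial (\<Sum>i\<in>I. q i) (\<lambda>x. \<Prod>i\<in>I. f i x)"
  using assms by (induction I rule: finite_induct) (auto intro!: polynomial_mult)

lemma polynomial_coord: "polynomial 1 (\<lambda>x::complex^'n::finite. x $ i)"
proof -
  have "monomial (\<lambda>l. if l = i then 1 else 0) x = x $ i" for x :: "complex^'n::finite"
    unfolding monomial_def by (subst prod.remove[of UNIV i]) (auto intro: prod.neutral)
  moreover have "polynomial 1 (monomial (\<lambda>l::'n. if l = i then 1 else 0))"
    by (rule polynomial_monomial) (simp add: exps_iff)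
  ultimately show ?thesis
    unfolding polynomial_def by simp
qed

lemma polynomial_compose:
  assumes "polynomial q p" "\<And>l. polynomial r (\<lambda>x. f x $ l)"
  shows "polynomial (CARD('n) * q * r) (\<lambda>x. p (f x :: complex^'n::finite))"
proof -
  obtain c where c: "\<And>x. p x = (\<Sum>\<alpha>\<in>exps q. c \<alpha> * monomial \<alpha> x)"
    using assms by (auto simp: polynomial_def)
  have "polynomial (CARD('n) * q * r) (\<lambda>x. monomial \<alpha> (f x))" if "\<alpha> \<in> exps q" for \<alpha> :: "'n \<Rightarrow> nat"
  proof -
    have "polynomial (\<Sum>l\<in>UNIV. \<alpha> l * r) (\<lambda>x. \<Prod>l\<in>UNIV. (f x $ l) ^ \<alpha> l)"
      by (intro polynomial_prod polynomial_power assms) auto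
    moreover have "(\<Sum>l\<in>UNIV. \<alpha> l * r) \<le> (\<Sum>l\<in>(UNIV::'n set). q * r)"
      using that by (intro sum_mono mult_right_mono) (auto simp: exps_iff)
    ultimately show ?thesis
      unfolding monomial_def by (elim polynomial_mono) simp
  qed
  then have "polynomial (CARD('n) * q * r) (\<lambda>x. \<Sum>\<alpha>\<in>exps q. c \<alpha> * monomial \<alpha> (f x))"
    by (intro polynomial_sum polynomial_cmult)
  then show ?thesis by (simp add: c)
qed

lemma polynomial_det:
  fixes A :: "complex^'m::finite \<Rightarrow> complex^'n::finite^'n"
  assumes "\<And>i j. polynomial q (\<lambda>x. A x $ i $ j)"
  shows "polynomial (CARD('n) * q) (\<lambda>x. det (A x))"
proof -
  have "polynomial (\<Sum>i\<in>(UNIV::'n set). q) (\<lambda>x. \<Prod>i\<in>UNIV. A x $ i $ p i)" for p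
    by (intro polynomial_prod assms) auto
  then show ?thesis
    unfolding det_def by (intro polynomial_sum polynomial_cmult) simp
qed

section \<open>Zero sets of polynomials: complex lines, density of the complement, Lebesgue measure
  zero\<close>

lemma polynomial_on_line:
  assumes "polynomial q p"
  shows "\<exists>P. \<forall>\<zeta>. p (y + \<zeta> *s b) = poly P \<zeta>"
proof -
  obtain c where c: "\<And>x. p x = (\<Sum>\<alpha>\<in>exps q. c \<alpha> * monomial \<alpha> x)"
    using assms by (auto simp: polynomial_def)
  have "p (y + \<zeta> *s b) = poly (\<Sum>\<alpha>\<in>exps q. smult (c \<alpha>) (\<Prod>l\<in>UNIV. [:y $ l, b $ l:] ^ \<alpha> l)) \<zeta>" for \<zeta>
    by (simp add: c monomial_def poly_sum poly_prod)
  then show ?thesis by blast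
qed

lemma finite_zeros_on_line:
  assumes "polynomial q p" "p (y + \<zeta>0 *s b) \<noteq> 0"
  shows "finite {\<zeta>. p (y + \<zeta> *s b) = 0}"
proof -
  obtain P where P: "\<And>\<zeta>. p (y + \<zeta> *s b) = poly P \<zeta>"
    using polynomial_on_line[OF assms(1)] by blast
  have "P \<noteq> 0" using assms(2) P by auto
  then show ?thesis using poly_roots_finite[of P] by (simp add: P)
qed

lemma continuous_on_polynomial:
  assumes "polynomial q p" shows "continuous_on S p"
proof -
  obtain c where c: "p = (\<lambda>x. \<Sum>\<alpha>\<in>exps q. c \<alpha> * monomial \<alpha> x)"
    using assms by (auto simp: polynomial_def)
  show ?thesis unfolding c monomial_def by (intro continuous_intros)
qed

text \<open>The complex line from \<open>x\<close> to a point where \<open>p\<close> does not vanish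
  meets the zero set in finitely many parameters, so all but finitely many of the parameters
  \<open>1 / (n + 1)\<close> give points off the zero set, and these tend to
  \<open>x\<close>.\<close>

lemma closure_polynomial_nonzero:
  fixes p :: "complex^'n::finite \<Rightarrow> complex"
  assumes "polynomial q p" "p y \<noteq> 0"
  shows "closure {x. p x \<noteq> 0} = UNIV"
proof -
  have "x \<in> closure {x. p x \<noteq> 0}" for x
  proof -
    have "p (x + 1 *s (y - x)) \<noteq> 0" using assms by simp
    from finite_zeros_on_line[OF assms(1) this]
    have fin0: "finite {\<zeta>. p (x + \<zeta> *s (y - x)) = 0}" .
    then have fin: "finite {n::nat. p (x + of_real (1 / Suc n) *s (y - x)) = 0}"
    proof -
      have "inj (\<lambda>n::nat. complex_of_real (1 / Suc n))"
        by (rule injI) (simp only: of_real_eq_iff divide_cancel_left, simp)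
      from finite_vimageI[OF fin0 this] show ?thesis by (simp add: vimage_def)
    qed
    then have ev: "\<forall>\<^sub>F n in sequentially. p (x + of_real (1 / Suc n) *s (y - x)) \<noteq> 0"
      using eventually_cofinite[of "\<lambda>n. p (x + of_real (1 / Suc n) *s (y - x)) \<noteq> 0"]
      by (simp add: cofinite_eq_sequentially)
    have "(\<lambda>n. x + of_real (1 / Suc n) *s (y - x)) \<longlonglongrightarrow> x"
    proof (rule vec_tendstoI)
      fix i
      have "(\<lambda>n. (x + of_real (1 / Suc n) *s (y - x)) $ i) \<longlonglongrightarrow> x $ i + of_real 0 * (y $ i - x $ i)"
        unfolding vector_add_component vector_smult_component vector_minus_component
        by (intro tendsto_intros LIMSEQ_inverse_real_of_nat[unfolded inverse_eq_divide])
      then show "(\<lambda>n. (x + of_real (1 / Suc n) *s (y - x)) $ i) \<longlonglongrightarrow> x $ i" by simp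
    qed
    then show ?thesis
      by (rule Lim_in_closed_set[OF closed_closure, rotated 2])
        (use ev in \<open>auto elim!: eventually_mono intro!: closure_subset[THEN subsetD]\<close>)
  qed
  then show ?thesis by blast
qed

lemma borel_polynomial: "polynomial q p \<Longrightarrow> p \<in> borel_measurable borel"
  by (rule borel_measurable_continuous_onI) (rule continuous_on_polynomial)

text \<open>Every ray from a point where the polynomial does not vanish meets the zero set in finitely
  many points, so averaging over dilations about that point annihilates its volume.\<close>

lemma null_set_polynomial:
  fixes p :: "complex^'n::finite \<Rightarrow> complex"
  assumes p: "polynomial q p" "p a \<noteq> 0"
  shows "{x. p x = 0} \<in> null_sets lborel"
proof -
  have [measurable]: "p \<in> borel_measurable borel" using p by (rule_tac borel_polynomial)
  define S where "S = {x. p x = 0}"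
  have [measurable]: "S \<in> sets borel" unfolding S_def by measurable
  let ?T = "\<lambda>t::real. \<lambda>y. a + t *\<^sub>R (y - a)"
  \<comment> \<open>Change of variables for the dilation by \<open>t\<close> about \<open>a\<close>:
    if one dilated copy of \<open>S\<close> is null, so is \<open>S\<close>.\<close>
  have scale: "emeasure lborel S = ennreal (\<bar>t\<bar> ^ DIM(complex^'n)) * (\<integral>\<^sup>+y. indicator S (?T t y) \<partial>lborel)"
    if "t \<noteq> 0" for t
  proof -
    have eq: "?T t y = (a - t *\<^sub>R a) + t *\<^sub>R y" for y by (simp add: algebra_simps)
    show ?thesis
      unfolding eq
      by (subst lborel_affine[OF that, of "a - t *\<^sub>R a"])
        (simp add: emeasure_density nn_integral_density nn_integral_distr nn_integral_cmult
          flip: nn_integral_indicator)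
  qed
  have ray: "(\<integral>\<^sup>+t. indicator {1..2::real} t * indicator S (?T t y) \<partial>lborel) = 0" for y
  proof -
    have "p (a + 0 *s (y - a)) \<noteq> 0" using p by simp
    from finite_zeros_on_line[OF p(1) this] have "finite {t::complex. p (a + t *s (y - a)) = 0}" .
    moreover have "{t. ?T t y \<in> S} = of_real -` {t::complex. p (a + t *s (y - a)) = 0}"
      by (auto simp: S_def scaleR_vec_def vector_scalar_mult_def scaleR_conv_of_real)
    ultimately have "finite {t. ?T t y \<in> S}"
      using finite_vimageI[OF _ inj_of_real] by metis
    then have "{t. ?T t y \<in> S} \<in> null_sets lborel"
      by (rule finite_imp_null_set_lborel)
    then have "AE t in lborel. t \<notin> {t. ?T t y \<in> S}" by (rule AE_not_in)
    then have "AE t in lborel. indicator {1..2::real} t * indicator S (?T t y) = (0::ennreal)"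
      by eventually_elim auto
    then show ?thesis by (simp add: nn_integral_0_iff_AE)
  qed
  have "(\<integral>\<^sup>+t. indicator {1..2::real} t * (\<integral>\<^sup>+y. indicator S (?T t y) \<partial>lborel) \<partial>lborel)
     = (\<integral>\<^sup>+t. (\<integral>\<^sup>+y. indicator {1..2::real} t * indicator S (?T t y) \<partial>lborel) \<partial>lborel)"
    by (intro nn_integral_cong) (simp add: nn_integral_cmult)
  also have "\<dots> = (\<integral>\<^sup>+y. (\<integral>\<^sup>+t. indicator {1..2::real} t * indicator S (?T t y) \<partial>lborel) \<partial>lborel)"
    by (rule lborel_pair.Fubini') measurable
  also have "\<dots> = 0" by (simp add: ray)
  finally have AE: "AE t in lborel. indicator {1..2::real} t * (\<integral>\<^sup>+y. indicator S (?T t y) \<partial>lborel) = 0"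
    by (subst (asm) nn_integral_0_iff_AE) auto
  have not_AE: "\<not> (AE t in lborel. t \<notin> {1..2::real})"
    using AE_iff_null_sets[of "{1..2::real}" lborel] by (auto simp: null_sets_def)
  \<comment> \<open>Almost every \<open>t\<close> in the interval works by Fubini; the interval has
    positive measure and excludes 0, so some admissible nonzero \<open>t\<close> exists.\<close>
  have "\<exists>t\<in>{1..2}. (\<integral>\<^sup>+y. indicator S (?T t y) \<partial>lborel) = 0"
  proof (rule ccontr)
    assume nonzero: "\<not> ?thesis"
    from AE have "AE t in lborel. t \<notin> {1..2::real}"
    proof eventually_elim
      case (elim t)
      with nonzero show ?case by (auto simp: indicator_def split: if_splits)
    qed
    with not_AE show False ..
  qed
  then obtain t :: real where "t \<in> {1..2}" "(\<integral>\<^sup>+y. indicator S (?T t y) \<partial>lborel) = 0" by blast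
  then have "emeasure lborel S = 0" using scale[of t] by auto
  then show ?thesis by (auto simp: null_sets_def S_def[symmetric])
qed

section \<open>Sub-mean value inequalities on discs\<close>

text \<open>In the parameter of \<open>circlepath\<close>, the Cauchy kernel
  \<open>c'(t) / (c(t) - \<zeta>)\<close> is the constant \<open>2 pi i\<close>, so Cauchy's formula
  is the mean over \<open>{0..1}\<close>.\<close>

lemma holomorphic_circle_mean:
  assumes "f holomorphic_on ball \<zeta> R" "0 < r" "r < R"
  shows "((\<lambda>t. f (circlepath \<zeta> r t)) has_integral f \<zeta>) {0..1}"
proof -
  have "f holomorphic_on cball \<zeta> r"
    using assms by (auto intro: holomorphic_on_subset)
  from Cauchy_integral_circlepath_simple[OF this, of \<zeta>]
  have "((\<lambda>t. f (circlepath \<zeta> r t) / (circlepath \<zeta> r t - \<zeta>) *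
          vector_derivative (circlepath \<zeta> r) (at t within {0..1})) has_integral
          2 * of_real pi * \<i> * f \<zeta>) {0..1}"
    using assms by (simp add: has_contour_integral_def)
  then have "((\<lambda>t. 2 * of_real pi * \<i> * f (circlepath \<zeta> r t)) has_integral
          2 * of_real pi * \<i> * f \<zeta>) {0..1}"
    by (rule has_integral_eq[rotated])
      (use assms in \<open>simp add: vector_derivative_circlepath01, simp add: circlepath\<close>)
  from has_integral_mult_right[OF this, of "1 / (2 * of_real pi * \<i>)"] show ?thesis
    by simp
qed

lemma continuous_on_circlepath [continuous_intros]: "continuous_on S (circlepath \<zeta> r)"
  unfolding circlepath by (intro continuous_intros)

lemma circlepath_in_sphere: "0 \<le> r \<Longrightarrow> circlepath \<zeta> r t \<in> sphere \<zeta> r"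
  by (simp add: circlepath dist_norm norm_mult)

lemma continuous_on_circle:
  assumes "continuous_on S h" "cball \<zeta> r \<subseteq> S" "0 \<le> r"
  shows "continuous_on {0..1} (\<lambda>t. h (circlepath \<zeta> r t))"
proof -
  have "circlepath \<zeta> r ` {0..1} \<subseteq> S"
    using circlepath_in_sphere[OF assms(3), of \<zeta>] assms(2) by fastforce
  then show ?thesis
    using continuous_on_compose2[OF assms(1) continuous_on_circlepath] by blast
qed

section \<open>The maximum principle and submean inequality on the unit disc\<close>

definition locally_submean :: "(complex \<Rightarrow> real) \<Rightarrow> complex \<Rightarrow> bool" where
  "locally_submean h \<zeta> \<longleftrightarrow>
    (\<exists>r0>0. \<forall>r. 0 < r \<and> r < r0 \<longrightarrow> h \<zeta> \<le> integral {0..1} (\<lambda>t. h (circlepath \<zeta> r t)))"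

text \<open>At an interior maximum point the submean inequality forces \<open>h\<close> to equal its
  maximum on small circles. Among all maximum points take one with largest real part: it is interior
  if the maximum exceeds \<open>M\<close>, and the rightmost point of a small circle about it is a
  maximum point further to the right.\<close>

lemma maximum_principle:
  assumes cont: "continuous_on (cball 0 1) h"
    and sub: "\<And>\<zeta>. \<zeta> \<in> ball 0 1 \<Longrightarrow> locally_submean h \<zeta>"
    and bnd: "\<And>\<zeta>. \<zeta> \<in> sphere 0 1 \<Longrightarrow> h \<zeta> \<le> M"
  shows "h 0 \<le> M"
proof (rule ccontr)
  assume less: "\<not> h 0 \<le> M"
  obtain z where z: "z \<in> cball 0 1" "\<And>w. w \<in> cball 0 1 \<Longrightarrow> h w \<le> h z"
    using continuous_attains_sup[OF compact_cball _ cont] by auto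
  define K where "K = {w \<in> cball 0 1. h w = h z}"
  have "closed K" unfolding K_def
    by (intro continuous_closed_preimage_constant cont closed_cball)
  moreover have "K \<subseteq> cball 0 1" by (auto simp: K_def)
  ultimately have "compact K"
    by (metis bounded_cball bounded_subset compact_eq_bounded_closed)
  moreover have "z \<in> K" using z by (simp add: K_def)
  ultimately obtain w where w: "w \<in> K" "\<And>v. v \<in> K \<Longrightarrow> Re v \<le> Re w"
    using continuous_attains_sup[of K Re] continuous_on_Re[OF continuous_on_id] by blast
  have "h w > M" using z(2)[of 0] less w by (auto simp: K_def)
  with w bnd[of w] have wb: "w \<in> ball 0 1" by (force simp: K_def)
  obtain r0 where r0: "r0 > 0" "\<And>r. 0 < r \<Longrightarrow> r < r0 \<Longrightarrow> h w \<le> integral {0..1} (\<lambda>t. h (circlepath w r t))"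
    using sub[OF wb] by (auto simp: locally_submean_def)
  obtain r1 where r1: "r1 > 0" "cball w r1 \<subseteq> ball 0 1"
    using wb open_contains_cball by blast
  define r where "r = min r0 r1 / 2"
  have r: "0 < r" "r < r0" "r \<le> r1" using r0 r1 by (auto simp: r_def)
  have sub1: "cball w r \<subseteq> cball 0 1"
    using subset_cball[OF r(3), of w] r1(2) ball_subset_cball[of 0 1] by blast
  have cont': "continuous_on {0..1} (\<lambda>t. h (circlepath w r t))"
    by (rule continuous_on_circle[OF cont sub1]) (use r in auto)
  have mem: "circlepath w r t \<in> cball 0 1" for t
    using circlepath_in_sphere[of r w t] r sub1 by (metis less_imp_le sphere_cball subsetD)
  have le: "h (circlepath w r t) \<le> h z" for t
    using z(2)[OF mem] .
  have int: "integral {0..1} (\<lambda>t. h z - h (circlepath w r t)) = h z - integral {0..1} (\<lambda>t. h (circlepath w r t))"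
    using integrable_continuous_real[OF cont'] by (subst Henstock_Kurzweil_Integration.integral_diff) auto
  moreover have "integral {0..1} (\<lambda>t. h z - h (circlepath w r t)) \<ge> 0"
    using le by (intro integral_nonneg integrable_continuous_real continuous_intros cont') auto
  moreover have "h w = h z" using w by (simp add: K_def)
  ultimately have "integral {0..1} (\<lambda>t. h z - h (circlepath w r t)) = 0"
    using r0(2)[OF r(1,2)] by linarith
  moreover have "continuous_on {0..1} (\<lambda>t. h z - h (circlepath w r t))"
    by (intro continuous_intros cont')
  ultimately have "h z - h (circlepath w r 0) = 0"
    using integral_eq_0_iff[of 0 1 "\<lambda>t. h z - h (circlepath w r t)"] le by auto
  then have "circlepath w r 0 \<in> K" using mem by (auto simp: K_def)
  with w(2) have "Re (circlepath w r 0) \<le> Re w" by blast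
  then show False using r by (simp add: circlepath)
qed

text \<open>The class of boundary values of real parts of polynomials is closed under products because
  conjugation inverts on the unit circle, which makes it amenable to Stone--Weierstrass.\<close>

definition harmonic_trace :: "(complex \<Rightarrow> real) \<Rightarrow> bool" where
  "harmonic_trace f \<longleftrightarrow> (\<exists>p. \<forall>z\<in>sphere 0 1. f z = Re (poly p z))"

lemma harmonic_trace_add:
  assumes "harmonic_trace f" "harmonic_trace g" shows "harmonic_trace (\<lambda>z. f z + g z)"
proof -
  obtain p q where "\<forall>z\<in>sphere 0 1. f z = Re (poly p z)" "\<forall>z\<in>sphere 0 1. g z = Re (poly q z)"
    using assms by (auto simp: harmonic_trace_def)
  then show ?thesis unfolding harmonic_trace_def by (intro exI[of _ "p + q"]) simp
qed

lemma harmonic_trace_sum: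
  "(\<And>i. i \<in> I \<Longrightarrow> harmonic_trace (f i)) \<Longrightarrow> harmonic_trace (\<lambda>z. \<Sum>i\<in>I. f i z)"
proof (induction I rule: infinite_finite_induct)
  case (insert i I)
  then show ?case using harmonic_trace_add[of "f i" "\<lambda>z. \<Sum>i\<in>I. f i z"] by simp
qed (auto simp: harmonic_trace_def intro!: exI[of _ 0])

lemma harmonic_trace_Re_monom: "harmonic_trace (\<lambda>z. Re (c * z ^ a))"
  unfolding harmonic_trace_def by (intro exI[of _ "monom c a"]) (simp add: poly_monom)

lemma harmonic_trace_Re_cnj_monom: "harmonic_trace (\<lambda>z. Re (c * z ^ a * cnj (d * z ^ b)))"
proof (cases "b \<le> a")
  case True
  have "Re (c * z ^ a * cnj (d * z ^ b)) = Re (c * cnj d * z ^ (a - b))" if "z \<in> sphere 0 1" for z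
  proof -
    have "z * cnj z = 1" using that by (simp add: complex_norm_square[symmetric])
    then have "z ^ b * cnj z ^ b = 1" by (metis power_mult_distrib power_one)
    moreover have "z ^ a = z ^ (a - b) * z ^ b" using True by (simp flip: power_add)
    moreover have "c * (u * v) * cnj (d * v) = c * cnj d * u * (v * cnj v)" for u v by simp
    ultimately have "c * z ^ a * cnj (d * z ^ b) = c * cnj d * z ^ (a - b)"
      by (metis complex_cnj_power mult.right_neutral)
    then show ?thesis by (simp only:)
  qed
  then show ?thesis
    using harmonic_trace_Re_monom[of "c * cnj d" "a - b"] unfolding harmonic_trace_def by fastforce
next
  case False
  \<comment> \<open>For \<open>a < b\<close> the power of \<open>z\<close> would be negative;
    conjugating, which preserves the real part, makes it the positive power
    \<open>b - a\<close>.\<close>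
  have "Re (c * z ^ a * cnj (d * z ^ b)) = Re (cnj c * d * z ^ (b - a))" if "z \<in> sphere 0 1" for z
  proof -
    have "z * cnj z = 1" using that by (simp add: complex_norm_square[symmetric])
    then have "z ^ a * cnj z ^ a = 1" by (metis power_mult_distrib power_one)
    moreover have "z ^ b = z ^ (b - a) * z ^ a" using False by (simp flip: power_add)
    moreover have "cnj (c * u * cnj (d * (v * u))) = cnj c * d * v * (u * cnj u)" for u v by simp
    ultimately have "cnj (c * z ^ a * cnj (d * z ^ b)) = cnj c * d * z ^ (b - a)"
      by (metis complex_cnj_power mult.right_neutral)
    then show ?thesis by (metis cnj.sel(1))
  qed
  then show ?thesis
    using harmonic_trace_Re_monom[of "cnj c * d" "b - a"] unfolding harmonic_trace_def by fastforce
qed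

lemma harmonic_trace_mult:
  assumes "harmonic_trace f" "harmonic_trace g" shows "harmonic_trace (\<lambda>z. f z * g z)"
proof -
  obtain p q where f: "\<forall>z\<in>sphere 0 1. f z = Re (poly p z)" and g: "\<forall>z\<in>sphere 0 1. g z = Re (poly q z)"
    using assms by (auto simp: harmonic_trace_def)
  \<comment> \<open>From \<open>Re a * Re b = Re (a * cnj b) / 2 + Re (a * b) / 2\<close>:
    \<open>?A\<close> is the expansion of the first term into mixed monomials, while the second is
    already the real part of a polynomial.\<close>
  let ?A = "\<lambda>z. \<Sum>i\<le>degree p. \<Sum>j\<le>degree q. Re (coeff p i / 2 * z ^ i * cnj (coeff q j * z ^ j))"
  have 1: "harmonic_trace ?A"
    by (intro harmonic_trace_sum harmonic_trace_Re_cnj_monom)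
  have 2: "harmonic_trace (\<lambda>z. Re (poly (smult (1/2) (p * q)) z))"
    unfolding harmonic_trace_def by blast
  have eq: "f z * g z = ?A z + Re (poly (smult (1/2) (p * q)) z)" if "z \<in> sphere 0 1" for z
  proof -
    have "(\<Sum>i\<le>degree p. coeff p i / 2 * z ^ i) = poly p z / 2"
      by (simp add: poly_altdef sum_divide_distrib)
    moreover have "(\<Sum>j\<le>degree q. cnj (coeff q j * z ^ j)) = cnj (poly q z)"
      by (simp only: poly_altdef cnj_sum)
    moreover have "?A z = Re ((\<Sum>i\<le>degree p. coeff p i / 2 * z ^ i) * (\<Sum>j\<le>degree q. cnj (coeff q j * z ^ j)))"
      by (simp only: sum_product Re_sum)
    ultimately have "?A z = Re (poly p z / 2 * cnj (poly q z))"
      by (simp only:)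
    moreover have "Re a * Re b = Re (a / 2 * cnj b) + Re (1/2 * (a * b))" for a b
    proof -
      have "Re (a / 2 * cnj b) = (Re a * Re b + Im a * Im b) / 2"
        "Re (1/2 * (a * b)) = (Re a * Re b - Im a * Im b) / 2" by simp_all
      moreover have "X = (X + Y) / 2 + (X - Y) / 2" for X Y :: real by (simp add: field_simps)
      ultimately show ?thesis by metis
    qed
    moreover have "f z * g z = Re (poly p z) * Re (poly q z)" using f g that by simp
    ultimately show ?thesis by (simp only: poly_smult poly_mult)
  qed
  show ?thesis
    using harmonic_trace_add[OF 1 2] eq unfolding harmonic_trace_def by force
qed

lemma harmonic_trace_dense:
  assumes "continuous_on (sphere 0 1) h" "0 < e"
  shows "\<exists>p. \<forall>z\<in>sphere 0 1. \<bar>h z - Re (poly p z)\<bar> < e"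
proof -
  have "\<exists>g. harmonic_trace g \<and> (\<forall>z\<in>sphere 0 1. \<bar>h z - g z\<bar> < e)"
  proof (rule Stone_Weierstrass_HOL)
    show "harmonic_trace (\<lambda>x. c)" for c
      unfolding harmonic_trace_def by (intro exI[of _ "[:of_real c:]"]) simp
    show "continuous_on (sphere 0 1) f" if tr: "harmonic_trace f" for f
    proof -
      obtain p where p: "\<And>z. z \<in> sphere 0 1 \<Longrightarrow> f z = Re (poly p z)"
        using tr by (auto simp: harmonic_trace_def)
      have "continuous_on (sphere 0 1) (\<lambda>z. Re (poly p z))" by (intro continuous_intros)
      then show ?thesis using p by (metis (no_types, lifting) continuous_on_cong)
    qed
    show "\<exists>f. harmonic_trace f \<and> f x \<noteq> f y" if "x \<in> sphere 0 1 \<and> y \<in> sphere 0 1 \<and> x \<noteq> y" for x y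
    proof (cases "Re x = Re y")
      case True
      with that have "Re (- \<i> * x ^ 1) \<noteq> Re (- \<i> * y ^ 1)" using complex_eqI[of x y] by auto
      then show ?thesis using harmonic_trace_Re_monom[of "- \<i>" 1] by blast
    next
      case False
      then have "Re (1 * x ^ 1) \<noteq> Re (1 * y ^ 1)" by simp
      then show ?thesis using harmonic_trace_Re_monom[of 1 1] by blast
    qed
  qed (use assms in \<open>auto intro: harmonic_trace_add harmonic_trace_mult\<close>)
  then show ?thesis by (auto simp: harmonic_trace_def) metis
qed

lemma has_integral_Re: "(f has_integral y) S \<Longrightarrow> ((\<lambda>x. Re (f x)) has_integral Re y) S"
  using has_integral_linear[OF _ bounded_linear_Re, of f y S] by (simp add: o_def)

text \<open>Subharmonicity is local: compare with the harmonic polynomial approximating the boundary values.\<close>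

proposition submean_unit_disc:
  assumes cont: "continuous_on (cball 0 1) h"
    and sub: "\<And>\<zeta>. \<zeta> \<in> ball 0 1 \<Longrightarrow> locally_submean h \<zeta>"
  shows "h 0 \<le> integral {0..1} (\<lambda>t. h (circlepath 0 1 t))"
proof (rule field_le_epsilon)
  fix e :: real assume "0 < e"
  have "continuous_on (sphere 0 1) h" using cont by (rule continuous_on_subset) auto
  then obtain p where p: "\<And>z. z \<in> sphere 0 1 \<Longrightarrow> \<bar>h z - Re (poly p z)\<bar> < e / 2"
    using harmonic_trace_dense[of h "e / 2"] \<open>0 < e\<close> by (meson half_gt_zero)
  have mean: "((\<lambda>t. Re (poly p (circlepath \<zeta> r t))) has_integral Re (poly p \<zeta>)) {0..1}" if "0 < r" for \<zeta> r
    by (intro has_integral_Re holomorphic_circle_mean[of _ _ "r + 1"] holomorphic_intros) (use that in auto)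
  \<comment> \<open>The circle means of \<open>Re p\<close> are exact, so subtracting it keeps the
    submean property, and the maximum principle applies to a function that is at most
    \<open>e / 2\<close> on the unit circle.\<close>
  have "h 0 - Re (poly p 0) \<le> e / 2"
  proof (rule maximum_principle[where h = "\<lambda>z. h z - Re (poly p z)"])
    show "continuous_on (cball 0 1) (\<lambda>z. h z - Re (poly p z))" by (intro continuous_intros cont)
    show "h \<zeta> - Re (poly p \<zeta>) \<le> e / 2" if "\<zeta> \<in> sphere 0 1" for \<zeta>
      using p[OF that] by linarith
    fix \<zeta> :: complex assume \<zeta>: "\<zeta> \<in> ball 0 1"
    then obtain r0 where r0: "r0 > 0" "\<And>r. 0 < r \<Longrightarrow> r < r0 \<Longrightarrow> h \<zeta> \<le> integral {0..1} (\<lambda>t. h (circlepath \<zeta> r t))"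
      using sub by (force simp: locally_submean_def)
    obtain r1 where r1: "r1 > 0" "cball \<zeta> r1 \<subseteq> ball 0 1" using \<zeta> open_contains_cball by blast
    show "locally_submean (\<lambda>z. h z - Re (poly p z)) \<zeta>"
      unfolding locally_submean_def
    proof (intro exI[of _ "min r0 r1"] conjI allI impI)
      fix r assume r: "0 < r \<and> r < min r0 r1"
      have "cball \<zeta> r \<subseteq> cball \<zeta> r1" using r by auto
      then have "cball \<zeta> r \<subseteq> cball 0 1" using r1 by (meson ball_subset_cball order.trans)
      then have "(\<lambda>t. h (circlepath \<zeta> r t)) integrable_on {0..1}"
        using r by (intro integrable_continuous_real continuous_on_circle[OF cont]) simp_all
      from Henstock_Kurzweil_Integration.integral_diff[OF this has_integral_integrable[OF mean[of r \<zeta>]]]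
      show "h \<zeta> - Re (poly p \<zeta>) \<le> integral {0..1} (\<lambda>t. h (circlepath \<zeta> r t) - Re (poly p (circlepath \<zeta> r t)))"
        using integral_unique[OF mean[of r \<zeta>]] r r0(2)[of r] by simp
    qed (use r0 r1 in auto)
  qed
  moreover have "Re (poly p 0) \<le> integral {0..1} (\<lambda>t. h (circlepath 0 1 t)) + e / 2"
  proof -
    have int: "(\<lambda>t. h (circlepath 0 1 t)) integrable_on {0..1}"
      by (intro integrable_continuous_real continuous_on_circle[OF cont]) auto
    have "((\<lambda>t. h (circlepath 0 1 t) + e / 2) has_integral integral {0..1} (\<lambda>t. h (circlepath 0 1 t)) + e / 2) {0..1}"
      using has_integral_add[OF integrable_integral[OF int] has_integral_const_real[of "e/2" 0 1]] by simp
    then show ?thesis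
    proof (rule has_integral_le[OF mean[of 1 0], rotated])
      show "Re (poly p (circlepath 0 1 t)) \<le> h (circlepath 0 1 t) + e / 2" for t
        using p[OF circlepath_in_sphere[OF zero_le_one]] by (smt (verit))
    qed simp
  qed
  ultimately show "h 0 \<le> integral {0..1} (\<lambda>t. h (circlepath 0 1 t)) + e" by linarith
qed

text \<open>A zero-free holomorphic function on a disc has a holomorphic logarithm, whose real part
  is \<open>ln |f|\<close>.\<close>

lemma ln_cmod_circle_mean:
  assumes "f holomorphic_on ball \<zeta> R" "\<And>z. z \<in> ball \<zeta> R \<Longrightarrow> f z \<noteq> 0" "0 < r" "r < R"
  shows "((\<lambda>t. ln (cmod (f (circlepath \<zeta> r t)))) has_integral ln (cmod (f \<zeta>))) {0..1}"
proof -
  obtain g where g: "g holomorphic_on ball \<zeta> R" "\<And>z. z \<in> ball \<zeta> R \<Longrightarrow> f z = exp (g z)"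
    using contractible_imp_holomorphic_log[OF assms(1)] convex_imp_contractible assms(2) by blast
  have eq: "ln (cmod (f z)) = Re (g z)" if "z \<in> ball \<zeta> R" for z
    using g(2)[OF that] by simp
  have "circlepath \<zeta> r t \<in> ball \<zeta> R" for t
    using circlepath_in_sphere[of r \<zeta> t] assms by auto
  moreover have "\<zeta> \<in> ball \<zeta> R" using assms by auto
  ultimately show ?thesis
    using has_integral_Re[OF holomorphic_circle_mean[OF g(1) assms(3,4)]] by (simp add: eq)
qed

section \<open>Homogeneous polynomial maps\<close>

text \<open>Complex linearity of the derivative is recorded together with polynomiality of the
  partial derivatives, because the Jacobian determinant must itself be a polynomial.\<close>

definition polynomially_differentiable :: "(complex^'n::finite \<Rightarrow> complex) \<Rightarrow> bool" where
  "polynomially_differentiable p \<longleftrightarrow>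
    (\<exists>q p'. polynomial q p \<and> (\<forall>j. polynomial q (p' j)) \<and>
      (\<forall>x. (p has_derivative (\<lambda>h. \<Sum>j\<in>UNIV. p' j x * h $ j)) (at x)))"

lemma polynomially_differentiable_const: "polynomially_differentiable (\<lambda>_. c)"
  unfolding polynomially_differentiable_def
  by (intro exI[of _ 0] exI[of _ "\<lambda>_ _. 0"]) simp

lemma polynomially_differentiable_coord: "polynomially_differentiable (\<lambda>x::complex^'n::finite. x $ i)"
  unfolding polynomially_differentiable_def
proof (intro exI[of _ 1] exI[of _ "\<lambda>j _. if j = i then 1 else 0"] conjI allI)
  show "((\<lambda>x::complex^'n. x $ i) has_derivative (\<lambda>h. \<Sum>j\<in>UNIV. (if j = i then 1 else 0) * h $ j)) (at x)" for x
    by (simp add: if_distrib if_distribR sum.delta cong: if_cong)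
      (rule bounded_linear_imp_has_derivative[OF bounded_linear_vec_nth])
qed (use polynomial_coord in auto)

lemma polynomially_differentiable_add:
  assumes "polynomially_differentiable f" "polynomially_differentiable g"
  shows "polynomially_differentiable (\<lambda>x. f x + g x)"
proof -
  obtain q1 f' where f: "polynomial q1 f" "\<And>j. polynomial q1 (f' j)"
    "\<And>x. (f has_derivative (\<lambda>h. \<Sum>j\<in>UNIV. f' j x * h $ j)) (at x)"
    using assms(1) by (auto simp: polynomially_differentiable_def)
  obtain q2 g' where g: "polynomial q2 g" "\<And>j. polynomial q2 (g' j)"
    "\<And>x. (g has_derivative (\<lambda>h. \<Sum>j\<in>UNIV. g' j x * h $ j)) (at x)"
    using assms(2) by (auto simp: polynomially_differentiable_def)
  show ?thesis unfolding polynomially_differentiable_def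
  proof (intro exI[of _ "q1 + q2"] exI[of _ "\<lambda>j x. f' j x + g' j x"] conjI allI polynomial_add)
    show "((\<lambda>x. f x + g x) has_derivative (\<lambda>h. \<Sum>j\<in>UNIV. (f' j x + g' j x) * h $ j)) (at x)" for x
      by (rule has_derivative_eq_rhs[OF has_derivative_add[OF f(3) g(3)]])
        (simp add: fun_eq_iff algebra_simps sum.distrib)
  qed (use polynomial_mono[OF f(1)] polynomial_mono[OF f(2)] polynomial_mono[OF g(1)] polynomial_mono[OF g(2)] in auto)
qed

lemma polynomially_differentiable_mult:
  assumes "polynomially_differentiable f" "polynomially_differentiable g"
  shows "polynomially_differentiable (\<lambda>x. f x * g x)"
proof -
  obtain q1 f' where f: "polynomial q1 f" "\<And>j. polynomial q1 (f' j)"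
    "\<And>x. (f has_derivative (\<lambda>h. \<Sum>j\<in>UNIV. f' j x * h $ j)) (at x)"
    using assms(1) by (auto simp: polynomially_differentiable_def)
  obtain q2 g' where g: "polynomial q2 g" "\<And>j. polynomial q2 (g' j)"
    "\<And>x. (g has_derivative (\<lambda>h. \<Sum>j\<in>UNIV. g' j x * h $ j)) (at x)"
    using assms(2) by (auto simp: polynomially_differentiable_def)
  show ?thesis unfolding polynomially_differentiable_def
  proof (intro exI[of _ "q1 + q2"] exI[of _ "\<lambda>j x. f x * g' j x + f' j x * g x"] conjI allI polynomial_add polynomial_mult)
    show "((\<lambda>x. f x * g x) has_derivative (\<lambda>h. \<Sum>j\<in>UNIV. (f x * g' j x + f' j x * g x) * h $ j)) (at x)" for x
      by (rule has_derivative_eq_rhs[OF has_derivative_mult[OF f(3) g(3)]])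
        (simp add: fun_eq_iff algebra_simps sum.distrib sum_distrib_left)
  qed (use f g in auto)
qed

lemma polynomially_differentiable_sum:
  "(\<And>i. i \<in> I \<Longrightarrow> polynomially_differentiable (f i)) \<Longrightarrow> polynomially_differentiable (\<lambda>x. \<Sum>i\<in>I. f i x)"
proof (induction I rule: infinite_finite_induct)
  case (insert i I)
  then show ?case using polynomially_differentiable_add[of "f i" "\<lambda>x. \<Sum>i\<in>I. f i x"] by simp
qed (auto simp: polynomially_differentiable_const)

lemma polynomially_differentiable_prod:
  "(\<And>i. i \<in> I \<Longrightarrow> polynomially_differentiable (f i)) \<Longrightarrow> polynomially_differentiable (\<lambda>x. \<Prod>i\<in>I. f i x)"
proof (induction I rule: infinite_finite_induct)
  case (insert i I)
  then show ?case using polynomially_differentiable_mult[of "f i" "\<lambda>x. \<Prod>i\<in>I. f i x"] by simp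
qed (auto simp: polynomially_differentiable_const)

lemma polynomially_differentiable_power:
  "polynomially_differentiable f \<Longrightarrow> polynomially_differentiable (\<lambda>x. f x ^ k)"
  by (induction k) (auto intro: polynomially_differentiable_const polynomially_differentiable_mult)

lemma polynomial_imp_polynomially_differentiable:
  assumes "polynomial q p" shows "polynomially_differentiable p"
proof -
  obtain c where c: "p = (\<lambda>x. \<Sum>\<alpha>\<in>exps q. c \<alpha> * monomial \<alpha> x)"
    using assms by (auto simp: polynomial_def)
  show ?thesis unfolding c monomial_def
    by (intro polynomially_differentiable_sum polynomially_differentiable_mult polynomially_differentiable_const
        polynomially_differentiable_prod polynomially_differentiable_power polynomially_differentiable_coord)
qed

lemma has_derivative_vec_componentwise:
  fixes F :: "'a::real_normed_vector \<Rightarrow> complex^'m::finite"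
  assumes "\<And>i. ((\<lambda>x. F x $ i) has_derivative (\<lambda>h. D h $ i)) (at x)"
  shows "(F has_derivative D) (at x)"
proof (subst has_derivative_componentwise_within, intro ballI)
  fix b :: "complex^'m" assume "b \<in> Basis"
  then obtain i c where b: "b = axis i c" by (auto simp: Basis_vec_def)
  show "((\<lambda>x. F x \<bullet> b) has_derivative (\<lambda>h. D h \<bullet> b)) (at x)"
    unfolding b inner_axis by (intro has_derivative_inner_left assms)
qed

lemma polynomial_map_jacobian:
  fixes F :: "complex^'n::finite \<Rightarrow> complex^'n"
  assumes "\<And>i. polynomial q (\<lambda>x. F x $ i)"
  shows "\<exists>q' A. (\<forall>i j. polynomial q' (\<lambda>x. A x $ i $ j)) \<and>
    (\<forall>x. (F has_derivative (\<lambda>h. A x *v h)) (at x))"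
proof -
  have "\<forall>i. \<exists>q p'. (\<forall>j. polynomial q (p' j)) \<and>
      (\<forall>x. ((\<lambda>x. F x $ i) has_derivative (\<lambda>h. \<Sum>j\<in>UNIV. p' j x * h $ j)) (at x))"
    using polynomial_imp_polynomially_differentiable[OF assms]
    unfolding polynomially_differentiable_def by blast
  then obtain qq p' where "\<forall>i. (\<forall>j. polynomial (qq i) (p' i j)) \<and>
      (\<forall>x. ((\<lambda>x. F x $ i) has_derivative (\<lambda>h. \<Sum>j\<in>UNIV. p' i j x * h $ j)) (at x))"
    unfolding choice_iff by blast
  then have p': "\<And>i j. polynomial (qq i) (p' i j)"
      "\<And>i x. ((\<lambda>x. F x $ i) has_derivative (\<lambda>h. \<Sum>j\<in>UNIV. p' i j x * h $ j)) (at x)"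
    by blast+
  define A where "A x = (\<chi> i j. p' i j x)" for x
  have "polynomial (sum qq UNIV) (\<lambda>x. A x $ i $ j)" for i j
    unfolding A_def by simp (rule polynomial_mono[OF p'(1)], simp add: member_le_sum)
  moreover have "(F has_derivative (\<lambda>h. A x *v h)) (at x)" for x
    by (rule has_derivative_vec_componentwise)
      (use p'(2) in \<open>simp add: A_def matrix_vector_mult_def\<close>)
  ultimately show ?thesis by blast
qed

text \<open>Removing finitely many points does not disconnect the complex plane. This is the source
  of the constancy of the number of preimages.\<close>

lemma finite_zeros_line_connected:
  assumes "polynomial q p" "p (y + \<zeta>0 *s b) \<noteq> 0"
  shows "connected {\<zeta>. p (y + \<zeta> *s b) \<noteq> 0}"
proof -
  have "{\<zeta>. p (y + \<zeta> *s b) \<noteq> 0} = - {\<zeta>. p (y + \<zeta> *s b) = 0}" by auto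
  moreover have "path_connected (- {\<zeta>. p (y + \<zeta> *s b) = 0})"
    by (intro path_connected_complement_countable countable_finite finite_zeros_on_line[OF assms]) auto
  ultimately show ?thesis using path_connected_imp_connected by metis
qed

lemma matrix_inv_cancel:
  assumes "invertible M" shows "M ** matrix_inv M = mat 1" "matrix_inv M ** M = mat 1"
  using someI_ex[OF assms[unfolded invertible_def]] by (auto simp: matrix_inv_def)

lemma linear_inverse_matrix_inv:
  fixes M :: "complex^'n::finite^'n"
  assumes "bij ((*v) M)" shows "inv ((*v) M) = (*v) (matrix_inv M)"
proof (rule inv_unique_comp)
  have "invertible M"
    using assms by (simp add: invertible_left_inverse matrix_left_invertible_injective bij_is_inj)
  then have "M ** matrix_inv M = mat 1" "matrix_inv M ** M = mat 1"
    by (auto simp: matrix_inv_cancel)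
  then show "(*v) M \<circ> (*v) (matrix_inv M) = id" "(*v) (matrix_inv M) \<circ> (*v) M = id"
    by (auto simp: fun_eq_iff matrix_vector_mul_assoc)
qed

lemma norm_vsmult: "norm (c *s x) = cmod c * norm (x :: complex^'n::finite)"
  by (simp add: norm_vec_def L2_set_mult_ineq norm_mult L2_set_right_distrib[symmetric])

lemma continuous_on_vsmult [continuous_intros]:
  fixes f :: "_ \<Rightarrow> complex" and g :: "_ \<Rightarrow> complex^'n::finite"
  assumes "continuous_on S f" "continuous_on S g" shows "continuous_on S (\<lambda>x. f x *s g x)"
  unfolding vector_scalar_mult_def by (intro continuous_intros assms)

lemma norm_normalize_eq_1: "x \<noteq> 0 \<Longrightarrow> norm (of_real (1 / norm x) *s (x :: complex^'n::finite)) = 1"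
  by (simp add: norm_vsmult norm_divide)

section \<open>Homogeneous maps without indeterminacy as coverings over their regular values\<close>

text \<open>Made for the iterated lifts, with \<open>e = d ^ n\<close>. The assumption
  \<open>eq_0_imp\<close> says that there are no indeterminacy points, and makes the map proper;
  \<open>A\<close> is the complex Jacobian matrix.\<close>

locale homogeneous_map =
  fixes F :: "complex^'n::finite \<Rightarrow> complex^'n" and e q q' :: nat and A :: "complex^'n \<Rightarrow> complex^'n^'n"
  assumes e_pos: "0 < e"
    and homogeneous: "F (c *s x) = c ^ e *s F x"
    and eq_0_imp: "F x = 0 \<Longrightarrow> x = 0"
    and polynomial_F: "polynomial q (\<lambda>x. F x $ i)"
    and polynomial_A: "polynomial q' (\<lambda>x. A x $ i $ j)"
    and has_derivative_F: "(F has_derivative (\<lambda>h. A x *v h)) (at x)"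
begin

lemma F_0 [simp]: "F 0 = 0"
  using homogeneous[of 0 0] e_pos by (simp add: power_0_left)

lemma F_eq_0_iff [simp]: "F x = 0 \<longleftrightarrow> x = 0"
  using eq_0_imp by auto

lemma continuous_on_F [continuous_intros]: "continuous_on S f \<Longrightarrow> continuous_on S (\<lambda>x. F (f x))"
  by (rule continuous_on_compose2[of UNIV F])
    (auto intro!: has_derivative_continuous_on has_derivative_at_withinI[OF has_derivative_F])

text \<open>The minimum of \<open>|F|\<close> on the unit sphere is positive by compactness, and
  homogeneity spreads this bound to the whole space.\<close>

lemma growth: "\<exists>c>0. \<forall>x. norm (F x) \<ge> c * norm x ^ e"
proof -
  have ne: "(SOME b. b \<in> Basis) \<in> sphere (0::complex^'n) 1" by (simp add: norm_Basis SOME_Basis)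
  have "continuous_on (sphere 0 1) (\<lambda>x. norm (F x))" by (intro continuous_intros)
  then obtain a where a: "a \<in> sphere 0 1" "\<And>x. x \<in> sphere 0 1 \<Longrightarrow> norm (F a) \<le> norm (F x)"
    using continuous_attains_inf[OF compact_sphere, of 0 1 "\<lambda>x. norm (F x)"] ne by blast
  have "norm (F a) * norm x ^ e \<le> norm (F x)" for x
  proof (cases "x = 0")
    case False
    have "norm (F a) \<le> norm (F (of_real (1 / norm x) *s x))"
      using False by (intro a(2)) (simp add: norm_vsmult norm_divide)
    then show ?thesis using False
      by (simp add: homogeneous norm_vsmult norm_power norm_divide field_simps)
  qed (use e_pos in \<open>simp add: power_0_left\<close>)
  moreover have "norm (F a) > 0" using a(1) by auto
  ultimately show ?thesis by blast
qed

lemma bounded_vimage: "bounded S \<Longrightarrow> bounded (F -` S)"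
proof -
  assume "bounded S"
  then obtain M where M: "\<And>y. y \<in> S \<Longrightarrow> norm y \<le> M" by (auto simp: bounded_iff)
  obtain c where c: "c > 0" "\<And>x. norm (F x) \<ge> c * norm x ^ e" using growth by blast
  have "norm x \<le> max 1 (M / c)" if "F x \<in> S" for x
  proof (cases "norm x \<le> 1")
    case False
    then have "norm x \<le> norm x ^ e" using e_pos by (intro self_le_power) auto
    also have "\<dots> \<le> M / c" using c(1) c(2)[of x] M[OF that] by (simp add: field_simps)
    finally show ?thesis by simp
  qed auto
  then show ?thesis by (auto simp: bounded_iff)
qed

text \<open>Properness: preimages of a convergent sequence stay bounded, so a subsequence converges
  inside \<open>S\<close>.\<close>

lemma closed_image: assumes "closed S" shows "closed (F ` S)"
  unfolding closed_sequential_limits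
proof (intro allI impI)
  fix y l assume yl: "(\<forall>n. y n \<in> F ` S) \<and> y \<longlonglongrightarrow> l"
  then have "\<forall>n. \<exists>x. x \<in> S \<and> y n = F x" by blast
  then obtain x where "\<forall>n. x n \<in> S \<and> y n = F (x n)" unfolding choice_iff by blast
  then have x: "\<And>n. x n \<in> S" "\<And>n. y n = F (x n)" by blast+
  have "bounded (range y)" using yl convergent_imp_bounded by blast
  then have "bounded (range x)"
    by (rule bounded_subset[OF bounded_vimage]) (auto simp: x(2))
  then obtain a r where a: "strict_mono r" "(x \<circ> r) \<longlonglongrightarrow> a"
    using bounded_imp_convergent_subsequence by blast
  have "a \<in> S" using closed_sequentially[OF assms _ a(2)] x(1) by auto
  have "(\<lambda>n. F ((x \<circ> r) n)) \<longlonglongrightarrow> F a"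
    using continuous_on_tendsto_compose[OF continuous_on_F[OF continuous_on_id, of UNIV] a(2)] by simp
  moreover have "(\<lambda>n. F ((x \<circ> r) n)) \<longlonglongrightarrow> l"
    using LIMSEQ_subseq_LIMSEQ[of y l r] yl a(1) x(2) by (simp add: o_def)
  ultimately have "F a = l" by (rule LIMSEQ_unique)
  then show "l \<in> F ` S" using \<open>a \<in> S\<close> by blast
qed

text \<open>A point outside the image counts as regular. That fibres over regular points are
  nonempty for large \<open>n\<close> will come from the mass of the limit measure.\<close>

definition reg :: "(complex^'n) set" where
  "reg = {y. y \<noteq> 0 \<and> (\<forall>x. F x = y \<longrightarrow> det (A x) \<noteq> 0)}"

lemma continuous_on_det_A: "continuous_on S (\<lambda>x. det (A x))"
  by (rule continuous_on_polynomial[OF polynomial_det[OF polynomial_A]])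

lemma open_reg: "open reg"
proof -
  have "closed {x. det (A x) = 0}"
    using continuous_closed_preimage_constant[OF continuous_on_det_A closed_UNIV] by simp
  then have "closed (F ` {x. det (A x) = 0} \<union> {0})" by (intro closed_Un closed_image) auto
  moreover have "reg = - (F ` {x. det (A x) = 0} \<union> {0})" by (auto simp: reg_def)
  ultimately show ?thesis by auto
qed

text \<open>The derivative of the inverse is given by a complex matrix, so a local branch composed
  with a complex line is holomorphic.\<close>

lemma local_inverse:
  assumes "det (A x0) \<noteq> 0"
  obtains U V g where "open U" "x0 \<in> U" "open V" "F x0 \<in> V" "homeomorphism U V F g"
    "\<And>y. y \<in> V \<Longrightarrow> (g has_derivative (\<lambda>h. matrix_inv (A (g y)) *v h)) (at y)"
proof -
  define F' where "F' x = Blinfun ((*v) (A x))" for x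
  have app: "blinfun_apply (F' x) = (*v) (A x)" for x
    unfolding F'_def by (simp add: bounded_linear_Blinfun_apply)
  have cont: "continuous_on UNIV F'"
  proof (rule continuous_on_blinfun_componentwise)
    fix i :: "complex^'n"
    show "continuous_on UNIV (\<lambda>x. blinfun_apply (F' x) i)"
      unfolding app matrix_vector_mult_def
      by (intro continuous_intros continuous_on_polynomial[OF polynomial_A])
  qed
  have inv: "invertible (A x0)" using assms by (simp add: invertible_det_nz)
  have invF': "Blinfun ((*v) (matrix_inv (A x0))) o\<^sub>L F' x0 = id_blinfun"
    by (rule blinfun_eqI)
      (use inv in \<open>simp add: app bounded_linear_Blinfun_apply matrix_vector_mul_assoc matrix_inv_cancel\<close>)
  have der: "(F has_derivative blinfun_apply (F' x)) (at x)" for x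
    unfolding app by (rule has_derivative_F)
  obtain U V g g' where g: "open U" "x0 \<in> U" "open V" "F x0 \<in> V" "homeomorphism U V F g"
    "\<And>y. y \<in> V \<Longrightarrow> (g has_derivative (g' y)) (at y)"
    "\<And>y. y \<in> V \<Longrightarrow> g' y = inv (blinfun_apply (F' (g y)))"
    "\<And>y. y \<in> V \<Longrightarrow> bij (blinfun_apply (F' (g y)))"
    using inverse_function_theorem[OF open_UNIV der cont UNIV_I invF'] by (metis (no_types, lifting))
  show ?thesis
  proof (rule that[OF g(1-5)])
    show "(g has_derivative (\<lambda>h. matrix_inv (A (g y)) *v h)) (at y)" if "y \<in> V" for y
      using g(6,7)[OF that] linear_inverse_matrix_inv[OF g(8)[OF that, unfolded app]] by (simp add: app)
  qed
qed

text \<open>The fibre is compact by properness and discrete by local injectivity.\<close>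

lemma finite_fibre: assumes "y \<in> reg" shows "finite (F -` {y})"
proof -
  have "\<exists>U. open U \<and> x \<in> U \<and> F -` {y} \<inter> U \<subseteq> {x}" if x: "x \<in> F -` {y}" for x
  proof -
    have "det (A x) \<noteq> 0" using assms x by (auto simp: reg_def)
    then obtain U V g where "open U" "x \<in> U" "homeomorphism U V F g"
      using local_inverse by metis
    then show ?thesis using x by (intro exI[of _ U]) (auto simp: homeomorphism_def, metis)
  qed
  then obtain U where U: "\<And>x. x \<in> F -` {y} \<Longrightarrow> open (U x) \<and> x \<in> U x \<and> F -` {y} \<inter> U x \<subseteq> {x}"
    by metis
  have "closed (F -` {y})"
    using continuous_closed_vimage[of "{y}" F] continuous_on_F[OF continuous_on_id, of UNIV]
    by (simp add: continuous_on_eq_continuous_at)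
  then have "compact (F -` {y})"
    by (simp add: compact_eq_bounded_closed bounded_vimage)
  then obtain D where D: "D \<subseteq> F -` {y}" "finite D" "F -` {y} \<subseteq> (\<Union>x\<in>D. U x)"
    by (rule compactE_image[where C = "F -` {y}" and f = U]) (use U in auto)
  have "F -` {y} \<subseteq> D"
  proof
    fix x assume x: "x \<in> F -` {y}"
    then obtain d where "d \<in> D" "x \<in> U d" using D by blast
    then have "x = d" using U[of d] D x by blast
    then show "x \<in> D" using \<open>d \<in> D\<close> by simp
  qed
  then show ?thesis using D finite_subset by blast
qed

lemma covering:
  assumes y: "y \<in> reg"
  obtains W g B where "open W" "y \<in> W" "W \<subseteq> reg"
    "\<And>z. z \<in> W \<Longrightarrow> F -` {z} = (\<lambda>x. g x z) ` (F -` {y})"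
    "\<And>z. z \<in> W \<Longrightarrow> inj_on (\<lambda>x. g x z) (F -` {y})"
    "\<And>x z. x \<in> F -` {y} \<Longrightarrow> z \<in> W \<Longrightarrow> (g x has_derivative (\<lambda>h. B x z *v h)) (at z)"
proof -
  let ?X = "F -` {y}"
  have "\<exists>U V g. open U \<and> x \<in> U \<and> open V \<and> y \<in> V \<and> homeomorphism U V F g \<and>
    (\<forall>z\<in>V. (g has_derivative (\<lambda>h. matrix_inv (A (g z)) *v h)) (at z))" if x: "x \<in> ?X" for x
  proof -
    have "det (A x) \<noteq> 0" using assms x by (auto simp: reg_def)
    then obtain U V g where "open U" "x \<in> U" "open V" "F x \<in> V" "homeomorphism U V F g"
      "\<And>y. y \<in> V \<Longrightarrow> (g has_derivative (\<lambda>h. matrix_inv (A (g y)) *v h)) (at y)"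
      using local_inverse by metis
    then show ?thesis using x by (intro exI[of _ U] exI[of _ V] exI[of _ g]) auto
  qed
  then have "\<forall>x. \<exists>U V g. x \<in> ?X \<longrightarrow> open U \<and> x \<in> U \<and> open V \<and> y \<in> V \<and> homeomorphism U V F g \<and>
    (\<forall>z\<in>V. (g has_derivative (\<lambda>h. matrix_inv (A (g z)) *v h)) (at z))" by blast
  then obtain U V g where "\<forall>x. x \<in> ?X \<longrightarrow> open (U x) \<and> x \<in> U x \<and> open (V x) \<and> y \<in> V x \<and>
    homeomorphism (U x) (V x) F (g x) \<and>
    (\<forall>z\<in>V x. (g x has_derivative (\<lambda>h. matrix_inv (A (g x z)) *v h)) (at z))"
    unfolding choice_iff by blast
  then have UVg: "\<And>x. x \<in> ?X \<Longrightarrow> open (U x)" "\<And>x. x \<in> ?X \<Longrightarrow> x \<in> U x"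
      "\<And>x. x \<in> ?X \<Longrightarrow> open (V x)" "\<And>x. x \<in> ?X \<Longrightarrow> y \<in> V x" "\<And>x. x \<in> ?X \<Longrightarrow> homeomorphism (U x) (V x) F (g x)"
      "\<And>x z. x \<in> ?X \<Longrightarrow> z \<in> V x \<Longrightarrow> (g x has_derivative (\<lambda>h. matrix_inv (A (g x z)) *v h)) (at z)"
    by blast+
  have fin: "finite ?X" by (rule finite_fibre[OF y])
  have gy: "g x y = x" if "x \<in> ?X" for x
    using UVg(2,5)[OF that] that by (auto simp: homeomorphism_def)
  have 1: "\<forall>\<^sub>F z in nhds y. \<forall>x\<in>?X. z \<in> V x"
    using UVg(3,4) fin by (intro eventually_ball_finite) (auto intro: eventually_nhds_in_open)
  have 2: "\<forall>\<^sub>F z in nhds y. \<forall>x\<in>?X. \<forall>x'\<in>?X. x \<noteq> x' \<longrightarrow> g x z \<noteq> g x' z"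
  proof (intro eventually_ball_finite ballI fin)
    fix x x' assume x: "x \<in> ?X" "x' \<in> ?X"
    show "\<forall>\<^sub>F z in nhds y. x \<noteq> x' \<longrightarrow> g x z \<noteq> g x' z"
    proof (cases "x = x'")
      case False
      have "isCont (g w) y" if "w \<in> ?X" for w
        using UVg(6)[OF that UVg(4)[OF that]] has_derivative_continuous by blast
      then have "((\<lambda>z. g x z - g x' z) \<longlongrightarrow> g x y - g x' y) (nhds y)"
        using x unfolding isCont_def tendsto_at_iff_tendsto_nhds by (intro tendsto_diff) auto
      then have "\<forall>\<^sub>F z in nhds y. g x z - g x' z \<noteq> 0"
        by (rule tendsto_imp_eventually_ne) (use gy x False in auto)
      then show ?thesis by eventually_elim auto
    qed auto
  qed
  have "closed (F ` (- (\<Union>x\<in>?X. U x)))" using UVg(1) by (intro closed_image) auto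
  moreover have "y \<notin> F ` (- (\<Union>x\<in>?X. U x))" using UVg(2) by auto
  ultimately have "\<forall>\<^sub>F z in nhds y. z \<in> - F ` (- (\<Union>x\<in>?X. U x))"
    using eventually_nhds_in_open[OF open_Compl, of "F ` (- (\<Union>x\<in>?X. U x))" y] by blast
  then have 3: "\<forall>\<^sub>F z in nhds y. z \<notin> F ` (- (\<Union>x\<in>?X. U x))"
    by (simp only: Compl_iff)
  have 4: "\<forall>\<^sub>F z in nhds y. z \<in> reg" by (rule eventually_nhds_in_open[OF open_reg y])
  define P where "P z \<longleftrightarrow> (\<forall>x\<in>?X. z \<in> V x) \<and> (\<forall>x\<in>?X. \<forall>x'\<in>?X. x \<noteq> x' \<longrightarrow> g x z \<noteq> g x' z) \<and>
      z \<notin> F ` (- (\<Union>x\<in>?X. U x)) \<and> z \<in> reg" for z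
  have "\<forall>\<^sub>F z in nhds y. P z"
    unfolding P_def by (intro eventually_conj 1 2 3 4)
  then obtain W where W: "open W" "y \<in> W" "\<forall>z\<in>W. P z"
    unfolding eventually_nhds by blast
  then have W': "(\<forall>x\<in>?X. z \<in> V x) \<and> (\<forall>x\<in>?X. \<forall>x'\<in>?X. x \<noteq> x' \<longrightarrow> g x z \<noteq> g x' z) \<and>
      z \<notin> F ` (- (\<Union>x\<in>?X. U x)) \<and> z \<in> reg" if "z \<in> W" for z
    using that unfolding P_def by blast
  show ?thesis
  proof (rule that[of W g "\<lambda>x z. matrix_inv (A (g x z))"])
    show "W \<subseteq> reg" using W' by blast
    fix z assume z: "z \<in> W"
    show "inj_on (\<lambda>x. g x z) ?X" using W'[OF z] by (auto simp: inj_on_def)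
    show "F -` {z} = (\<lambda>x. g x z) ` ?X"
    proof
      show "(\<lambda>x. g x z) ` ?X \<subseteq> F -` {z}"
        using W'[OF z] UVg(5) by (auto simp: homeomorphism_def)
      show "F -` {z} \<subseteq> (\<lambda>x. g x z) ` ?X"
      proof
        fix w assume w: "w \<in> F -` {z}"
        then obtain x where x: "x \<in> ?X" "w \<in> U x" using W'[OF z] by blast
        then have "g x z = w" using UVg(5)[OF x(1)] w by (auto simp: homeomorphism_def)
        then show "w \<in> (\<lambda>x. g x z) ` ?X" using x by blast
      qed
    qed
  qed (use W W' UVg(6) in auto)
qed

end

section \<open>Plurisubharmonic functions\<close>

text \<open>Continuity near the point is built in, so that circle means exist and can be added and
  compared.\<close>

definition submean_at :: "(complex \<Rightarrow> real) \<Rightarrow> complex \<Rightarrow> bool" where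
  "submean_at h \<zeta> \<longleftrightarrow> (\<exists>R>0. continuous_on (ball \<zeta> R) h) \<and> locally_submean h \<zeta>"

lemma submean_atD:
  assumes "submean_at h \<zeta>"
  obtains r0 where "r0 > 0" "continuous_on (ball \<zeta> r0) h"
    "\<And>r. 0 < r \<Longrightarrow> r < r0 \<Longrightarrow> (\<lambda>t. h (circlepath \<zeta> r t)) integrable_on {0..1}"
    "\<And>r. 0 < r \<Longrightarrow> r < r0 \<Longrightarrow> h \<zeta> \<le> integral {0..1} (\<lambda>t. h (circlepath \<zeta> r t))"
proof -
  obtain R r1 where R: "R > 0" "continuous_on (ball \<zeta> R) h" and r1: "r1 > 0"
    "\<And>r. 0 < r \<and> r < r1 \<Longrightarrow> h \<zeta> \<le> integral {0..1} (\<lambda>t. h (circlepath \<zeta> r t))"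
    using assms unfolding submean_at_def locally_submean_def by metis
  have cont: "continuous_on (ball \<zeta> (min R r1)) h"
    by (rule continuous_on_subset[OF R(2)]) auto
  have "(\<lambda>t. h (circlepath \<zeta> r t)) integrable_on {0..1}" if "0 < r" "r < min R r1" for r
    by (intro integrable_continuous_real continuous_on_circle[OF cont] cball_subset_ball_iff[THEN iffD2])
      (use that in auto)
  then show ?thesis
    by (intro that[of "min R r1"]) (use R r1 cont in auto)
qed

lemma submean_atI:
  assumes "r0 > 0" "continuous_on (ball \<zeta> r0) h"
    "\<And>r. 0 < r \<Longrightarrow> r < r0 \<Longrightarrow> h \<zeta> \<le> integral {0..1} (\<lambda>t. h (circlepath \<zeta> r t))"
  shows "submean_at h \<zeta>"
  using assms unfolding submean_at_def locally_submean_def by blast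

lemma submean_at_add:
  assumes "submean_at f \<zeta>" "submean_at g \<zeta>" shows "submean_at (\<lambda>z. f z + g z) \<zeta>"
proof -
  obtain r1 where r1: "r1 > 0" "continuous_on (ball \<zeta> r1) f"
    "\<And>r. 0 < r \<Longrightarrow> r < r1 \<Longrightarrow> (\<lambda>t. f (circlepath \<zeta> r t)) integrable_on {0..1}"
    "\<And>r. 0 < r \<Longrightarrow> r < r1 \<Longrightarrow> f \<zeta> \<le> integral {0..1} (\<lambda>t. f (circlepath \<zeta> r t))"
    using submean_atD[OF assms(1)] by metis
  obtain r2 where r2: "r2 > 0" "continuous_on (ball \<zeta> r2) g"
    "\<And>r. 0 < r \<Longrightarrow> r < r2 \<Longrightarrow> (\<lambda>t. g (circlepath \<zeta> r t)) integrable_on {0..1}"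
    "\<And>r. 0 < r \<Longrightarrow> r < r2 \<Longrightarrow> g \<zeta> \<le> integral {0..1} (\<lambda>t. g (circlepath \<zeta> r t))"
    using submean_atD[OF assms(2)] by metis
  show ?thesis
  proof (rule submean_atI[of "min r1 r2"])
    show "continuous_on (ball \<zeta> (min r1 r2)) (\<lambda>z. f z + g z)"
      by (intro continuous_on_add continuous_on_subset[OF r1(2)] continuous_on_subset[OF r2(2)]) auto
    fix r assume r: "0 < r" "r < min r1 r2"
    then have "integral {0..1} (\<lambda>t. f (circlepath \<zeta> r t) + g (circlepath \<zeta> r t)) =
      integral {0..1} (\<lambda>t. f (circlepath \<zeta> r t)) + integral {0..1} (\<lambda>t. g (circlepath \<zeta> r t))"
      by (intro Henstock_Kurzweil_Integration.integral_add r1(3) r2(3)) auto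
    then show "f \<zeta> + g \<zeta> \<le> integral {0..1} (\<lambda>t. f (circlepath \<zeta> r t) + g (circlepath \<zeta> r t))"
      using r1(4)[of r] r2(4)[of r] r by simp
  qed (use r1 r2 in auto)
qed

lemma submean_at_const: "submean_at (\<lambda>_. c) \<zeta>"
  by (rule submean_atI[of 1]) auto

lemma submean_at_sum:
  "(\<And>i. i \<in> I \<Longrightarrow> submean_at (f i) \<zeta>) \<Longrightarrow> submean_at (\<lambda>z. \<Sum>i\<in>I. f i z) \<zeta>"
proof (induction I rule: infinite_finite_induct)
  case (insert i I)
  then show ?case using submean_at_add[of "f i" \<zeta> "\<lambda>z. \<Sum>i\<in>I. f i z"] by simp
qed (auto simp: submean_at_const)

lemma submean_at_max:
  assumes "submean_at f \<zeta>" "submean_at g \<zeta>" shows "submean_at (\<lambda>z. max (f z) (g z)) \<zeta>"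
proof -
  obtain r1 where r1: "r1 > 0" "continuous_on (ball \<zeta> r1) f"
    "\<And>r. 0 < r \<Longrightarrow> r < r1 \<Longrightarrow> (\<lambda>t. f (circlepath \<zeta> r t)) integrable_on {0..1}"
    "\<And>r. 0 < r \<Longrightarrow> r < r1 \<Longrightarrow> f \<zeta> \<le> integral {0..1} (\<lambda>t. f (circlepath \<zeta> r t))"
    using submean_atD[OF assms(1)] by metis
  obtain r2 where r2: "r2 > 0" "continuous_on (ball \<zeta> r2) g"
    "\<And>r. 0 < r \<Longrightarrow> r < r2 \<Longrightarrow> (\<lambda>t. g (circlepath \<zeta> r t)) integrable_on {0..1}"
    "\<And>r. 0 < r \<Longrightarrow> r < r2 \<Longrightarrow> g \<zeta> \<le> integral {0..1} (\<lambda>t. g (circlepath \<zeta> r t))"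
    using submean_atD[OF assms(2)] by metis
  show ?thesis
  proof (rule submean_atI[of "min r1 r2"])
    show cont: "continuous_on (ball \<zeta> (min r1 r2)) (\<lambda>z. max (f z) (g z))"
      by (intro continuous_on_max continuous_on_subset[OF r1(2)] continuous_on_subset[OF r2(2)]) auto
    fix r assume r: "0 < r" "r < min r1 r2"
    have int: "(\<lambda>t. max (f (circlepath \<zeta> r t)) (g (circlepath \<zeta> r t))) integrable_on {0..1}"
      by (intro integrable_continuous_real continuous_on_circle[OF cont] cball_subset_ball_iff[THEN iffD2])
        (use r in auto)
    have "integral {0..1} (\<lambda>t. f (circlepath \<zeta> r t)) \<le> integral {0..1} (\<lambda>t. max (f (circlepath \<zeta> r t)) (g (circlepath \<zeta> r t)))"
      "integral {0..1} (\<lambda>t. g (circlepath \<zeta> r t)) \<le> integral {0..1} (\<lambda>t. max (f (circlepath \<zeta> r t)) (g (circlepath \<zeta> r t)))"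
      using r by (intro integral_le int r1(3) r2(3); simp)+
    then show "max (f \<zeta>) (g \<zeta>) \<le> integral {0..1} (\<lambda>t. max (f (circlepath \<zeta> r t)) (g (circlepath \<zeta> r t)))"
      using r1(4)[of r] r2(4)[of r] r by simp
  qed (use r1 r2 in auto)
qed

lemma submean_at_cong:
  assumes "submean_at f \<zeta>" "R > 0" "\<And>z. z \<in> ball \<zeta> R \<Longrightarrow> g z = f z" shows "submean_at g \<zeta>"
proof -
  obtain r1 where r1: "r1 > 0" "continuous_on (ball \<zeta> r1) f"
    "\<And>r. 0 < r \<Longrightarrow> r < r1 \<Longrightarrow> f \<zeta> \<le> integral {0..1} (\<lambda>t. f (circlepath \<zeta> r t))"
    using submean_atD[OF assms(1)] by metis
  show ?thesis
  proof (rule submean_atI[of "min r1 R"])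
    have "continuous_on (ball \<zeta> (min r1 R)) f" by (rule continuous_on_subset[OF r1(2)]) auto
    then show "continuous_on (ball \<zeta> (min r1 R)) g"
      by (rule continuous_on_eq) (use assms(3) in auto)
    fix r assume r: "0 < r" "r < min r1 R"
    have "circlepath \<zeta> r t \<in> ball \<zeta> R" for t
      using circlepath_in_sphere[of r \<zeta> t] r by auto
    then show "g \<zeta> \<le> integral {0..1} (\<lambda>t. g (circlepath \<zeta> r t))"
      using r1(3)[of r] r assms by simp
  qed (use r1 assms in auto)
qed

lemma submean_at_ln_cmod:
  assumes "f holomorphic_on ball \<zeta> R" "R > 0" "\<And>z. z \<in> ball \<zeta> R \<Longrightarrow> f z \<noteq> 0" "0 \<le> c"
  shows "submean_at (\<lambda>z. c * ln (cmod (f z))) \<zeta>"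
proof (rule submean_atI[OF assms(2)])
  show "continuous_on (ball \<zeta> R) (\<lambda>z. c * ln (cmod (f z)))"
    by (intro continuous_intros holomorphic_on_imp_continuous_on assms) (use assms(3) in auto)
  show "c * ln (cmod (f \<zeta>)) \<le> integral {0..1} (\<lambda>t. c * ln (cmod (f (circlepath \<zeta> r t))))"
    if "0 < r" "r < R" for r
    using integral_unique[OF ln_cmod_circle_mean[OF assms(1,3) that]] by simp
qed

definition holomorphic_vec :: "(complex \<Rightarrow> complex^'n::finite) \<Rightarrow> complex set \<Rightarrow> bool" where
  "holomorphic_vec g S \<longleftrightarrow> (\<forall>i. (\<lambda>z. g z $ i) holomorphic_on S)"

lemma holomorphic_vec_continuous:
  assumes "holomorphic_vec g S" shows "continuous_on S g"
proof -
  have "continuous_on S (\<lambda>z. \<chi> i. g z $ i)"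
    using assms by (intro continuous_on_vec_lambda) (auto simp: holomorphic_vec_def holomorphic_on_imp_continuous_on)
  then show ?thesis by simp
qed

text \<open>Plurisubharmonicity on the punctured space, tested along arbitrary analytic discs so that it
  is visibly inherited by local inverse branches.\<close>

definition psh :: "(complex^'n::finite \<Rightarrow> real) \<Rightarrow> bool" where
  "psh u \<longleftrightarrow> continuous_on (- {0}) u \<and>
    (\<forall>g \<zeta> R. 0 < R \<and> holomorphic_vec g (ball \<zeta> R) \<and> (\<forall>z\<in>ball \<zeta> R. g z \<noteq> 0) \<longrightarrow>
      submean_at (\<lambda>z. u (g z)) \<zeta>)"

lemma psh_add: "psh u \<Longrightarrow> psh v \<Longrightarrow> psh (\<lambda>x. u x + v x)"
  unfolding psh_def by (intro conjI continuous_on_add allI impI submean_at_add) blast+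

lemma psh_max: "psh u \<Longrightarrow> psh v \<Longrightarrow> psh (\<lambda>x. max (u x) (v x))"
  unfolding psh_def by (intro conjI continuous_on_max allI impI submean_at_max) blast+

lemma psh_const: "psh (\<lambda>_. c)"
  unfolding psh_def by (auto intro!: submean_at_const)

section \<open>Logarithms of linear forms and of the norm\<close>

text \<open>The Hermitian product, linear in its first argument, so that pairing a holomorphic curve
  with a fixed vector is holomorphic.\<close>

definition cip :: "complex^'n::finite \<Rightarrow> complex^'n \<Rightarrow> complex" where
  "cip x a = (\<Sum>i\<in>UNIV. x $ i * cnj (a $ i))"

lemma cip_le: "cmod (cip x a) \<le> norm x * norm a"
proof -
  have "cmod (cip x a) \<le> (\<Sum>i\<in>UNIV. \<bar>cmod (x $ i)\<bar> * \<bar>cmod (a $ i)\<bar>)"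
    unfolding cip_def by (rule order.trans[OF norm_sum]) (simp add: norm_mult)
  also have "\<dots> \<le> norm x * norm a"
    unfolding norm_vec_def by (rule L2_set_mult_ineq)
  finally show ?thesis .
qed

lemma cip_self: "cip x x = of_real ((norm x)\<^sup>2)"
  by (simp add: cip_def norm_vec_def L2_set_def real_sqrt_pow2 sum_nonneg complex_norm_square[symmetric])

lemma cip_vsmult: "cip (c *s x) a = c * cip x a"
  by (simp add: cip_def sum_distrib_left mult_ac)

lemma cip_vsmult_right: "cip x (c *s a) = cnj c * cip x a"
  by (simp add: cip_def sum_distrib_left mult_ac)

lemma continuous_on_cip [continuous_intros]:
  "continuous_on S f \<Longrightarrow> continuous_on S (\<lambda>x. cip (f x) a)"
  unfolding cip_def by (intro continuous_intros)

text \<open>The function is the supremum of \<open>ln |cip x b|\<close> over \<open>b = a\<close>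
  and all \<open>b\<close> of norm \<open>s\<close>. At a given centre one such \<open>b\<close>
  attains the supremum; near that centre \<open>ln |cip (g z) b|\<close> has exact circle means and
  lies below the function, which yields the submean inequality.\<close>

lemma psh_ln_max:
  fixes a :: "complex^'n::finite"
  assumes "0 < s"
  shows "psh (\<lambda>x. ln (max (cmod (cip x a)) (s * norm x)))"
  unfolding psh_def
proof (intro conjI allI impI)
  let ?M = "\<lambda>x::complex^'n. max (cmod (cip x a)) (s * norm x)"
  have pos: "?M x > 0" if "x \<noteq> 0" for x using assms that by (simp add: less_max_iff_disj)
  have contM: "continuous_on S ?M" for S by (intro continuous_intros)
  show "continuous_on (- {0}) (\<lambda>x. ln (?M x))"
    by (intro continuous_on_ln contM) (use pos in force)
  fix g :: "complex \<Rightarrow> complex^'n" and \<zeta> :: complex and R :: real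
  assume g: "0 < R \<and> holomorphic_vec g (ball \<zeta> R) \<and> (\<forall>z\<in>ball \<zeta> R. g z \<noteq> 0)"
  then have g0: "g \<zeta> \<noteq> 0" by simp
  define b where "b = (if cmod (cip (g \<zeta>) a) \<ge> s * norm (g \<zeta>) then a else of_real (s / norm (g \<zeta>)) *s g \<zeta>)"
  have b_le: "cmod (cip x b) \<le> ?M x" for x
  proof (cases "cmod (cip (g \<zeta>) a) \<ge> s * norm (g \<zeta>)")
    case False
    then have "cmod (cip x b) \<le> norm x * norm (of_real (s / norm (g \<zeta>)) *s g \<zeta>)"
      unfolding b_def by (simp only: if_False cip_le)
    also have "\<dots> = s * norm x" using g0 assms by (simp add: norm_vsmult norm_divide)
    finally show ?thesis by simp
  qed (simp add: b_def)
  have b_eq: "cmod (cip (g \<zeta>) b) = ?M (g \<zeta>)"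
  proof (cases "cmod (cip (g \<zeta>) a) \<ge> s * norm (g \<zeta>)")
    case False
    then have "cip (g \<zeta>) b = of_real (s / norm (g \<zeta>) * (norm (g \<zeta>))\<^sup>2)"
      by (simp add: b_def cip_vsmult_right cip_self)
    then have "cmod (cip (g \<zeta>) b) = \<bar>s / norm (g \<zeta>) * (norm (g \<zeta>))\<^sup>2\<bar>" by (simp only: norm_of_real)
    also have "\<dots> = s * norm (g \<zeta>)" using g0 assms by (simp add: power2_eq_square)
    finally show ?thesis using False by simp
  qed (simp add: b_def)
  define f where "f z = cip (g z) b" for z
  have hol: "f holomorphic_on ball \<zeta> R"
    unfolding f_def cip_def using g by (intro holomorphic_intros) (auto simp: holomorphic_vec_def)
  have fz: "f \<zeta> \<noteq> 0" using b_eq pos[OF g0] by (auto simp: f_def)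
  have "isCont f \<zeta>"
    using holomorphic_on_imp_continuous_on[OF hol] g by (simp add: continuous_on_eq_continuous_at)
  then obtain e where e: "e > 0" "\<And>z. dist \<zeta> z < e \<Longrightarrow> f z \<noteq> 0"
    using continuous_at_avoid[of \<zeta> f 0] fz by metis
  define R' where "R' = min R e"
  have R': "R' > 0" "R' \<le> R" "\<And>z. z \<in> ball \<zeta> R' \<Longrightarrow> f z \<noteq> 0" using g e by (auto simp: R'_def)
  have hol': "f holomorphic_on ball \<zeta> R'" using hol by (rule holomorphic_on_subset) (use R' in auto)
  have cont: "continuous_on (ball \<zeta> R) (\<lambda>z. ln (?M (g z)))"
  proof (intro continuous_on_ln continuous_on_compose2[OF contM[of UNIV]] holomorphic_vec_continuous ballI)
    show "?M (g z) \<noteq> 0" if "z \<in> ball \<zeta> R" for z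
      using g that pos[of "g z"] by (metis less_irrefl)
  qed (use g in auto)
  show "submean_at (\<lambda>z. ln (?M (g z))) \<zeta>"
  proof (rule submean_atI[OF R'(1)])
    show cont': "continuous_on (ball \<zeta> R') (\<lambda>z. ln (?M (g z)))"
      by (rule continuous_on_subset[OF cont]) (use R' in auto)
    fix r assume r: "0 < r" "r < R'"
    have mean: "((\<lambda>t. ln (cmod (f (circlepath \<zeta> r t)))) has_integral ln (cmod (f \<zeta>))) {0..1}"
      by (rule ln_cmod_circle_mean[OF hol' R'(3) r])
    have "(\<lambda>t. ln (?M (g (circlepath \<zeta> r t)))) integrable_on {0..1}"
      by (intro integrable_continuous_real continuous_on_circle[OF cont'] cball_subset_ball_iff[THEN iffD2])
        (use r in auto)
    then have "ln (cmod (f \<zeta>)) \<le> integral {0..1} (\<lambda>t. ln (?M (g (circlepath \<zeta> r t))))"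
    proof (rule has_integral_le[OF mean integrable_integral])
      fix t
      have "circlepath \<zeta> r t \<in> ball \<zeta> R'" using circlepath_in_sphere[of r \<zeta> t] r by auto
      then have "0 < cmod (f (circlepath \<zeta> r t))" using R'(3) by simp
      then show "ln (cmod (f (circlepath \<zeta> r t))) \<le> ln (?M (g (circlepath \<zeta> r t)))"
        using b_le[of "g (circlepath \<zeta> r t)"] by (intro ln_mono) (auto simp: f_def)
    qed
    then show "ln (?M (g \<zeta>)) \<le> integral {0..1} (\<lambda>t. ln (?M (g (circlepath \<zeta> r t))))"
      using b_eq by (simp add: f_def)
  qed
qed

section \<open>Sums over fibres\<close>

locale nondegenerate_map = homogeneous_map F e q q' A
  for F :: "complex^'n::finite \<Rightarrow> complex^'n" and e q q' A +
  assumes jacobian_nonzero: "\<exists>x. det (A x) \<noteq> 0"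
begin

text \<open>A dimension count makes the functions \<open>J\<^sup>a * F\<^sup>\<beta>\<close> linearly dependent, where \<open>J\<close> is the
  Jacobian determinant. The lowest \<open>J\<close>-coefficient of a dependency is a polynomial in \<open>F\<close> that
  vanishes on the critical set.\<close>

lemma critical_value_polynomial:
  obtains r Q where "polynomial r Q" "\<exists>y. Q y \<noteq> 0" "\<And>y. Q y \<noteq> 0 \<Longrightarrow> y \<in> reg"
proof -
  define N where "N = CARD('n)"
  define J where "J x = det (A x)" for x
  define dJ where "dJ = N * q'"
  have J: "polynomial dJ J"
    unfolding J_def dJ_def N_def by (rule polynomial_det[OF polynomial_A])
  obtain x1 where x1: "J x1 \<noteq> 0" using jacobian_nonzero by (auto simp: J_def)
  \<comment> \<open>The constants are arranged so that the products outnumber the exponents of their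
    common degree bound \<open>D\<close>: \<open>D + 1 \<le> (B + 1) * (N * q + 1)\<close> gives
    \<open>(D + 1) ^ N \<le> (B + 1) ^ N * M\<close>, which is less than
    \<open>(M + 1) * (B + 1) ^ N\<close>.\<close>
  define M where "M = (N * q + 1) ^ N"
  define B where "B = M * dJ"
  define D where "D = B + N * B * q"
  define \<phi> where "\<phi> ab x = J x ^ fst ab * monomial (snd ab) (F x)" for ab x
  define K where "K = {..M} \<times> (exps B :: ('n \<Rightarrow> nat) set)"
  have "\<forall>ab. \<exists>c. ab \<in> K \<longrightarrow> (\<forall>x. \<phi> ab x = (\<Sum>\<alpha>\<in>exps D. c \<alpha> * monomial \<alpha> x))"
  proof
    fix ab :: "nat \<times> ('n \<Rightarrow> nat)"
    show "\<exists>c. ab \<in> K \<longrightarrow> (\<forall>x. \<phi> ab x = (\<Sum>\<alpha>\<in>exps D. c \<alpha> * monomial \<alpha> x))"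
    proof (cases "ab \<in> K")
      case True
      then have ab: "fst ab \<le> M" "snd ab \<in> exps B" by (auto simp: K_def)
      have "polynomial (fst ab * dJ + N * B * q) (\<phi> ab)"
        unfolding \<phi>_def N_def
        by (intro polynomial_mult polynomial_power J polynomial_compose polynomial_monomial ab polynomial_F)
      moreover have "fst ab * dJ + N * B * q \<le> D"
        using ab(1) by (simp add: D_def B_def)
      ultimately have "polynomial D (\<phi> ab)" by (rule polynomial_mono)
      then show ?thesis unfolding polynomial_def by blast
    qed blast
  qed
  then obtain m where m: "\<forall>ab. ab \<in> K \<longrightarrow> (\<forall>x. \<phi> ab x = (\<Sum>\<alpha>\<in>exps D. m ab \<alpha> * monomial \<alpha> x))"
    unfolding choice_iff by blast
  have "D + 1 \<le> (B + 1) * (N * q + 1)" by (simp add: D_def algebra_simps)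
  then have "(D + 1) ^ N \<le> (B + 1) ^ N * M"
    unfolding M_def by (metis power_mono power_mult_distrib zero_le)
  also have "\<dots> < (M + 1) * (B + 1) ^ N" by simp
  finally have card: "card (exps D :: ('n \<Rightarrow> nat) set) < card K"
    by (simp add: K_def card_cartesian_product card_exps N_def)
  have finK: "finite K" by (simp add: K_def)
  obtain c where c0: "\<exists>ab\<in>K. c ab \<noteq> 0" and c: "\<forall>\<alpha>\<in>exps D. (\<Sum>ab\<in>K. m ab \<alpha> * c ab) = 0"
    using homogeneous_system_nontrivial_solution[OF finite_exps finK card, of "\<lambda>\<alpha> ab. m ab \<alpha>"] by blast
  have rel: "(\<Sum>ab\<in>K. c ab * \<phi> ab x) = 0" for x
  proof -
    have "(\<Sum>ab\<in>K. c ab * \<phi> ab x) = (\<Sum>ab\<in>K. \<Sum>\<alpha>\<in>exps D. (m ab \<alpha> * c ab) * monomial \<alpha> x)"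
    proof (intro sum.cong refl)
      fix ab assume "ab \<in> K"
      then have "\<phi> ab x = (\<Sum>\<alpha>\<in>exps D. m ab \<alpha> * monomial \<alpha> x)" using m by blast
      then show "c ab * \<phi> ab x = (\<Sum>\<alpha>\<in>exps D. (m ab \<alpha> * c ab) * monomial \<alpha> x)"
        by (simp add: sum_distrib_left mult_ac)
    qed
    also have "\<dots> = (\<Sum>\<alpha>\<in>exps D. (\<Sum>ab\<in>K. m ab \<alpha> * c ab) * monomial \<alpha> x)"
      by (subst sum.swap) (simp add: sum_distrib_right)
    also have "\<dots> = 0" using c by simp
    finally show ?thesis .
  qed
  define P where "P a z = (\<Sum>\<beta>\<in>exps B. c (a, \<beta>) * monomial \<beta> z)" for a z
  have rel': "(\<Sum>a\<le>M. J x ^ a * P a (F x)) = 0" for x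
  proof -
    have "(\<Sum>ab\<in>K. c ab * \<phi> ab x) = (\<Sum>a\<le>M. \<Sum>\<beta>\<in>exps B. c (a, \<beta>) * (J x ^ a * monomial \<beta> (F x)))"
      unfolding K_def \<phi>_def sum.cartesian_product' by simp
    also have "\<dots> = (\<Sum>a\<le>M. J x ^ a * P a (F x))"
      by (simp add: P_def sum_distrib_left mult_ac)
    finally show ?thesis using rel[of x] by simp
  qed
  define a0 where "a0 = (LEAST a. \<exists>\<beta>\<in>exps B. c (a, \<beta>) \<noteq> 0)"
  obtain a1 \<beta>1 where a1: "a1 \<le> M" "\<beta>1 \<in> exps B" "c (a1, \<beta>1) \<noteq> 0" using c0 by (auto simp: K_def)
  have a0: "\<exists>\<beta>\<in>exps B. c (a0, \<beta>) \<noteq> 0"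
    unfolding a0_def by (rule LeastI[of _ a1]) (use a1 in blast)
  have a0_le: "a0 \<le> M"
    using Least_le[of "\<lambda>a. \<exists>\<beta>\<in>exps B. c (a, \<beta>) \<noteq> 0" a1] a1 unfolding a0_def by fastforce
  have less: "P a z = 0" if "a < a0" for a z
  proof -
    have "\<forall>\<beta>\<in>exps B. c (a, \<beta>) = 0" using not_less_Least[OF that[unfolded a0_def]] by blast
    then show ?thesis by (simp add: P_def)
  qed
  \<comment> \<open>The relation divided by \<open>J ^ a0\<close>. It vanishes where
    \<open>J\<close> does not, hence everywhere by density and continuity; on the critical set only
    the summand \<open>a = a0\<close> survives.\<close>
  define R where "R x = (\<Sum>a\<in>{a0..M}. J x ^ (a - a0) * P a (F x))" for x
  have "J x ^ a0 * R x = 0" for x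
  proof -
    have "J x ^ a0 * R x = (\<Sum>a\<in>{a0..M}. J x ^ a * P a (F x))"
      unfolding R_def sum_distrib_left by (intro sum.cong refl) (simp add: mult.assoc[symmetric] power_add[symmetric])
    also have "\<dots> = (\<Sum>a\<le>M. J x ^ a * P a (F x))"
      by (intro sum.mono_neutral_left) (auto simp: less)
    finally show ?thesis using rel' by simp
  qed
  then have R0: "R x = 0" if "J x \<noteq> 0" for x using that by (metis mult_eq_0_iff power_not_zero)
  have polyP: "polynomial B (P a)" for a
    unfolding P_def by (intro polynomial_sum polynomial_cmult polynomial_monomial)
  have contR: "continuous_on UNIV R"
    unfolding R_def
    by (intro continuous_intros continuous_on_polynomial[OF J] continuous_on_compose2[OF continuous_on_polynomial[OF polyP]]) auto
  have R_0: "R x = 0" for x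
    using continuous_constant_on_closure[of "{x. J x \<noteq> 0}" R 0 x] contR R0
      closure_polynomial_nonzero[OF J x1] by auto
  have vanish: "P a0 (F x) = 0" if "J x = 0" for x
  proof -
    have "R x = (\<Sum>a\<in>{a0..M}. if a = a0 then P a0 (F x) else 0)"
      unfolding R_def by (intro sum.cong refl) (use that in \<open>auto simp: power_0_left\<close>)
    also have "\<dots> = P a0 (F x)" using a0_le by simp
    finally show ?thesis using R_0 by simp
  qed
  have "\<exists>z. P a0 z \<noteq> 0"
    using polynomial_eq_0_imp_coeff_eq_0[where q = B and c = "\<lambda>\<beta>. c (a0, \<beta>)"] a0 unfolding P_def by blast
  then obtain z1 where z1: "P a0 z1 \<noteq> 0" by blast
  \<comment> \<open>The final polynomial is multiplied by one coordinate so that it also vanishes at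
    the origin, which is excluded from \<open>reg\<close>; density ensures that the product is not
    identically zero.\<close>
  obtain i :: 'n where True by blast
  have "open {z :: complex^'n. z $ i \<noteq> 0}"
    by (intro open_Collect_neq continuous_intros)
  moreover have "axis i 1 \<in> {z :: complex^'n. z $ i \<noteq> 0}" by (simp add: axis_def)
  ultimately obtain z2 where z2: "z2 $ i \<noteq> 0" "P a0 z2 \<noteq> 0"
    using closure_polynomial_nonzero[OF polyP z1] open_Int_closure_eq_empty[of "{z :: complex^'n. z $ i \<noteq> 0}" "{z. P a0 z \<noteq> 0}"]
    by blast
  show ?thesis
  proof (rule that[of "B + 1" "\<lambda>z. P a0 z * z $ i"])
    show "polynomial (B + 1) (\<lambda>z. P a0 z * z $ i)"
      by (intro polynomial_mult polyP polynomial_coord)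
    show "\<exists>y. P a0 y * y $ i \<noteq> 0" using z2 by auto
    show "y \<in> reg" if "P a0 y * y $ i \<noteq> 0" for y
      using that vanish by (auto simp: reg_def J_def)
  qed
qed

text \<open>The covering property makes the cardinality locally constant. Two points with
  \<open>Q \<noteq> 0\<close> are joined inside the connected nonvanishing set of \<open>Q\<close>
  on their complex line, and every regular value has such points arbitrarily near.\<close>

lemma card_fibre_eq:
  assumes "y \<in> reg" "y' \<in> reg" shows "card (F -` {y}) = card (F -` {y'})"
proof -
  obtain r Q where Q: "polynomial r Q" "\<exists>y. Q y \<noteq> 0" "\<And>y. Q y \<noteq> 0 \<Longrightarrow> y \<in> reg"
    using critical_value_polynomial by metis
  have loc: "\<exists>W. open W \<and> y \<in> W \<and> (\<forall>z\<in>W. card (F -` {z}) = card (F -` {y}))" if "y \<in> reg" for y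
  proof -
    obtain W g B where W: "open W" "y \<in> W" "W \<subseteq> reg"
      "\<And>z. z \<in> W \<Longrightarrow> F -` {z} = (\<lambda>x. g x z) ` (F -` {y})"
      "\<And>z. z \<in> W \<Longrightarrow> inj_on (\<lambda>x. g x z) (F -` {y})"
      "\<And>x z. x \<in> F -` {y} \<Longrightarrow> z \<in> W \<Longrightarrow> (g x has_derivative (\<lambda>h. B x z *v h)) (at z)"
      using covering[OF \<open>y \<in> reg\<close>] by blast
    have "card (F -` {z}) = card (F -` {y})" if "z \<in> W" for z
      using W(4)[OF that] card_image[OF W(5)[OF that]] by simp
    then show ?thesis using W by blast
  qed
  have eq: "card (F -` {a}) = card (F -` {b})" if ab: "Q a \<noteq> 0" "Q b \<noteq> 0" for a b
  proof -
    let ?l = "\<lambda>\<zeta>. a + \<zeta> *s (b - a)"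
    let ?S = "{\<zeta>. Q (?l \<zeta>) \<noteq> 0}"
    have "Q (?l 0) \<noteq> 0" using ab by simp
    from finite_zeros_line_connected[OF Q(1) this] have "connected ?S" .
    then have "(\<lambda>\<zeta>. card (F -` {?l \<zeta>})) constant_on ?S"
    proof (rule locally_constant_imp_constant)
      fix \<zeta> assume \<zeta>: "\<zeta> \<in> ?S"
      then obtain W where W: "open W" "?l \<zeta> \<in> W" "\<forall>z\<in>W. card (F -` {z}) = card (F -` {?l \<zeta>})"
        using loc[of "?l \<zeta>"] Q(3) by blast
      have "continuous_on UNIV ?l" by (intro continuous_intros)
      then have "open (?l -` W)" by (rule open_vimage[OF W(1)])
      then show "\<exists>T. openin (top_of_set ?S) T \<and> \<zeta> \<in> T \<and> (\<forall>x\<in>T. card (F -` {?l x}) = card (F -` {?l \<zeta>}))"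
      proof (intro exI conjI)
        show "openin (top_of_set ?S) (?S \<inter> ?l -` W)" using \<open>open (?l -` W)\<close> by (rule openin_open_Int)
        show "\<zeta> \<in> ?S \<inter> ?l -` W" using \<zeta> W(2) by blast
        show "\<forall>x\<in>?S \<inter> ?l -` W. card (F -` {?l x}) = card (F -` {?l \<zeta>})" using W(3) by blast
      qed
    qed
    moreover have "0 \<in> ?S" "1 \<in> ?S" using ab by auto
    ultimately have "card (F -` {?l 0}) = card (F -` {?l 1})" unfolding constant_on_def by metis
    then show ?thesis by simp
  qed
  obtain y0 where y0: "Q y0 \<noteq> 0" using Q(2) by blast
  have near: "\<exists>z. Q z \<noteq> 0 \<and> card (F -` {z}) = card (F -` {y})" if y: "y \<in> reg" for y
  proof -
    obtain W where W: "open W" "y \<in> W" "\<forall>z\<in>W. card (F -` {z}) = card (F -` {y})"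
      using loc[OF y] by blast
    then have "W \<inter> {z. Q z \<noteq> 0} \<noteq> {}"
      using closure_polynomial_nonzero[OF Q(1) y0] open_Int_closure_eq_empty[OF W(1), of "{z. Q z \<noteq> 0}"] by auto
    then show ?thesis using W(3) by blast
  qed
  show ?thesis using near[OF assms(1)] near[OF assms(2)] eq by metis
qed

section \<open>Fibre sums and their continuation across the critical values\<close>

text \<open>The sum runs over the fibre of the lift, in which each point of the projective fibre
  occurs \<open>e\<close> times.\<close>

definition fibre_sum :: "(complex^'n \<Rightarrow> real) \<Rightarrow> complex^'n \<Rightarrow> real" where
  "fibre_sum u z = (\<Sum>x\<in>F -` {z}. u x)"

lemma local_branches:
  assumes y: "y \<in> reg"
  obtains W and X :: "(complex^'n) set" and g B where "open W" "y \<in> W" "W \<subseteq> reg" "finite X"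
    "\<And>u z. z \<in> W \<Longrightarrow> fibre_sum u z = (\<Sum>x\<in>X. u (g x z))"
    "\<And>x z. x \<in> X \<Longrightarrow> z \<in> W \<Longrightarrow> g x z \<noteq> 0"
    "\<And>x z. x \<in> X \<Longrightarrow> z \<in> W \<Longrightarrow> (g x has_derivative (\<lambda>h. B x z *v h)) (at z)"
proof -
  obtain W g B where W: "open W" "y \<in> W" "W \<subseteq> reg"
    "\<And>z. z \<in> W \<Longrightarrow> F -` {z} = (\<lambda>x. g x z) ` (F -` {y})"
    "\<And>z. z \<in> W \<Longrightarrow> inj_on (\<lambda>x. g x z) (F -` {y})"
    "\<And>x z. x \<in> F -` {y} \<Longrightarrow> z \<in> W \<Longrightarrow> (g x has_derivative (\<lambda>h. B x z *v h)) (at z)"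
    using covering[OF y] by blast
  show ?thesis
  proof (rule that[OF W(1,2,3) finite_fibre[OF y]])
    show "fibre_sum u z = (\<Sum>x\<in>F -` {y}. u (g x z))" if "z \<in> W" for u z
      unfolding fibre_sum_def W(4)[OF that] by (subst sum.reindex[OF W(5)[OF that]]) simp
    show "g x z \<noteq> 0" if "x \<in> F -` {y}" "z \<in> W" for x z
    proof
      assume 0: "g x z = 0"
      have "g x z \<in> F -` {z}" using W(4)[OF that(2)] that(1) by blast
      then have "z = 0" using 0 by simp
      then show False using that(2) W(3) by (auto simp: reg_def)
    qed
  qed (use W(6) in blast)
qed

lemma continuous_on_fibre_sum:
  assumes "continuous_on (- {0}) u" shows "continuous_on reg (fibre_sum u)"
proof (subst continuous_on_eq_continuous_at[OF open_reg], intro ballI)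
  fix y assume y: "y \<in> reg"
  obtain W and X :: "(complex^'n) set" and g B where W: "open W" "y \<in> W" "W \<subseteq> reg" "finite X"
    "\<And>u z. z \<in> W \<Longrightarrow> fibre_sum u z = (\<Sum>x\<in>X. u (g x z))"
    "\<And>x z. x \<in> X \<Longrightarrow> z \<in> W \<Longrightarrow> g x z \<noteq> 0"
    "\<And>x z. x \<in> X \<Longrightarrow> z \<in> W \<Longrightarrow> (g x has_derivative (\<lambda>h. B x z *v h)) (at z)"
    by (rule local_branches[OF y]) (rule that)
  have "isCont (\<lambda>z. \<Sum>x\<in>X. u (g x z)) y"
  proof (intro continuous_sum)
    fix x assume x: "x \<in> X"
    have "isCont (g x) y" using W(7)[OF x W(2)] has_derivative_continuous by blast
    moreover have "isCont u (g x y)"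
      using assms W(6)[OF x W(2)] continuous_on_eq_continuous_at[of "- {0}" u] by auto
    ultimately show "isCont (\<lambda>z. u (g x z)) y" by (rule isCont_o2)
  qed
  moreover have "\<forall>\<^sub>F z in nhds y. fibre_sum u z = (\<Sum>x\<in>X. u (g x z))"
    using eventually_nhds_in_open[OF W(1,2)] by eventually_elim (rule W(5))
  ultimately show "isCont (fibre_sum u) y" by (simp only: isCont_cong)
qed

text \<open>Near \<open>Q = 0\<close> the fibre sum stays bounded above while
  \<open>\<epsilon> ln |Q|\<close> tends to minus infinity, so the cut at \<open>- K\<close> takes
  over before the critical values are reached and the function is continuous everywhere.\<close>

definition cut_fibre_sum :: "(complex^'n \<Rightarrow> complex) \<Rightarrow> real \<Rightarrow> real \<Rightarrow> (complex^'n \<Rightarrow> real) \<Rightarrow> complex^'n \<Rightarrow> real" where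
  "cut_fibre_sum Q \<epsilon> K u z =
    (if Q z = 0 then - K else max (fibre_sum u z + \<epsilon> * ln (cmod (Q z))) (- K))"

text \<open>Properness confines the fibres over a ball to a bounded set, and their cardinality is
  constant.\<close>

lemma fibre_sum_bounded_above:
  assumes u: "\<And>M. \<exists>C. \<forall>x. x \<noteq> 0 \<longrightarrow> norm x \<le> M \<longrightarrow> u x \<le> C"
  shows "\<exists>C. \<forall>z\<in>reg. norm z \<le> M \<longrightarrow> fibre_sum u z \<le> C"
proof (cases "reg = {}")
  case False
  then obtain y0 where y0: "y0 \<in> reg" by blast
  define N where "N = card (F -` {y0})"
  have "bounded (F -` cball 0 M)" by (intro bounded_vimage bounded_cball)
  then obtain M' where "\<forall>x\<in>F -` cball 0 M. norm x \<le> M'" unfolding bounded_iff by blast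
  then have M': "norm x \<le> M'" if "norm (F x) \<le> M" for x using that by simp
  obtain C where C: "\<And>x. x \<noteq> 0 \<Longrightarrow> norm x \<le> M' \<Longrightarrow> u x \<le> C" using u by blast
  have "fibre_sum u z \<le> N * C" if z: "z \<in> reg" "norm z \<le> M" for z
  proof -
    have "fibre_sum u z \<le> of_nat (card (F -` {z})) * C"
      unfolding fibre_sum_def
    proof (rule sum_bounded_above)
      fix x assume "x \<in> F -` {z}"
      then show "u x \<le> C" using z M'[of x] by (intro C) (auto simp: reg_def)
    qed
    also have "card (F -` {z}) = N" unfolding N_def by (rule card_fibre_eq[OF z(1) y0])
    finally show ?thesis by simp
  qed
  then show ?thesis by blast
qed auto

lemma continuous_on_cut_fibre_sum:
  assumes Q: "polynomial r Q" "\<And>y. Q y \<noteq> 0 \<Longrightarrow> y \<in> reg"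
    and cont: "continuous_on (- {0}) u"
    and bnd: "\<And>M. \<exists>C. \<forall>x. x \<noteq> 0 \<longrightarrow> norm x \<le> M \<longrightarrow> u x \<le> C" and \<epsilon>: "0 < \<epsilon>"
  shows "continuous_on UNIV (cut_fibre_sum Q \<epsilon> K u)"
proof (subst continuous_on_eq_continuous_at[OF open_UNIV], intro ballI)
  have contQ: "continuous_on S Q" for S by (rule continuous_on_polynomial[OF Q(1)])
  fix y :: "complex^'n"
  show "isCont (cut_fibre_sum Q \<epsilon> K u) y"
  proof (cases "Q y = 0")
    case False
    let ?S = "{z. Q z \<noteq> 0}"
    have S: "open ?S" by (intro open_Collect_neq contQ continuous_on_const)
    have "continuous_on ?S (fibre_sum u)"
      by (rule continuous_on_subset[OF continuous_on_fibre_sum[OF cont]]) (use Q(2) in auto)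
    then have "continuous_on ?S (\<lambda>z. max (fibre_sum u z + \<epsilon> * ln (cmod (Q z))) (- K))"
      by (intro continuous_intros contQ) auto
    then have "isCont (\<lambda>z. max (fibre_sum u z + \<epsilon> * ln (cmod (Q z))) (- K)) y"
      using S False by (simp add: continuous_on_eq_continuous_at)
    moreover have "\<forall>\<^sub>F z in nhds y. cut_fibre_sum Q \<epsilon> K u z = max (fibre_sum u z + \<epsilon> * ln (cmod (Q z))) (- K)"
      using eventually_nhds_in_open[OF S, of y] False by (auto simp: cut_fibre_sum_def elim!: eventually_mono)
    ultimately show ?thesis by (simp only: isCont_cong)
  next
    case True
    obtain C where C: "\<And>z. z \<in> reg \<Longrightarrow> norm z \<le> norm y + 1 \<Longrightarrow> fibre_sum u z \<le> C"
      using fibre_sum_bounded_above[OF bnd] by blast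
    \<comment> \<open>Solves \<open>C + \<epsilon> * ln \<delta> = - K\<close>, so the cut is active
      wherever \<open>|Q| < \<delta>\<close>.\<close>
    define \<delta> where "\<delta> = exp ((- K - C) / \<epsilon>)"
    let ?S = "ball y 1 \<inter> {z. cmod (Q z) < \<delta>}"
    have S: "open ?S" by (intro open_Int open_ball open_Collect_less continuous_intros contQ)
    moreover have "y \<in> ?S" using True by (simp add: \<delta>_def)
    ultimately have "\<forall>\<^sub>F z in nhds y. z \<in> ?S" by (rule eventually_nhds_in_open)
    then have "\<forall>\<^sub>F z in nhds y. cut_fibre_sum Q \<epsilon> K u z = - K"
    proof eventually_elim
      case (elim z)
      show ?case
      proof (cases "Q z = 0")
        case False
        have "norm z \<le> norm y + 1"
          using elim norm_triangle_ineq2[of z y] by (auto simp: dist_norm norm_minus_commute)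
        then have "fibre_sum u z \<le> C" using C Q(2) False by blast
        moreover have "ln (cmod (Q z)) < (- K - C) / \<epsilon>"
        proof -
          have "ln (cmod (Q z)) < ln \<delta>" using elim False by (subst ln_less_cancel_iff) (auto simp: \<delta>_def)
          then show ?thesis by (simp add: \<delta>_def)
        qed
        then have "\<epsilon> * ln (cmod (Q z)) < - K - C" using \<epsilon> by (simp add: pos_less_divide_eq mult.commute)
        ultimately show ?thesis using False by (simp add: cut_fibre_sum_def)
      qed (simp add: cut_fibre_sum_def)
    qed
    then have "isCont (cut_fibre_sum Q \<epsilon> K u) y \<longleftrightarrow> isCont (\<lambda>_. - K) y" by (rule isCont_cong)
    then show ?thesis by simp
  qed
qed

text \<open>On a complex line the function is, off the zeros of \<open>Q\<close>, locally a maximum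
  of a constant and a sum of \<open>u\<close> along holomorphic branches plus
  \<open>\<epsilon> ln |Q|\<close>; at a zero of \<open>Q\<close> it takes its minimum
  \<open>- K\<close>, so the inequality is trivial there. \<open>submean_unit_disc\<close> passes
  from these small circles to the unit circle, for every direction \<open>b\<close>.\<close>

lemma cut_fibre_sum_submean:
  assumes Q: "polynomial r Q" "\<And>y. Q y \<noteq> 0 \<Longrightarrow> y \<in> reg"
    and u: "psh u"
    and bnd: "\<And>M. \<exists>C. \<forall>x. x \<noteq> 0 \<longrightarrow> norm x \<le> M \<longrightarrow> u x \<le> C" and \<epsilon>: "0 < \<epsilon>"
  shows "cut_fibre_sum Q \<epsilon> K u y \<le> integral {0..1} (\<lambda>t. cut_fibre_sum Q \<epsilon> K u (y + circlepath 0 1 t *s b))"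
proof -
  let ?H = "cut_fibre_sum Q \<epsilon> K u"
  let ?l = "\<lambda>\<zeta>::complex. y + \<zeta> *s b"
  have cont: "continuous_on UNIV ?H"
    using continuous_on_cut_fibre_sum[OF Q _ bnd \<epsilon>] u by (simp add: psh_def)
  have contl: "continuous_on S ?l" for S by (intro continuous_intros)
  have contHl: "continuous_on S (\<lambda>\<zeta>. ?H (?l \<zeta>))" for S
    by (rule continuous_on_compose2[OF cont contl]) auto
  have "?H (?l 0) \<le> integral {0..1} (\<lambda>t. ?H (?l (circlepath 0 1 t)))"
  proof (rule submean_unit_disc[OF contHl])
    fix \<zeta> :: complex
    show "locally_submean (\<lambda>\<zeta>. ?H (?l \<zeta>)) \<zeta>"
    proof (cases "Q (?l \<zeta>) = 0")
      case True
      have "?H (?l \<zeta>) \<le> integral {0..1} (\<lambda>t. ?H (?l (circlepath \<zeta> r t)))" if "0 < r" for r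
      proof -
        have "(\<lambda>t. ?H (?l (circlepath \<zeta> r t))) integrable_on {0..1}"
          by (intro integrable_continuous_real continuous_on_circle[OF contHl[of UNIV]]) (use that in auto)
        moreover have "((\<lambda>t::real. - K) has_integral - K) {0..1}"
          using has_integral_const_real[of "- K" 0 1] by simp
        ultimately have "- K \<le> integral {0..1} (\<lambda>t. ?H (?l (circlepath \<zeta> r t)))"
          by (intro has_integral_le[OF _ integrable_integral]) (auto simp: cut_fibre_sum_def)
        then show ?thesis using True by (simp add: cut_fibre_sum_def)
      qed
      then show ?thesis unfolding locally_submean_def by (intro exI[of _ 1]) auto
    next
      case False
      then have reg: "?l \<zeta> \<in> reg" by (rule Q(2))
      obtain W and X :: "(complex^'n) set" and g B where W: "open W" "?l \<zeta> \<in> W" "W \<subseteq> reg" "finite X"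
        "\<And>u z. z \<in> W \<Longrightarrow> fibre_sum u z = (\<Sum>x\<in>X. u (g x z))"
        "\<And>x z. x \<in> X \<Longrightarrow> z \<in> W \<Longrightarrow> g x z \<noteq> 0"
        "\<And>x z. x \<in> X \<Longrightarrow> z \<in> W \<Longrightarrow> (g x has_derivative (\<lambda>h. B x z *v h)) (at z)"
        by (rule local_branches[OF reg]) (rule that)
      have "open (W \<inter> {z. Q z \<noteq> 0})"
        by (intro open_Int W open_Collect_neq continuous_on_polynomial[OF Q(1)] continuous_on_const)
      then have "open (?l -` (W \<inter> {z. Q z \<noteq> 0}))"
        by (rule open_vimage[OF _ contl])
      moreover have "\<zeta> \<in> ?l -` (W \<inter> {z. Q z \<noteq> 0})" using W False by auto
      ultimately obtain R where R: "R > 0" "ball \<zeta> R \<subseteq> ?l -` (W \<inter> {z. Q z \<noteq> 0})"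
        using open_contains_ball by blast
      then have RW: "?l \<xi> \<in> W" "Q (?l \<xi>) \<noteq> 0" if "\<xi> \<in> ball \<zeta> R" for \<xi> using that by blast+
      have "submean_at (\<lambda>\<xi>. u (g x (?l \<xi>))) \<zeta>" if x: "x \<in> X" for x
      proof -
        have "holomorphic_vec (\<lambda>\<xi>. g x (?l \<xi>)) (ball \<zeta> R)"
          unfolding holomorphic_vec_def holomorphic_on_def field_differentiable_def
        proof (intro allI ballI exI)
          fix i \<xi> assume \<xi>: "\<xi> \<in> ball \<zeta> R"
          have "(?l has_derivative (\<lambda>h. h *s b)) (at \<xi>)"
            by (rule has_derivative_vec_componentwise) (auto intro!: derivative_eq_intros)
          from has_derivative_compose[OF this W(7)[OF x RW(1)[OF \<xi>]]]
          have "((\<lambda>\<xi>. g x (?l \<xi>)) has_derivative (\<lambda>h. B x (?l \<xi>) *v (h *s b))) (at \<xi>)" by simp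
          from bounded_linear.has_derivative[OF bounded_linear_vec_nth[of i] this]
          have "((\<lambda>\<xi>. g x (?l \<xi>) $ i) has_derivative (\<lambda>h. (B x (?l \<xi>) *v (h *s b)) $ i)) (at \<xi>)" .
          moreover have "(\<lambda>h. (B x (?l \<xi>) *v (h *s b)) $ i) = (*) ((B x (?l \<xi>) *v b) $ i)"
            by (simp add: fun_eq_iff matrix_vector_mult_def sum_distrib_left sum_distrib_right mult_ac)
          ultimately show "((\<lambda>\<xi>. g x (?l \<xi>) $ i) has_field_derivative ((B x (?l \<xi>) *v b) $ i)) (at \<xi> within ball \<zeta> R)"
            unfolding has_field_derivative_def by (metis has_derivative_at_withinI)
        qed
        then show ?thesis using u R W(6)[OF x] RW unfolding psh_def by blast
      qed
      moreover have "submean_at (\<lambda>\<xi>. \<epsilon> * ln (cmod (Q (?l \<xi>)))) \<zeta>"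
      proof (rule submean_at_ln_cmod[OF _ R(1)])
        obtain P where "\<And>\<xi>. Q (?l \<xi>) = poly P \<xi>" using polynomial_on_line[OF Q(1)] by blast
        then show "(\<lambda>\<xi>. Q (?l \<xi>)) holomorphic_on ball \<zeta> R" by (simp add: holomorphic_intros)
      qed (use RW \<epsilon> in auto)
      ultimately have "submean_at (\<lambda>\<xi>. max ((\<Sum>x\<in>X. u (g x (?l \<xi>))) + \<epsilon> * ln (cmod (Q (?l \<xi>)))) (- K)) \<zeta>"
        by (intro submean_at_max submean_at_add submean_at_sum submean_at_const)
      then have "submean_at (\<lambda>\<xi>. ?H (?l \<xi>)) \<zeta>"
        by (rule submean_at_cong[OF _ R(1)]) (use RW W(5) in \<open>auto simp: cut_fibre_sum_def\<close>)
      then show ?thesis by (simp add: submean_at_def)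
    qed
  qed
  then show ?thesis by simp
qed

end

section \<open>Gaussian means\<close>

lemma power_le_fact_mult_exp: "0 \<le> x \<Longrightarrow> x ^ m \<le> fact m * exp (x::real)"
proof -
  assume x: "0 \<le> x"
  have sums: "(\<lambda>n. x ^ n / fact n) sums exp x"
    using exp_converges[of x] by (simp add: scaleR_conv_of_real field_simps)
  have "(\<Sum>n\<in>{m}. x ^ n / fact n) \<le> exp x"
    unfolding sums_unique[OF sums] by (rule sum_le_suminf) (use sums x in \<open>auto simp: sums_iff\<close>)
  then show ?thesis by (simp add: field_simps)
qed

text \<open>The exponent exceeds the dimension by 2: a ball of radius \<open>1 + n\<close> has
  volume of order \<open>(1 + n) ^ DIM('a)\<close>, which leaves the convergent series of inverse
  squares.\<close>

lemma integrable_inverse_power_norm: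
  "integrable lborel (\<lambda>z::'a::euclidean_space. inverse ((1 + norm z) ^ (DIM('a) + 2)))"
proof (rule integrableI_bounded)
  define m where "m = DIM('a) + 2"
  let ?f = "\<lambda>z::'a. inverse ((1 + norm z) ^ m)"
  define c where "c = unit_ball_vol (real DIM('a))"
  have c: "0 \<le> c" by (simp add: c_def)
  let ?g = "\<lambda>n z. ennreal (inverse ((1 + real n) ^ m)) * indicator (cball (0::'a) (1 + real n)) z"
  have le: "ennreal (norm (?f z)) \<le> (\<Sum>n. ?g n z)" for z
  proof -
    define n where "n = nat \<lfloor>norm z\<rfloor>"
    have n: "real n \<le> norm z" "norm z \<le> 1 + real n" by (auto simp: n_def) linarith+
    have "?f z \<le> inverse ((1 + real n) ^ m)"
      using n by (intro le_imp_inverse_le power_mono) auto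
    then have "ennreal (norm (?f z)) \<le> ?g n z"
      using n by (simp add: indicator_def ennreal_leI)
    also have "?g n z \<le> (\<Sum>n. ?g n z)"
    proof -
      have "h n \<le> suminf h" for h :: "nat \<Rightarrow> ennreal"
        using sum_le_suminf[of h "{n}"] by simp
      from this[of "\<lambda>n. ?g n z"] show ?thesis .
    qed
    finally show ?thesis .
  qed
  have [measurable]: "cball (0::'a) r \<in> sets borel" for r by simp
  have term_eq: "(\<integral>\<^sup>+z. ?g n z \<partial>lborel) = ennreal (c * inverse ((1 + real n) ^ 2))" for n
  proof -
    have "(\<integral>\<^sup>+z. ?g n z \<partial>lborel) = ennreal (inverse ((1 + real n) ^ m)) * ennreal (c * (1 + real n) ^ DIM('a))"
      by (subst nn_integral_cmult_indicator) (auto simp: emeasure_cball c_def)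
    also have "\<dots> = ennreal (inverse ((1 + real n) ^ m) * (c * (1 + real n) ^ DIM('a)))"
      by (rule ennreal_mult[symmetric]) (use c in auto)
    also have "inverse ((1 + real n) ^ m) * (c * (1 + real n) ^ DIM('a)) = c * inverse ((1 + real n) ^ 2)"
    proof -
      have "inverse (x ^ (k + 2)) * (c * x ^ k) = c * inverse (x ^ 2)" if "x > 0" for x :: real and k
        using that by (simp add: power_add power2_eq_square field_simps)
      from this[of "1 + real n"] show ?thesis by (simp only: m_def)
    qed
    finally show ?thesis .
  qed
  have "(\<integral>\<^sup>+z. ennreal (norm (?f z)) \<partial>lborel) \<le> (\<integral>\<^sup>+z. (\<Sum>n. ?g n z) \<partial>lborel)"
    by (intro nn_integral_mono le)
  also have "\<dots> = (\<Sum>n. \<integral>\<^sup>+z. ?g n z \<partial>lborel)"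
    by (rule nn_integral_suminf) measurable
  also have "\<dots> = (\<Sum>n. ennreal (c * inverse ((1 + real n) ^ 2)))" by (simp only: term_eq)
  also have "\<dots> < \<infinity>"
  proof -
    have "summable (\<lambda>n. c * inverse ((1 + real n) ^ 2))"
      using inverse_squares_sums by (intro summable_mult) (auto simp: sums_iff inverse_eq_divide add_ac)
    then show ?thesis
      using c by (subst suminf_ennreal2) auto
  qed
  finally show "(\<integral>\<^sup>+z. ennreal (norm (inverse ((1 + norm (z::'a)) ^ (DIM('a) + 2)))) \<partial>lborel) < \<infinity>"
    unfolding m_def .
qed simp

lemma power_mult_exp_neg_square_le:
  fixes a r :: real
  assumes "0 < a" "0 \<le> r"
  shows "(1 + r) ^ m * exp (- (a * r\<^sup>2)) \<le> fact m * exp (1 + 1 / (4 * a))"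
proof -
  \<comment> \<open>Completing the square bounds \<open>r - a * r\<^sup>2\<close> by
    \<open>1 / (4 * a)\<close>.\<close>
  have "0 \<le> a * (r - 1 / (2 * a))\<^sup>2" using assms by simp
  also have "\<dots> = a * r\<^sup>2 - r + 1 / (4 * a)"
    using assms by (simp add: power2_eq_square field_simps)
  finally have *: "1 + r - a * r\<^sup>2 \<le> 1 + 1 / (4 * a)" by simp
  have "(1 + r) ^ m * exp (- (a * r\<^sup>2)) \<le> (fact m * exp (1 + r)) * exp (- (a * r\<^sup>2))"
    using assms by (intro mult_right_mono power_le_fact_mult_exp) auto
  also have "\<dots> = fact m * exp (1 + r - a * r\<^sup>2)" by (simp add: exp_diff exp_minus field_simps)
  also have "\<dots> \<le> fact m * exp (1 + 1 / (4 * a))" using * by simp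
  finally show ?thesis .
qed

lemma integrable_power_mult_gaussian:
  fixes a :: real
  assumes "0 < a"
  shows "integrable lborel (\<lambda>z::'a::euclidean_space. (1 + norm z) ^ p * exp (- (a * (norm z)\<^sup>2)))"
proof -
  let ?D = "DIM('a) + 2"
  define C where "C = fact (p + ?D) * exp (1 + 1 / (4 * a))"
  have "integrable lborel (\<lambda>z::'a. C * inverse ((1 + norm z) ^ ?D))"
    by (intro integrable_mult_right integrable_inverse_power_norm)
  then show ?thesis
  proof (rule Bochner_Integration.integrable_bound)
    show "AE z::'a in lborel. norm ((1 + norm z) ^ p * exp (- (a * (norm z)\<^sup>2))) \<le> norm (C * inverse ((1 + norm z) ^ ?D))"
    proof (rule AE_I2)
      fix z :: 'a
      have pos: "0 < (1 + norm z) ^ ?D" by (intro zero_less_power add_pos_nonneg) auto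
      have "(1 + norm z) ^ (p + ?D) * exp (- (a * (norm z)\<^sup>2)) \<le> C"
        unfolding C_def by (rule power_mult_exp_neg_square_le[OF assms]) simp
      moreover have "(1 + norm z) ^ (p + ?D) = (1 + norm z) ^ p * (1 + norm z) ^ ?D" by (rule power_add)
      ultimately have "(1 + norm z) ^ p * exp (- (a * (norm z)\<^sup>2)) * (1 + norm z) ^ ?D \<le> C"
        by (metis mult.assoc mult.commute)
      then have "(1 + norm z) ^ p * exp (- (a * (norm z)\<^sup>2)) \<le> C * inverse ((1 + norm z) ^ ?D)"
        using pos_le_divide_eq[OF pos] unfolding divide_inverse by blast
      moreover have "0 \<le> (1 + norm z) ^ p * exp (- (a * (norm z)\<^sup>2))" by simp
      ultimately show "norm ((1 + norm z) ^ p * exp (- (a * (norm z)\<^sup>2))) \<le> norm (C * inverse ((1 + norm z) ^ ?D))"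
        unfolding real_norm_def by (smt (verit))
    qed
  qed simp
qed

text \<open>From \<open>|z|^2 \<le> 2 |z - y|^2 + 2 |y|^2\<close>: halving the decay rate gives one
  integrable majorant for all shifts in a bounded set.\<close>

lemma gaussian_shift_le:
  fixes y z :: "'a::real_normed_vector"
  shows "exp (- (norm (z - y))\<^sup>2) \<le> exp ((norm y)\<^sup>2) * exp (- (1/2 * (norm z)\<^sup>2))"
proof -
  have "norm z \<le> norm (z - y) + norm y" using norm_triangle_ineq[of "z - y" y] by simp
  then have "(norm z)\<^sup>2 \<le> (norm (z - y) + norm y)\<^sup>2" by (intro power_mono) auto
  also have "\<dots> \<le> 2 * (norm (z - y))\<^sup>2 + 2 * (norm y)\<^sup>2"
    using sum_squares_bound[of "norm (z - y)" "norm y"] by (simp add: power2_sum)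
  finally have "- (norm (z - y))\<^sup>2 \<le> (norm y)\<^sup>2 + - (1/2 * (norm z)\<^sup>2)" by simp
  then show ?thesis by (simp flip: exp_add)
qed

lemma tendsto_gaussian_shift_L1:
  fixes y :: "nat \<Rightarrow> 'a::euclidean_space"
  assumes "y \<longlonglongrightarrow> 0"
  shows "(\<lambda>n. \<integral>z. \<bar>exp (- (norm (z - y n))\<^sup>2) - exp (- (norm z)\<^sup>2)\<bar> \<partial>lborel) \<longlonglongrightarrow> 0"
proof -
  obtain M where M: "\<And>n. norm (y n) \<le> M"
    using convergent_imp_bounded[OF assms] by (auto simp: bounded_iff)
  let ?w = "\<lambda>z::'a. (exp (M\<^sup>2) + 1) * exp (- (1/2 * (norm z)\<^sup>2))"
  have "(\<lambda>n. \<integral>z. \<bar>exp (- (norm (z - y n))\<^sup>2) - exp (- (norm z)\<^sup>2)\<bar> \<partial>lborel) \<longlonglongrightarrow> (\<integral>z. \<bar>exp (- (norm (z - 0::'a))\<^sup>2) - exp (- (norm z)\<^sup>2)\<bar> \<partial>lborel)"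
  proof (rule integral_dominated_convergence[where w = ?w])
    show "integrable lborel ?w"
      using integrable_power_mult_gaussian[of "1/2" 0, where ?'a = 'a] by (intro integrable_mult_right) simp
    show "AE z in lborel. (\<lambda>n. \<bar>exp (- (norm (z - y n))\<^sup>2) - exp (- (norm z)\<^sup>2)\<bar>) \<longlonglongrightarrow> \<bar>exp (- (norm (z - 0))\<^sup>2) - exp (- (norm z)\<^sup>2)\<bar>"
      by (intro AE_I2 tendsto_intros assms)
    show "AE z in lborel. norm (\<bar>exp (- (norm (z - y n))\<^sup>2) - exp (- (norm z)\<^sup>2)\<bar>) \<le> ?w z" for n
    proof (rule AE_I2)
      fix z :: 'a
      have "(norm (y n))\<^sup>2 \<le> M\<^sup>2" using M[of n] by (intro power_mono) auto
      then have "exp (- (norm (z - y n))\<^sup>2) \<le> exp (M\<^sup>2) * exp (- (1/2 * (norm z)\<^sup>2))"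
        by (intro order.trans[OF gaussian_shift_le] mult_right_mono) auto
      moreover have "exp (- (norm z)\<^sup>2) \<le> exp (- (1/2 * (norm z)\<^sup>2))" by simp
      ultimately have "\<bar>exp (- (norm (z - y n))\<^sup>2) - exp (- (norm z)\<^sup>2)\<bar>
          \<le> exp (M\<^sup>2) * exp (- (1/2 * (norm z)\<^sup>2)) + exp (- (1/2 * (norm z)\<^sup>2))"
        by (smt (verit) exp_gt_zero)
      then show "norm (\<bar>exp (- (norm (z - y n))\<^sup>2) - exp (- (norm z)\<^sup>2)\<bar>) \<le> ?w z"
        by (simp add: distrib_right)
    qed
  qed simp_all
  then show ?thesis by simp
qed

text \<open>The measure-theoretic facts about linear maps and critical values are available in the
  library for index types that are well-ordered; \<open>'n bit0\<close> is such a type with twice as many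
  elements as \<open>'n\<close>.\<close>

lemma real_coordinates:
  obtains \<phi> :: "complex^'n::finite \<Rightarrow> real^('n bit0)" and \<psi>
  where "linear \<phi>" "linear \<psi>" "\<And>x. \<psi> (\<phi> x) = x" "\<And>y. \<phi> (\<psi> y) = y"
    "\<And>x y. \<phi> x \<bullet> \<phi> y = x \<bullet> y"
    "\<And>x. norm (\<phi> x) = norm x" "\<And>y. norm (\<psi> y) = norm y" "distr lborel borel \<phi> = lborel"
proof -
  have "card (Basis :: (complex^'n) set) = card (Basis :: (real^('n bit0)) set)" by simp
  then obtain h where h: "bij_betw h (Basis :: (complex^'n) set) (Basis :: (real^('n bit0)) set)"
    using finite_same_card_bij[OF finite_Basis finite_Basis] by blast
  define \<phi> where "\<phi> x = (\<Sum>b\<in>Basis. (x \<bullet> b) *\<^sub>R h b)" for x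
  define \<psi> where "\<psi> y = (\<Sum>b\<in>Basis. (y \<bullet> h b) *\<^sub>R b)" for y
  have hB: "h b \<in> Basis" if "b \<in> Basis" for b using h that by (auto simp: bij_betw_def)
  have hh: "h b \<bullet> h b' = (if b = b' then 1 else 0)" if "b \<in> Basis" "b' \<in> Basis" for b b'
    using inner_Basis[OF hB[OF that(1)] hB[OF that(2)]] h that by (auto simp: bij_betw_def inj_on_eq_iff)
  have lin: "linear \<phi>" "linear \<psi>"
    unfolding \<phi>_def \<psi>_def
    by (auto intro!: linearI simp: inner_add_left scaleR_add_left sum.distrib scaleR_sum_right)
  have \<phi>h: "\<phi> x \<bullet> h b = x \<bullet> b" if "b \<in> Basis" for x b
    unfolding \<phi>_def inner_sum_left using that by (simp add: hh sum.delta if_distrib cong: if_cong sum.cong)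
  have \<psi>b: "\<psi> y \<bullet> b = y \<bullet> h b" if "b \<in> Basis" for y b
    unfolding \<psi>_def inner_sum_left using that by (simp add: inner_Basis sum.delta if_distrib cong: if_cong sum.cong)
  have \<psi>\<phi>: "\<psi> (\<phi> x) = x" for x by (rule euclidean_eqI) (simp add: \<psi>b \<phi>h)
  have \<phi>\<psi>: "\<phi> (\<psi> y) = y" for y
  proof (rule euclidean_eqI)
    fix b' :: "real^('n bit0)" assume "b' \<in> Basis"
    then obtain b where "b \<in> Basis" "b' = h b" using h by (auto simp: bij_betw_def)
    then show "\<phi> (\<psi> y) \<bullet> b' = y \<bullet> b'" by (simp add: \<phi>h \<psi>b)
  qed
  have inner: "\<phi> x \<bullet> \<phi> y = x \<bullet> y" for x y
  proof -
    have "\<phi> x \<bullet> \<phi> y = (\<Sum>b\<in>Basis. (y \<bullet> b) * (\<phi> x \<bullet> h b))"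
      unfolding \<phi>_def[of y] inner_sum_right by simp
    also have "\<dots> = (\<Sum>b\<in>Basis. (x \<bullet> b) * (y \<bullet> b))" by (intro sum.cong refl) (simp add: \<phi>h)
    finally show ?thesis by (simp add: euclidean_inner[of x y])
  qed
  have norm\<phi>: "norm (\<phi> x) = norm x" for x by (simp add: norm_eq_sqrt_inner inner)
  have norm\<psi>: "norm (\<psi> y) = norm y" for y using norm\<phi>[of "\<psi> y"] by (simp add: \<phi>\<psi>)
  have [measurable]: "\<phi> \<in> borel_measurable borel"
    using lin(1) by (intro borel_measurable_continuous_onI linear_continuous_on) (simp add: linear_conv_bounded_linear)
  have "lborel = distr lborel borel \<phi>"
  proof (rule lborel_eqI)
    fix l u :: "real^('n bit0)" assume lu: "\<And>b. b \<in> Basis \<Longrightarrow> l \<bullet> b \<le> u \<bullet> b"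
    have mem: "\<phi> x \<in> box l u \<longleftrightarrow> x \<in> box (\<psi> l) (\<psi> u)" for x
    proof -
      have "\<phi> x \<in> box l u \<longleftrightarrow> (\<forall>b\<in>h ` Basis. l \<bullet> b < \<phi> x \<bullet> b \<and> \<phi> x \<bullet> b < u \<bullet> b)"
        using h by (simp add: mem_box bij_betw_def)
      also have "\<dots> \<longleftrightarrow> x \<in> box (\<psi> l) (\<psi> u)" by (simp add: mem_box \<phi>h \<psi>b)
      finally show ?thesis .
    qed
    have "emeasure (distr lborel borel \<phi>) (box l u) = emeasure lborel (\<phi> -` box l u)"
      by (subst emeasure_distr) auto
    also have "\<phi> -` box l u = box (\<psi> l) (\<psi> u)" using mem by auto
    also have "emeasure lborel (box (\<psi> l) (\<psi> u)) = (\<Prod>b\<in>Basis. (\<psi> u - \<psi> l) \<bullet> b)"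
      by (rule emeasure_lborel_box) (simp add: \<psi>b lu hB)
    also have "(\<Prod>b\<in>Basis. (\<psi> u - \<psi> l) \<bullet> b) = (\<Prod>b\<in>Basis. (u - l) \<bullet> h b)"
      by (intro prod.cong refl) (simp add: inner_diff_left \<psi>b)
    also have "\<dots> = (\<Prod>b\<in>Basis. (u - l) \<bullet> b)"
      by (rule prod.reindex_bij_betw[OF h])
    finally show "emeasure (distr lborel borel \<phi>) (box l u) = (\<Prod>b\<in>Basis. (u - l) \<bullet> b)" .
  qed simp
  then show ?thesis by (intro that[OF lin \<psi>\<phi> \<phi>\<psi> inner norm\<phi> norm\<psi>]) simp
qed

lemma lborel_distr_orthogonal_wellorder:
  fixes T :: "real^'m::{finite,wellorder} \<Rightarrow> real^'m::_"
  assumes "orthogonal_transformation T"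
  shows "distr lborel borel T = lborel"
proof (rule lborel_eqI[symmetric])
  have bl: "bounded_linear T" using assms by (simp add: orthogonal_transformation_linear linear_conv_bounded_linear[symmetric])
  have [measurable]: "T \<in> borel_measurable borel"
    by (intro borel_measurable_continuous_onI linear_continuous_on bl)
  fix l u :: "(real, 'm) vec" assume lu: "\<And>b. b \<in> Basis \<Longrightarrow> l \<bullet> b \<le> u \<bullet> b"
  have inv: "orthogonal_transformation (inv T)" by (rule orthogonal_transformation_inv[OF assms])
  have eq: "T -` box l u = inv T ` box l u"
    using orthogonal_transformation_bij[OF assms] by (rule bij_vimage_eq_inv_image)
  have lm: "T -` box l u \<in> lmeasurable" unfolding eq by (rule measurable_orthogonal_image[OF inv]) simp
  have borel: "T -` box l u \<in> sets borel" using measurable_sets_borel[of T borel "box l u"] by simp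
  have "emeasure (distr lborel borel T) (box l u) = emeasure lborel (T -` box l u)"
    by (subst emeasure_distr) auto
  also have "\<dots> = emeasure lebesgue (T -` box l u)"
    using borel by (simp add: main_part_sets)
  also have "\<dots> = ennreal (measure lebesgue (T -` box l u))"
    by (rule emeasure_eq_measure2[OF lm])
  also have "measure lebesgue (T -` box l u) = measure lebesgue (box l u)"
    unfolding eq by (rule measure_orthogonal_image[OF inv]) simp
  also have "ennreal (measure lebesgue (box l u)) = (\<Prod>b\<in>Basis. (u - l) \<bullet> b)"
    by (subst measure_completion) (auto simp: measure_lborel_box lu)
  finally show "emeasure (distr lborel borel T) (box l u) = (\<Prod>b\<in>Basis. (u - l) \<bullet> b)" .
qed simp

text \<open>Unimodular multiplication preserves norms, hence is orthogonal in real coordinates. This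
  invariance is what turns circle means into Gaussian means.\<close>

lemma lborel_distr_unimodular_mult:
  fixes c :: complex
  assumes "cmod c = 1"
  shows "distr lborel borel (\<lambda>z::complex^'n::finite. c *s z) = lborel"
proof -
  obtain \<phi> :: "complex^'n::finite \<Rightarrow> real^('n bit0)" and \<psi>
    where \<phi>: "linear \<phi>" "linear \<psi>" "\<And>x. \<psi> (\<phi> x) = x" "\<And>y. \<phi> (\<psi> y) = y"
    "\<And>x y. \<phi> x \<bullet> \<phi> y = x \<bullet> y"
    "\<And>x. norm (\<phi> x) = norm x" "\<And>y. norm (\<psi> y) = norm y" "distr lborel borel \<phi> = lborel"
    using real_coordinates by metis
  define T where "T y = \<phi> (c *s \<psi> y)" for y
  have "linear (\<lambda>z::complex^'n. c *s z)"
    by (rule linearI) (simp_all add: vec_eq_iff algebra_simps)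
  then have lin: "linear T"
    using linear_compose[OF linear_compose[OF \<phi>(2)] \<phi>(1)] unfolding T_def by (simp add: o_def)
  have "orthogonal_transformation T"
    unfolding orthogonal_transformation using lin by (simp add: T_def \<phi>(6,7) norm_vsmult assms)
  then have inv: "distr lborel borel T = lborel" by (rule lborel_distr_orthogonal_wellorder)
  have meas: "\<phi> \<in> borel_measurable borel" "\<psi> \<in> borel_measurable borel"
    using \<phi>(1,2) by (auto intro!: borel_measurable_continuous_onI linear_continuous_on simp: linear_conv_bounded_linear)
  have measT: "T \<in> borel_measurable borel"
    using lin by (auto intro!: borel_measurable_continuous_onI linear_continuous_on simp: linear_conv_bounded_linear)
  note [measurable] = meas measT
  have "(\<lambda>z::complex^'n. c *s z) = (\<lambda>z. \<psi> (T (\<phi> z)))" by (simp add: fun_eq_iff T_def \<phi>(3))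
  then have "distr lborel borel (\<lambda>z::complex^'n. c *s z) = distr (distr (distr lborel borel \<phi>) borel T) borel \<psi>"
    by (simp add: distr_distr comp_def)
  also have "\<dots> = distr (distr lborel borel \<phi>) borel \<psi>" by (simp only: \<phi>(8) inv)
  also have "\<dots> = distr lborel borel (\<psi> \<circ> \<phi>)" by (subst distr_distr) auto
  also have "\<psi> \<circ> \<phi> = id" by (simp add: fun_eq_iff \<phi>(3))
  also have "distr lborel borel id = (lborel :: (complex^'n) measure)"
    by (rule lborel_eqI[symmetric]) (auto simp: emeasure_distr)
  finally show ?thesis .
qed

text \<open>Sard's theorem in real coordinates: a singular complex matrix has a nontrivial kernel,
  so the corresponding real derivative has deficient rank.\<close>

lemma negligible_critical_values:
  fixes F :: "complex^'n::finite \<Rightarrow> complex^'n"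
  assumes "\<And>x. (F has_derivative (\<lambda>h. A x *v h)) (at x)"
  shows "negligible (F ` {x. det (A x) = 0})"
proof -
  obtain \<phi> :: "complex^'n::finite \<Rightarrow> real^('n bit0)" and \<psi>
    where \<phi>: "linear \<phi>" "linear \<psi>" "\<And>x. \<psi> (\<phi> x) = x" "\<And>y. \<phi> (\<psi> y) = y"
    using real_coordinates by metis
  have bl: "bounded_linear \<phi>" "bounded_linear \<psi>" using \<phi> by (auto simp: linear_conv_bounded_linear)
  define S where "S = {x. det (A x) = 0}"
  define G where "G y = \<phi> (F (\<psi> y))" for y
  define D where "D y h = \<phi> (A (\<psi> y) *v \<psi> h)" for y h
  have der: "(G has_derivative D y) (at y within T)" for y T
    unfolding G_def D_def
    by (rule has_derivative_at_withinI)
      (intro bounded_linear.has_derivative[OF bl(1)]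
        has_derivative_compose[OF bounded_linear.has_derivative[OF bl(2) has_derivative_ident] assms])
  have "negligible (G ` (\<phi> ` S))"
  proof (rule baby_Sard)
    show "(G has_derivative D y) (at y within \<phi> ` S)" for y by (rule der)
    fix y assume "y \<in> \<phi> ` S"
    then have "det (A (\<psi> y)) = 0" using \<phi>(3) by (auto simp: S_def)
    then have "\<not> inj ((*v) (A (\<psi> y)))"
      by (metis invertible_det_nz invertible_left_inverse matrix_left_invertible_injective)
    then obtain a b where ab: "A (\<psi> y) *v a = A (\<psi> y) *v b" "a \<noteq> b" by (auto simp: inj_def)
    have lin: "linear (D y)" using has_derivative_linear[OF der] .
    have "D y (\<phi> a) = D y (\<phi> b)" "\<phi> a \<noteq> \<phi> b" using ab \<phi>(3) by (auto simp: D_def) metis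
    then have "\<not> inj ((*v) (matrix (D y)))"
      using lin by (auto simp: inj_def matrix_works)
    then have "rank (matrix (D y)) \<noteq> CARD('n bit0)" by (simp only: full_rank_injective not_False_eq_True)
    moreover have "rank (matrix (D y)) \<le> CARD('n bit0)" using rank_bound[of "matrix (D y)"] by simp
    ultimately show "rank (matrix (D y)) < CARD('n bit0)" by linarith
  qed simp
  then have "negligible (\<psi> ` G ` \<phi> ` S)"
    by (rule negligible_differentiable_image_negligible[rotated])
      (auto intro!: linear_imp_differentiable_on \<phi>)
  moreover have "\<psi> ` G ` \<phi> ` S = F ` S" by (simp add: image_image G_def \<phi>)
  ultimately show ?thesis by (simp add: S_def)
qed

section \<open>The normalized Gaussian and its submean inequality\<close>

text \<open>Dividing by the integral itself makes the total mass 1 immediate; the constant ratio to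
  \<open>gauss\<close> becomes the density \<rho> required by \<open>smooth_prob\<close>.\<close>

definition gdens :: "complex^'n::finite \<Rightarrow> real" where
  "gdens z = exp (- (norm z)\<^sup>2) / (\<integral>z. exp (- (norm (z :: complex^'n))\<^sup>2) \<partial>lborel)"

lemma integrable_exp_neg_norm_square: "integrable lborel (\<lambda>z::'a::euclidean_space. exp (- (norm z)\<^sup>2))"
  using integrable_power_mult_gaussian[of 1 0, where ?'a = 'a] by simp

lemma integral_exp_neg_norm_square_pos: "0 < (\<integral>z. exp (- (norm (z::'a::euclidean_space))\<^sup>2) \<partial>lborel)"
proof -
  have "0 \<le> (\<integral>z. exp (- (norm (z::'a))\<^sup>2) \<partial>lborel)" by (rule integral_nonneg_AE) simp
  moreover have "(\<integral>z. exp (- (norm (z::'a))\<^sup>2) \<partial>lborel) \<noteq> 0"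
  proof
    assume "(\<integral>z. exp (- (norm (z::'a))\<^sup>2) \<partial>lborel) = 0"
    then have "AE z::'a in lborel. exp (- (norm z)\<^sup>2) = 0"
      using integral_nonneg_eq_0_iff_AE[OF integrable_exp_neg_norm_square[where ?'a = 'a]] by simp
    then have "ae_filter (lborel :: 'a measure) = bot" by (simp add: trivial_limit_def)
    then show False by (simp add: ae_filter_eq_bot_iff)
  qed
  ultimately show ?thesis by linarith
qed

lemma gdens_nonneg [simp]: "0 \<le> gdens z"
  unfolding gdens_def by (intro divide_nonneg_pos integral_exp_neg_norm_square_pos) simp

lemma borel_measurable_gdens [measurable]: "gdens \<in> borel_measurable borel"
  unfolding gdens_def by measurable

lemma integrable_gdens: "integrable lborel gdens"
  unfolding gdens_def by (intro integrable_divide_zero integrable_exp_neg_norm_square)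

lemma integral_gdens: "(\<integral>z. gdens (z::complex^'n::finite) \<partial>lborel) = 1"
  unfolding gdens_def using integral_exp_neg_norm_square_pos[where ?'a = "complex^'n"] by simp

lemma gdens_vsmult: "cmod c = 1 \<Longrightarrow> gdens (c *s z) = gdens z"
  by (simp add: gdens_def norm_vsmult)

lemma nn_integral_lborel_translate:
  fixes f :: "'a::euclidean_space \<Rightarrow> ennreal"
  assumes [measurable]: "f \<in> borel_measurable borel"
  shows "(\<integral>\<^sup>+z. f (y + z) \<partial>lborel) = (\<integral>\<^sup>+z. f z \<partial>lborel)"
  by (subst (2) lborel_distr_plus[of y, symmetric]) (simp add: nn_integral_distr)

lemma nn_integral_lborel_unimodular:
  fixes f :: "complex^'n::finite \<Rightarrow> ennreal"
  assumes [measurable]: "f \<in> borel_measurable borel" and c: "cmod c = 1"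
  shows "(\<integral>\<^sup>+z. f (c *s z) \<partial>lborel) = (\<integral>\<^sup>+z. f z \<partial>lborel)"
proof -
  have [measurable]: "(\<lambda>z::complex^'n. c *s z) \<in> borel_measurable borel"
    by (intro borel_measurable_continuous_onI continuous_intros)
  show ?thesis
    by (subst (2) lborel_distr_unimodular_mult[OF c, symmetric]) (simp add: nn_integral_distr)
qed

lemma has_bochner_integral_gdens_translate:
  fixes y :: "complex^'n::finite"
  shows "has_bochner_integral lborel (\<lambda>z. gdens (z - y)) 1"
proof (rule has_bochner_integral_nn_integral)
  have "(\<integral>\<^sup>+z. ennreal (gdens (z - y)) \<partial>lborel) = (\<integral>\<^sup>+z. ennreal (gdens (z::complex^'n)) \<partial>lborel)"
    using nn_integral_lborel_translate[of "\<lambda>z. ennreal (gdens (z - y))" y] by simp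
  also have "\<dots> = ennreal 1"
    by (subst nn_integral_eq_integral[OF integrable_gdens]) (auto simp: integral_gdens)
  finally show "(\<integral>\<^sup>+z. ennreal (gdens (z - y)) \<partial>lborel) = ennreal 1" .
qed auto

text \<open>The circle inequality is averaged over \<open>b\<close> with Gaussian weight. By
  rotation invariance all points of the circle contribute the same integral, so the mean over the
  angle disappears. The majorant \<open>B\<close> replaces \<open>H\<close> because the fibre sums
  are explicitly controlled only from above.\<close>

lemma gaussian_submean:
  fixes H B :: "complex^'n::finite \<Rightarrow> real"
  assumes cont: "continuous_on UNIV H"
    and sub: "\<And>b. H y \<le> integral {0..1} (\<lambda>t. H (y + circlepath 0 1 t *s b))"
    and lower: "\<And>z. - K \<le> H z" and le: "\<And>z. H z \<le> B z"
    and [measurable]: "B \<in> borel_measurable borel"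
    and int: "integrable lborel (\<lambda>z. B z * gdens (z - y))"
  shows "H y \<le> (\<integral>z. B z * gdens (z - y) \<partial>lborel)"
proof -
  have [measurable]: "H \<in> borel_measurable borel" by (rule borel_measurable_continuous_onI[OF cont])
  let ?c = "circlepath 0 1"
  have cmod_c: "cmod (?c t) = 1" for t by (simp add: circlepath)
  have contc: "continuous_on UNIV ?c" by (intro continuous_intros)
  have contp: "continuous_on UNIV (\<lambda>(b, t). y + ?c t *s b)"
    unfolding case_prod_unfold circlepath by (intro continuous_intros)
  have measp: "(\<lambda>(b, t). y + ?c t *s b) \<in> borel_measurable (borel \<Otimes>\<^sub>M borel)"
    unfolding borel_prod by (rule borel_measurable_continuous_onI[OF contp])
  \<comment> \<open>Adding \<open>K\<close> makes the integrand nonnegative, so the two integrations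
    may be exchanged before any integrability of \<open>H\<close> is known.\<close>
  define h where "h z = ennreal (H z + K)" for z
  have meash [measurable]: "h \<in> borel_measurable borel" unfolding h_def by measurable
  have measP [measurable]: "(\<lambda>(b, t). h (y + ?c t *s b)) \<in> borel_measurable (borel \<Otimes>\<^sub>M borel)"
    using measurable_compose[OF measp meash] by (simp add: case_prod_unfold)
  have step: "h y \<le> (\<integral>\<^sup>+t. indicator {0..1} t * h (y + ?c t *s b) \<partial>lborel)" for b
  proof -
    have contb: "continuous_on UNIV (\<lambda>t. H (y + ?c t *s b))"
      by (rule continuous_on_compose2[OF cont]) (auto intro!: continuous_intros)
    then have "(\<lambda>t. H (y + ?c t *s b)) integrable_on {0..1}"
      by (intro integrable_continuous_real) (rule continuous_on_subset, auto)
    then have "((\<lambda>t. H (y + ?c t *s b) + K) has_integral (integral {0..1} (\<lambda>t. H (y + ?c t *s b)) + K)) {0..1}"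
      using has_integral_add[OF integrable_integral has_integral_const_real[of K 0 1]] by simp
    then have hi: "((\<lambda>t. if t \<in> {0..1} then H (y + ?c t *s b) + K else 0) has_integral
        (integral {0..1} (\<lambda>t. H (y + ?c t *s b)) + K)) UNIV"
      by (simp only: has_integral_restrict_UNIV)
    have "(\<lambda>t. H (y + ?c t *s b)) \<in> borel_measurable borel"
      by (rule borel_measurable_continuous_onI[OF contb])
    then have m: "(\<lambda>t. if t \<in> {0..1} then H (y + ?c t *s b) + K else 0) \<in> borel_measurable borel"
      by measurable
    have "(\<integral>\<^sup>+t. ennreal (if t \<in> {0..1} then H (y + ?c t *s b) + K else 0) \<partial>lborel)
        = ennreal (integral {0..1} (\<lambda>t. H (y + ?c t *s b)) + K)"
    proof (rule nn_integral_has_integral_lborel[OF m _ hi])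
      show "0 \<le> (if t \<in> {0..1} then H (y + ?c t *s b) + K else 0)" for t
        using lower[of "y + ?c t *s b"] by simp
    qed
    moreover have "(\<lambda>t. ennreal (if t \<in> {0..1} then H (y + ?c t *s b) + K else 0)) =
        (\<lambda>t. indicator {0..1} t * h (y + ?c t *s b))"
      by (auto simp: fun_eq_iff h_def indicator_def)
    ultimately show ?thesis unfolding h_def using sub[of b] by (simp add: ennreal_leI)
  qed
  have one: "(\<integral>\<^sup>+b. ennreal (gdens (b::complex^'n)) \<partial>lborel) = 1"
    by (subst nn_integral_eq_integral[OF integrable_gdens]) (auto simp: integral_gdens)
  have "h y = (\<integral>\<^sup>+b. h y * ennreal (gdens (b::complex^'n)) \<partial>lborel)"
    by (subst nn_integral_cmult) (auto simp: one)
  also have "\<dots> \<le> (\<integral>\<^sup>+b. (\<integral>\<^sup>+t. indicator {0..1} t * h (y + ?c t *s b) \<partial>lborel) * ennreal (gdens b) \<partial>lborel)"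
    by (intro nn_integral_mono mult_right_mono step) simp
  also have "\<dots> = (\<integral>\<^sup>+b. (\<integral>\<^sup>+t. indicator {0..1} t * h (y + ?c t *s b) * ennreal (gdens b) \<partial>lborel) \<partial>lborel)"
    by (intro nn_integral_cong, subst nn_integral_multc) auto
  also have "\<dots> = (\<integral>\<^sup>+t. (\<integral>\<^sup>+b. indicator {0..1} t * h (y + ?c t *s b) * ennreal (gdens b) \<partial>lborel) \<partial>lborel)"
    by (rule lborel_pair.Fubini') measurable
  \<comment> \<open>Substitute the rotated vector for \<open>b\<close>: Lebesgue measure and the
    Gaussian weight are both unchanged, and the inner integral no longer depends on
    \<open>t\<close>.\<close>
  also have "\<dots> = (\<integral>\<^sup>+t. indicator {0..1::real} t * (\<integral>\<^sup>+b. h (y + b) * ennreal (gdens b) \<partial>lborel) \<partial>lborel)"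
  proof (intro nn_integral_cong)
    fix t :: real
    have [measurable]: "(\<lambda>b. h (y + ?c t *s b)) \<in> borel_measurable borel"
      by (rule measurable_compose[OF borel_measurable_continuous_onI meash]) (intro continuous_intros)
    have "(\<integral>\<^sup>+b. indicator {0..1} t * h (y + ?c t *s b) * ennreal (gdens b) \<partial>lborel)
      = indicator {0..1} t * (\<integral>\<^sup>+b. h (y + ?c t *s b) * ennreal (gdens (?c t *s b)) \<partial>lborel)"
      by (subst nn_integral_cmult[symmetric]) (auto simp: mult.assoc gdens_vsmult[OF cmod_c])
    also have "(\<integral>\<^sup>+b. h (y + ?c t *s b) * ennreal (gdens (?c t *s b)) \<partial>lborel) = (\<integral>\<^sup>+b. h (y + b) * ennreal (gdens b) \<partial>lborel)"
      by (rule nn_integral_lborel_unimodular[of "\<lambda>b. h (y + b) * ennreal (gdens b)", OF _ cmod_c]) measurable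
    finally show "(\<integral>\<^sup>+b. indicator {0..1} t * h (y + ?c t *s b) * ennreal (gdens b) \<partial>lborel)
      = indicator {0..1} t * (\<integral>\<^sup>+b. h (y + b) * ennreal (gdens b) \<partial>lborel)" .
  qed
  also have "\<dots> = (\<integral>\<^sup>+b. h (y + b) * ennreal (gdens b) \<partial>lborel)"
    by (subst nn_integral_multc) auto
  also have "\<dots> = (\<integral>\<^sup>+z. h z * ennreal (gdens (z - y)) \<partial>lborel)"
    by (subst nn_integral_lborel_translate[of "\<lambda>z. h z * ennreal (gdens (z - y))" y, symmetric]) auto
  also have "\<dots> \<le> (\<integral>\<^sup>+z. ennreal ((B z + K) * gdens (z - y)) \<partial>lborel)"
    using le by (intro nn_integral_mono) (auto simp: h_def ennreal_mult'' intro!: mult_right_mono ennreal_leI)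
  also have "\<dots> = ennreal (\<integral>z. (B z + K) * gdens (z - y) \<partial>lborel)"
  proof (rule nn_integral_eq_integral)
    show "integrable lborel (\<lambda>z. (B z + K) * gdens (z - y))"
      using int has_bochner_integral_gdens_translate[of y]
      by (auto simp: distrib_right has_bochner_integral_iff intro!: Bochner_Integration.integrable_add)
    show "AE z in lborel. 0 \<le> (B z + K) * gdens (z - y)"
      using lower le by (intro AE_I2 mult_nonneg_nonneg gdens_nonneg) (smt (verit))
  qed
  also have "(\<integral>z. (B z + K) * gdens (z - y) \<partial>lborel) = (\<integral>z. B z * gdens (z - y) \<partial>lborel) + K"
  proof -
    have K: "has_bochner_integral lborel (\<lambda>z. K * gdens (z - y)) (K * 1)"
      by (rule has_bochner_integral_mult_right[OF has_bochner_integral_gdens_translate])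
    show ?thesis unfolding distrib_right
      using int K by (subst Bochner_Integration.integral_add) (auto simp: has_bochner_integral_iff)
  qed
  finally have "ennreal (H y + K) \<le> ennreal ((\<integral>z. B z * gdens (z - y) \<partial>lborel) + K)" by (simp add: h_def)
  moreover have "0 \<le> H y + K" using lower[of y] by simp
  \<comment> \<open>Since \<open>ennreal\<close> sends negative reals to 0, the inequality returns
    to the reals only up to this alternative; nonnegativity of the right-hand side settles the
    second case.\<close>
  ultimately have "H y + K \<le> (\<integral>z. B z * gdens (z - y) \<partial>lborel) + K \<or> H y + K = 0"
    by (metis ennreal_le_iff2 antisym)
  moreover have "0 \<le> (\<integral>z. B z * gdens (z - y) \<partial>lborel) + K"
  proof -
    have "0 \<le> (\<integral>z. (B z + K) * gdens (z - y) \<partial>lborel)"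
      using lower le by (intro integral_nonneg_AE AE_I2 mult_nonneg_nonneg gdens_nonneg) (smt (verit))
    then show ?thesis
      using \<open>(\<integral>z. (B z + K) * gdens (z - y) \<partial>lborel) = (\<integral>z. B z * gdens (z - y) \<partial>lborel) + K\<close> by simp
  qed
  ultimately show ?thesis by linarith
qed

lemma polynomial_growth:
  assumes "polynomial q p"
  shows "\<exists>C. \<forall>z. cmod (p z) \<le> C * (1 + norm (z::complex^'n::finite)) ^ (CARD('n) * q)"
proof -
  obtain c where c: "\<And>x. p x = (\<Sum>\<alpha>\<in>exps q. c \<alpha> * monomial \<alpha> x)"
    using assms by (auto simp: polynomial_def)
  have mono: "cmod (monomial \<alpha> z) \<le> (1 + norm z) ^ (CARD('n) * q)" if "\<alpha> \<in> exps q" for \<alpha> and z :: "complex^'n"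
  proof -
    have "cmod (monomial \<alpha> z) = (\<Prod>l\<in>UNIV. cmod (z $ l) ^ \<alpha> l)"
      by (simp add: monomial_def prod_norm[symmetric] norm_power)
    also have "\<dots> \<le> (\<Prod>l\<in>(UNIV::'n set). (1 + norm z) ^ q)"
    proof (rule prod_mono)
      fix l :: 'n
      have "cmod (z $ l) \<le> norm z" by (rule Finite_Cartesian_Product.norm_nth_le)
      then have "cmod (z $ l) ^ \<alpha> l \<le> (1 + norm z) ^ \<alpha> l"
        by (intro power_mono) auto
      also have "\<dots> \<le> (1 + norm z) ^ q"
        using that by (intro power_increasing) (auto simp: exps_iff)
      finally show "0 \<le> cmod (z $ l) ^ \<alpha> l \<and> cmod (z $ l) ^ \<alpha> l \<le> (1 + norm z) ^ q" by simp
    qed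
    also have "\<dots> = (1 + norm z) ^ (CARD('n) * q)" by (simp add: power_mult[symmetric] mult.commute)
    finally show ?thesis .
  qed
  have "cmod (p z) \<le> (\<Sum>\<alpha>\<in>exps q. cmod (c \<alpha>)) * (1 + norm z) ^ (CARD('n) * q)" for z
    unfolding c sum_distrib_right
    by (intro order.trans[OF norm_sum] sum_mono) (simp add: norm_mult mult_left_mono mono)
  then show ?thesis by blast
qed

lemma integrable_growth_gdens:
  fixes f :: "complex^'n::finite \<Rightarrow> real"
  assumes [measurable]: "f \<in> borel_measurable borel" and "\<And>z. \<bar>f z\<bar> \<le> C * (1 + norm z) ^ p"
  shows "integrable lborel (\<lambda>z. f z * gdens (z - y))"
proof -
  define m where "m = (\<integral>z. exp (- (norm (z :: complex^'n))\<^sup>2) \<partial>lborel)"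
  have m: "m > 0" unfolding m_def by (rule integral_exp_neg_norm_square_pos)
  have "integrable lborel (\<lambda>z::complex^'n. C * exp ((norm y)\<^sup>2) / m * ((1 + norm z) ^ p * exp (- (1/2 * (norm z)\<^sup>2))))"
    by (intro integrable_mult_right integrable_power_mult_gaussian) simp
  then show ?thesis
  proof (rule Bochner_Integration.integrable_bound)
    show "AE z in lborel. norm (f z * gdens (z - y)) \<le>
      norm (C * exp ((norm y)\<^sup>2) / m * ((1 + norm z) ^ p * exp (- (1/2 * (norm z)\<^sup>2))))"
    proof (rule AE_I2)
      fix z :: "complex^'n"
      have "gdens (z - y) \<le> exp ((norm y)\<^sup>2) * exp (- (1/2 * (norm z)\<^sup>2)) / m"
        unfolding gdens_def m_def[symmetric] using m by (intro divide_right_mono gaussian_shift_le) auto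
      then have "\<bar>f z\<bar> * gdens (z - y) \<le> (C * (1 + norm z) ^ p) * (exp ((norm y)\<^sup>2) * exp (- (1/2 * (norm z)\<^sup>2)) / m)"
        by (intro mult_mono assms order.trans[OF abs_ge_zero assms(2)]) auto
      then have "norm (f z * gdens (z - y)) \<le> C * exp ((norm y)\<^sup>2) / m * ((1 + norm z) ^ p * exp (- (1/2 * (norm z)\<^sup>2)))"
        by (simp add: abs_mult mult_ac)
      then show "norm (f z * gdens (z - y)) \<le>
        norm (C * exp ((norm y)\<^sup>2) / m * ((1 + norm z) ^ p * exp (- (1/2 * (norm z)\<^sup>2))))"
        unfolding real_norm_def[of "C * _ / _ * _"] by (rule order.trans[OF _ abs_ge_self])
    qed
  qed simp
qed

lemma gdens_translate_L1:
  assumes "0 < \<delta>"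
  shows "\<exists>r>0. \<forall>y::complex^'n::finite. norm y \<le> r \<longrightarrow> (\<integral>z. \<bar>gdens (z - y) - gdens z\<bar> \<partial>lborel) \<le> \<delta>"
proof (rule ccontr)
  assume contr: "\<not> ?thesis"
  have "\<forall>n. \<exists>y::complex^'n. norm y \<le> inverse (real (Suc n)) \<and> \<not> (\<integral>z. \<bar>gdens (z - y) - gdens z\<bar> \<partial>lborel) \<le> \<delta>"
    using contr by (metis inverse_positive_iff_positive of_nat_0_less_iff zero_less_Suc)
  then obtain y :: "nat \<Rightarrow> complex^'n" where y: "\<forall>n. norm (y n) \<le> inverse (real (Suc n)) \<and> \<not> (\<integral>z. \<bar>gdens (z - y n) - gdens z\<bar> \<partial>lborel) \<le> \<delta>"
    unfolding choice_iff by blast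
  have "y \<longlonglongrightarrow> 0"
    by (rule Lim_null_comparison[OF _ LIMSEQ_inverse_real_of_nat]) (use y in auto)
  define m where "m = (\<integral>z. exp (- (norm (z :: complex^'n))\<^sup>2) \<partial>lborel)"
  have m: "m > 0" unfolding m_def by (rule integral_exp_neg_norm_square_pos)
  have "(\<lambda>n. (\<integral>z. \<bar>exp (- (norm (z - y n))\<^sup>2) - exp (- (norm z)\<^sup>2)\<bar> \<partial>lborel) / m) \<longlonglongrightarrow> 0 / m"
    by (intro tendsto_divide tendsto_gaussian_shift_L1 tendsto_const \<open>y \<longlonglongrightarrow> 0\<close>) (use m in auto)
  moreover have "(\<integral>z. \<bar>exp (- (norm (z - y n))\<^sup>2) - exp (- (norm z)\<^sup>2)\<bar> \<partial>lborel) / m = (\<integral>z. \<bar>gdens (z - y n) - gdens z\<bar> \<partial>lborel)" for n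
    unfolding gdens_def m_def[symmetric] using m
    by (simp add: diff_divide_distrib[symmetric] abs_divide)
  ultimately have "(\<lambda>n. \<integral>z. \<bar>gdens (z - y n) - gdens z\<bar> \<partial>lborel) \<longlonglongrightarrow> 0" by simp
  then have "\<forall>\<^sub>F n in sequentially. (\<integral>z. \<bar>gdens (z - y n) - gdens z\<bar> \<partial>lborel) < \<delta>"
    by (rule order_tendstoD) (rule assms)
  then obtain n where "(\<integral>z. \<bar>gdens (z - y n) - gdens z\<bar> \<partial>lborel) < \<delta>" by (auto simp: eventually_sequentially)
  then show False using y by (metis less_imp_le)
qed

lemma le_of_forall_eps_mult: "(\<And>\<epsilon>::real. 0 < \<epsilon> \<Longrightarrow> a \<le> b + \<epsilon> * c) \<Longrightarrow> a \<le> b"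
proof (rule field_le_epsilon)
  fix e :: real assume *: "\<And>\<epsilon>::real. 0 < \<epsilon> \<Longrightarrow> a \<le> b + \<epsilon> * c" and "0 < e"
  have "a \<le> b + e / (\<bar>c\<bar> + 1) * c" by (rule *) (use \<open>0 < e\<close> in auto)
  also have "e / (\<bar>c\<bar> + 1) * c \<le> e * (c / (\<bar>c\<bar> + 1))" by simp
  also have "\<dots> \<le> e * 1" using \<open>0 < e\<close> by (intro mult_left_mono) (auto simp: divide_le_eq)
  finally show "a \<le> b + e" by simp
qed

lemma complex_root_exists:
  assumes "0 < n" shows "\<exists>z::complex. z ^ n = c"
proof (cases "c = 0")
  case False
  then have "card {z. z ^ n = c} \<noteq> 0" using card_nth_roots[OF False assms] assms by simp
  then have "{z. z ^ n = c} \<noteq> {}" by (metis card.empty)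
  then show ?thesis by blast
qed (use assms in \<open>auto intro: exI[of _ 0]\<close>)

section \<open>Gaussian bounds for fibre sums\<close>

context nondegenerate_map
begin

text \<open>Because \<open>ln t \<le> t\<close>, the cut fibre sum lies below
  \<open>B + \<epsilon> * |Q|\<close>, and polynomial growth makes the perturbation integrable. With
  \<open>y\<close> fixed off \<open>Q = 0\<close>, both \<open>\<epsilon> * ln |Q y|\<close> and the
  integral of \<open>\<epsilon> * |Q|\<close> vanish as \<epsilon> tends to 0.\<close>

lemma fibre_sum_gaussian_bound:
  assumes Q: "polynomial q2 Q" "\<And>y. Q y \<noteq> 0 \<Longrightarrow> y \<in> reg"
    and u: "psh u" and bnd: "\<And>M. \<exists>C. \<forall>x. x \<noteq> 0 \<longrightarrow> norm x \<le> M \<longrightarrow> u x \<le> C"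
    and B [measurable]: "B \<in> borel_measurable borel" and le: "\<And>z. z \<in> reg \<Longrightarrow> fibre_sum u z \<le> B z"
    and lower: "\<And>z. - K \<le> B z" and y: "Q y \<noteq> 0"
    and int: "integrable lborel (\<lambda>z. B z * gdens (z - y))"
  shows "fibre_sum u y \<le> (\<integral>z. B z * gdens (z - y) \<partial>lborel)"
proof (rule le_of_forall_eps_mult)
  fix \<epsilon> :: real assume \<epsilon>: "0 < \<epsilon>"
  have [measurable]: "Q \<in> borel_measurable borel" by (rule borel_polynomial[OF Q(1)])
  obtain C where C: "\<And>z. cmod (Q z) \<le> C * (1 + norm z) ^ (CARD('n) * q2)"
    using polynomial_growth[OF Q(1)] by blast
  have intQ: "integrable lborel (\<lambda>z. cmod (Q z) * gdens (z - y))"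
    by (rule integrable_growth_gdens[of _ C "CARD('n) * q2"]) (use C in auto)
  let ?H = "cut_fibre_sum Q \<epsilon> K u"
  have "?H y \<le> (\<integral>z. (B z + \<epsilon> * cmod (Q z)) * gdens (z - y) \<partial>lborel)"
  proof (rule gaussian_submean)
    show "continuous_on UNIV ?H"
      using continuous_on_cut_fibre_sum[OF Q _ bnd \<epsilon>] u by (simp add: psh_def)
    show "?H y \<le> integral {0..1} (\<lambda>t. ?H (y + circlepath 0 1 t *s b))" for b
      by (rule cut_fibre_sum_submean[OF Q u bnd \<epsilon>])
    show "- K \<le> ?H z" for z by (simp add: cut_fibre_sum_def)
    show "?H z \<le> B z + \<epsilon> * cmod (Q z)" for z
    proof (cases "Q z = 0")
      case False
      have "ln (cmod (Q z)) \<le> cmod (Q z)" using False ln_le_minus_one[of "cmod (Q z)"] by simp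
      then have "\<epsilon> * ln (cmod (Q z)) \<le> \<epsilon> * cmod (Q z)" using \<epsilon> by simp
      moreover have "0 \<le> \<epsilon> * cmod (Q z)" using \<epsilon> by simp
      ultimately show ?thesis using False le[OF Q(2)[OF False]] lower[of z] by (simp add: cut_fibre_sum_def)
    qed (use lower in \<open>simp add: cut_fibre_sum_def\<close>)
    show "integrable lborel (\<lambda>z. (B z + \<epsilon> * cmod (Q z)) * gdens (z - y))"
      unfolding distrib_right mult.assoc by (intro Bochner_Integration.integrable_add int integrable_mult_right intQ)
  qed simp
  also have "\<dots> = (\<integral>z. B z * gdens (z - y) \<partial>lborel) + \<epsilon> * (\<integral>z. cmod (Q z) * gdens (z - y) \<partial>lborel)"
    unfolding distrib_right mult.assoc by (subst Bochner_Integration.integral_add) (auto intro!: int integrable_mult_right intQ)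
  finally have "fibre_sum u y + \<epsilon> * ln (cmod (Q y)) \<le> (\<integral>z. B z * gdens (z - y) \<partial>lborel) + \<epsilon> * (\<integral>z. cmod (Q z) * gdens (z - y) \<partial>lborel)"
    using y by (simp add: cut_fibre_sum_def)
  then show "fibre_sum u y \<le> (\<integral>z. B z * gdens (z - y) \<partial>lborel) + \<epsilon> * ((\<integral>z. cmod (Q z) * gdens (z - y) \<partial>lborel) - ln (cmod (Q y)))"
    by (simp add: algebra_simps)
qed

text \<open>Scaling by an \<open>e\<close>-th root of \<open>1 / c\<close> carries the fibre over
  \<open>c *s z\<close> to the fibre over \<open>z\<close>; differentiating the homogeneity relation
  compares the Jacobians at corresponding points.\<close>

lemma reg_vsmult:
  assumes z: "z \<in> reg" and c: "c \<noteq> 0" shows "c *s z \<in> reg"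
proof -
  have "det (A x) \<noteq> 0" if Fx: "F x = c *s z" for x
  proof -
    obtain lam where l: "lam ^ e = inverse c" using complex_root_exists[OF e_pos] by blast
    then have l0: "lam \<noteq> 0" using c e_pos by (auto simp: power_0_left)
    have "F (lam *s x) = z" using Fx l c by (simp add: homogeneous)
    then have "det (A (lam *s x)) \<noteq> 0" using z by (auto simp: reg_def)
    then have inj: "inj ((*v) (A (lam *s x)))"
      by (simp add: invertible_det_nz[symmetric] invertible_left_inverse matrix_left_invertible_injective)
    have bl: "bounded_linear (\<lambda>h::complex^'n. c *s h)" for c
      unfolding linear_conv_bounded_linear[symmetric] by (rule linearI) (simp_all add: vec_eq_iff algebra_simps)
    have "((\<lambda>x. F (lam *s x)) has_derivative (\<lambda>h. A (lam *s x) *v (lam *s h))) (at x)"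
      by (rule has_derivative_compose[OF bounded_linear.has_derivative[OF bl has_derivative_ident] has_derivative_F])
    moreover have "((\<lambda>x. F (lam *s x)) has_derivative (\<lambda>h. lam ^ e *s (A x *v h))) (at x)"
      unfolding homogeneous by (rule bounded_linear.has_derivative[OF bl has_derivative_F])
    ultimately have eq: "A (lam *s x) *v (lam *s h) = lam ^ e *s (A x *v h)" for h
      by (metis has_derivative_unique)
    have "inj ((*v) (A x))"
    proof (rule injI)
      fix a b assume "A x *v a = A x *v b"
      then have "A (lam *s x) *v (lam *s a) = A (lam *s x) *v (lam *s b)" by (simp add: eq)
      then have "lam *s a = lam *s b" using inj by (simp add: inj_eq)
      then show "a = b" using l0 by (simp add: vec_eq_iff)
    qed
    then show ?thesis
      by (simp add: invertible_det_nz[symmetric] invertible_left_inverse matrix_left_invertible_injective)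
  qed
  then show ?thesis using z c by (auto simp: reg_def vec_eq_iff)
qed

lemma fibre_sum_vsmult:
  assumes w: "\<And>x c. c \<noteq> 0 \<Longrightarrow> w (c *s x) = w x" and c: "c \<noteq> 0"
  shows "fibre_sum w (c *s z) = fibre_sum w z"
proof -
  obtain lam where l: "lam ^ e = c" using complex_root_exists[OF e_pos] by blast
  then have l0: "lam \<noteq> 0" using c e_pos by (auto simp: power_0_left)
  have "F -` {c *s z} = (\<lambda>x. lam *s x) ` (F -` {z})"
  proof
    show "(\<lambda>x. lam *s x) ` (F -` {z}) \<subseteq> F -` {c *s z}" using l by (auto simp: homogeneous)
    show "F -` {c *s z} \<subseteq> (\<lambda>x. lam *s x) ` (F -` {z})"
    proof
      fix x assume "x \<in> F -` {c *s z}"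
      then have "F (inverse lam *s x) = z" using l c by (simp add: homogeneous power_inverse vec_eq_iff)
      moreover have "x = lam *s (inverse lam *s x)" using l0 by simp
      ultimately show "x \<in> (\<lambda>x. lam *s x) ` (F -` {z})" by blast
    qed
  qed
  moreover have "inj_on (\<lambda>x. lam *s x) (F -` {z})" using l0 by (auto simp: inj_on_def vec_eq_iff)
  ultimately show ?thesis unfolding fibre_sum_def by (simp add: sum.reindex w[OF l0])
qed

text \<open>The value 0 off the open set \<open>reg\<close> makes Borel measurability a consequence
  of continuity on \<open>reg\<close>; integrals do not see the choice, since the complement is
  Lebesgue null.\<close>

definition fibre_sum_reg :: "(complex^'n \<Rightarrow> real) \<Rightarrow> complex^'n \<Rightarrow> real" where
  "fibre_sum_reg w z = (if z \<in> reg then fibre_sum w z else 0)"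

lemma borel_measurable_fibre_sum_reg:
  assumes "continuous_on (- {0}) w" shows "fibre_sum_reg w \<in> borel_measurable borel"
proof -
  have "(\<lambda>z. if z \<in> reg then fibre_sum w z else 0) \<in> borel_measurable borel"
    by (rule borel_measurable_continuous_on_if)
      (use open_reg in \<open>auto intro!: continuous_on_fibre_sum[OF assms] borel_open\<close>)
  then show ?thesis by (simp add: fibre_sum_reg_def[abs_def])
qed

lemma abs_fibre_sum_reg_le:
  assumes "\<And>x. x \<noteq> 0 \<Longrightarrow> \<bar>w x\<bar> \<le> M" "0 \<le> M" "z0 \<in> reg"
  shows "\<bar>fibre_sum_reg w z\<bar> \<le> real (card (F -` {z0})) * M"
proof (cases "z \<in> reg")
  case True
  have "\<bar>fibre_sum w z\<bar> \<le> (\<Sum>x\<in>F -` {z}. \<bar>w x\<bar>)" unfolding fibre_sum_def by (rule sum_abs)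
  also have "\<dots> \<le> real (card (F -` {z})) * M"
    by (rule sum_bounded_above) (use assms(1) True in \<open>auto simp: reg_def\<close>)
  finally show ?thesis using True card_fibre_eq[OF True assms(3)] by (simp add: fibre_sum_reg_def)
qed (use assms in \<open>simp add: fibre_sum_reg_def\<close>)

text \<open>By scale invariance the fibre sum at \<open>z0\<close> is its value at a point \<open>y\<close> near the origin, and the
  Gaussian centred at \<open>y\<close> barely differs from the standard one. On the fibre over \<open>z\<close> the correction
  \<open>C * G\<close> is constant up to \<open>C * \<tau>\<close> and depends on \<open>norm z\<close> only through \<open>ln (norm z) / e\<close>.\<close>

lemma fibre_sum_le_gaussian_mean:
  assumes w: "continuous_on (- {0}) w" "\<And>x. x \<noteq> 0 \<Longrightarrow> \<bar>w x\<bar> \<le> M" "\<And>x c. c \<noteq> 0 \<Longrightarrow> w (c *s x) = w x"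
    and M: "0 \<le> M" and C: "0 \<le> C"
    and G: "\<And>x. x \<noteq> 0 \<Longrightarrow> \<bar>G x - (ln (norm (F x)) - \<kappa>) / e\<bar> \<le> \<tau>"
    and psh: "psh (\<lambda>x. w x + C * G x)"
    and r: "0 < r" "r \<le> 1"
    and L1: "\<And>y::complex^'n. norm y \<le> r \<Longrightarrow> (\<integral>z. \<bar>gdens (z - y) - gdens z\<bar> \<partial>lborel) \<le> \<delta>"
    and m1: "\<And>y::complex^'n. norm y \<le> 1 \<Longrightarrow> (\<integral>z. norm z * gdens (z - y) \<partial>lborel) \<le> m1"
    and z0: "z0 \<in> reg"
  shows "fibre_sum w z0 \<le> (\<integral>z. fibre_sum_reg w z * gdens z \<partial>lborel)
     + real (card (F -` {z0})) * (M * \<delta> + C * ((m1 - ln (r / 2)) / e + 2 * \<tau>))"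
proof -
  define N where "N = real (card (F -` {z0}))"
  have N0: "0 \<le> N" by (simp add: N_def)
  have cardN: "real (card (F -` {z})) = N" if "z \<in> reg" for z
    using card_fibre_eq[OF that z0] by (simp add: N_def)
  have \<tau>0: "0 \<le> \<tau>"
    using G[of "SOME b. b \<in> Basis"] nonzero_Basis[OF SOME_Basis] by (smt (verit))
  let ?u = "\<lambda>x. w x + C * G x"
  let ?p = "fibre_sum_reg w"
  \<comment> \<open>The upper bound for \<open>C * G\<close> summed over a fibre, with
    \<open>ln (norm z)\<close> weakened to \<open>norm z\<close> so that the majorant is bounded
    below and has linear growth.\<close>
  define B where "B z = ?p z + C * N * ((norm z - \<kappa>) / e + \<tau>)" for z
  have [measurable]: "?p \<in> borel_measurable borel" by (rule borel_measurable_fibre_sum_reg[OF w(1)])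
  have p_le: "\<bar>?p z\<bar> \<le> N * M" for z
    using abs_fibre_sum_reg_le[OF w(2) M z0] by (simp add: N_def)
  have e0: "0 < real e" using e_pos by simp
  have G_bnd: "G x \<le> (ln (norm (F x)) - \<kappa>) / e + \<tau>" "(ln (norm (F x)) - \<kappa>) / e - \<tau> \<le> G x" if "x \<noteq> 0" for x
    using G[OF that] by linarith+
  have split: "fibre_sum ?u z = fibre_sum w z + C * (\<Sum>x\<in>F -` {z}. G x)" for z
    unfolding fibre_sum_def by (simp add: sum.distrib sum_distrib_left)
  have bnd: "\<exists>K. \<forall>x. x \<noteq> 0 \<longrightarrow> norm x \<le> R \<longrightarrow> ?u x \<le> K" for R
  proof -
    have "compact (F ` cball 0 R)"
      by (intro compact_continuous_image continuous_on_F continuous_on_id compact_cball)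
    then obtain b where b: "\<forall>y\<in>F ` cball 0 R. norm y \<le> b" using compact_imp_bounded bounded_iff by metis
    have "?u x \<le> M + C * ((b - \<kappa>) / e + \<tau>)" if x: "x \<noteq> 0" "norm x \<le> R" for x
    proof -
      have "ln (norm (F x)) \<le> norm (F x)" using x ln_le_minus_one[of "norm (F x)"] by simp
      also have "norm (F x) \<le> b" using b x by simp
      finally have "(ln (norm (F x)) - \<kappa>) / e + \<tau> \<le> (b - \<kappa>) / e + \<tau>" using e0 by (simp add: divide_right_mono)
      then have "C * G x \<le> C * ((b - \<kappa>) / e + \<tau>)" using C G_bnd(1)[OF x(1)] by (intro mult_left_mono) auto
      moreover have "w x \<le> M" using w(2)[OF x(1)] by linarith
      ultimately show ?thesis by linarith
    qed
    then show ?thesis by blast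
  qed
  have le_B: "fibre_sum ?u z \<le> B z" if z: "z \<in> reg" for z
  proof -
    have "(\<Sum>x\<in>F -` {z}. G x) \<le> real (card (F -` {z})) * ((norm z - \<kappa>) / e + \<tau>)"
    proof (rule sum_bounded_above)
      fix x assume x: "x \<in> F -` {z}"
      have z0: "z \<noteq> 0" using z by (auto simp: reg_def)
      then have "G x \<le> (ln (norm z) - \<kappa>) / e + \<tau>" using G_bnd(1)[of x] x by auto
      moreover have "ln (norm z) \<le> norm z" using z0 ln_le_minus_one[of "norm z"] by simp
      then have "(ln (norm z) - \<kappa>) / e \<le> (norm z - \<kappa>) / e" using e0 by (simp add: divide_right_mono)
      ultimately show "G x \<le> (norm z - \<kappa>) / e + \<tau>" by linarith
    qed
    then have "C * (\<Sum>x\<in>F -` {z}. G x) \<le> C * (N * ((norm z - \<kappa>) / e + \<tau>))"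
      using C cardN[OF z] by (intro mult_left_mono) auto
    then show ?thesis using z by (simp add: split B_def fibre_sum_reg_def mult.assoc)
  qed
  have lower: "- (N * M + C * N * (\<bar>\<kappa>\<bar> / e)) \<le> B z" for z
  proof -
    have "- (\<bar>\<kappa>\<bar> / e) \<le> (norm z - \<kappa>) / e + \<tau>"
    proof -
      have "- \<bar>\<kappa>\<bar> \<le> norm z - \<kappa>" using norm_ge_zero[of z] abs_ge_self[of \<kappa>] by linarith
      then have "- \<bar>\<kappa>\<bar> / e \<le> (norm z - \<kappa>) / e" by (intro divide_right_mono) auto
      then show ?thesis using \<tau>0 by simp
    qed
    then have "C * N * (- (\<bar>\<kappa>\<bar> / e)) \<le> C * N * ((norm z - \<kappa>) / e + \<tau>)"
      using C N0 by (intro mult_left_mono) auto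
    then show ?thesis using p_le[of z] by (simp add: B_def abs_le_iff)
  qed
  have int_p: "integrable lborel (\<lambda>z. ?p z * gdens (z - y))" for y
    by (rule integrable_growth_gdens[of _ "N * M" 0]) (use p_le in auto)
  have int_n: "integrable lborel (\<lambda>z. norm z * gdens (z - y))" for y :: "complex^'n"
    by (rule integrable_growth_gdens[of _ 1 1]) auto
  have hb: "has_bochner_integral lborel (\<lambda>z. B z * gdens (z - y))
      ((\<integral>z. ?p z * gdens (z - y) \<partial>lborel) + C * N * (((\<integral>z. norm z * gdens (z - y) \<partial>lborel) - \<kappa> * 1) / e + \<tau> * 1))" for y
  proof -
    have eq: "B z * gdens (z - y) = ?p z * gdens (z - y) + C * N * ((norm z * gdens (z - y) - \<kappa> * gdens (z - y)) / e + \<tau> * gdens (z - y))" for z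
      by (simp add: B_def field_simps)
    show ?thesis unfolding eq
      by (intro has_bochner_integral_add has_bochner_integral_mult_right has_bochner_integral_divide_zero
          has_bochner_integral_diff has_bochner_integral_gdens_translate has_bochner_integral_integrable int_p int_n)
  qed
  obtain q2 Q where Q: "polynomial q2 Q" "\<exists>y. Q y \<noteq> 0" "\<And>y. Q y \<noteq> 0 \<Longrightarrow> y \<in> reg"
    using critical_value_polynomial by metis
  define R where "R = (\<integral>z. ?p z * gdens z \<partial>lborel) + N * (M * \<delta> + C * ((m1 - ln (r / 2)) / e + 2 * \<tau>))"
  \<comment> \<open>In this shell \<open>ln (norm y)\<close> is at least \<open>ln (r / 2)\<close>,
    which bounds the fibre sum of \<open>C * G\<close> from below and permits its subtraction, while
    \<open>norm y < r\<close> keeps the shifted Gaussian close to the centred one.\<close>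
  have main: "fibre_sum w y \<le> R" if y: "Q y \<noteq> 0" "r / 2 < norm y" "norm y < r" for y
  proof -
    have yreg: "y \<in> reg" by (rule Q(3)[OF y(1)])
    have "fibre_sum ?u y \<le> (\<integral>z. B z * gdens (z - y) \<partial>lborel)"
    proof (rule fibre_sum_gaussian_bound[OF Q(1,3) psh bnd _ le_B lower y(1)])
      show "B \<in> borel_measurable borel" unfolding B_def by measurable
    qed (use hb has_bochner_integral_iff in auto)
    also have "\<dots> = (\<integral>z. ?p z * gdens (z - y) \<partial>lborel) + C * N * (((\<integral>z. norm z * gdens (z - y) \<partial>lborel) - \<kappa>) / e + \<tau>)"
      using hb[of y] by (simp add: has_bochner_integral_iff)
    also have "\<dots> \<le> ((\<integral>z. ?p z * gdens z \<partial>lborel) + N * M * \<delta>) + C * N * ((m1 - \<kappa>) / e + \<tau>)"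
    proof (intro add_mono mult_left_mono divide_right_mono diff_mono order.refl)
      show "(\<integral>z. norm z * gdens (z - y) \<partial>lborel) \<le> m1" using y r by (intro m1) auto
      have int0: "integrable lborel (\<lambda>z. ?p z * gdens z)" using int_p[of 0] by simp
      have intd: "integrable lborel (\<lambda>z. \<bar>gdens (z - y) - gdens z\<bar>)"
        using has_bochner_integral_gdens_translate[of y] integrable_gdens
        by (intro integrable_abs Bochner_Integration.integrable_diff) (auto simp: has_bochner_integral_iff)
      have "(\<integral>z. ?p z * gdens (z - y) \<partial>lborel) - (\<integral>z. ?p z * gdens z \<partial>lborel) = (\<integral>z. ?p z * gdens (z - y) - ?p z * gdens z \<partial>lborel)"
        by (rule Bochner_Integration.integral_diff[symmetric, OF int_p int0])
      also have "\<dots> \<le> (\<integral>z. N * M * \<bar>gdens (z - y) - gdens z\<bar> \<partial>lborel)"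
      proof (rule integral_mono)
        fix z
        have "?p z * gdens (z - y) - ?p z * gdens z \<le> \<bar>?p z\<bar> * \<bar>gdens (z - y) - gdens z\<bar>"
          unfolding right_diff_distrib[symmetric] abs_mult[symmetric] by (rule abs_ge_self)
        also have "\<dots> \<le> N * M * \<bar>gdens (z - y) - gdens z\<bar>"
          by (intro mult_right_mono p_le) auto
        finally show "?p z * gdens (z - y) - ?p z * gdens z \<le> N * M * \<bar>gdens (z - y) - gdens z\<bar>" .
      qed (intro Bochner_Integration.integrable_diff int_p int0 integrable_mult_right intd)+
      also have "\<dots> = N * M * (\<integral>z. \<bar>gdens (z - y) - gdens z\<bar> \<partial>lborel)" by simp
      also have "\<dots> \<le> N * M * \<delta>" using N0 M y by (intro mult_left_mono L1) auto
      finally show "(\<integral>z. ?p z * gdens (z - y) \<partial>lborel) \<le> (\<integral>z. ?p z * gdens z \<partial>lborel) + N * M * \<delta>" by linarith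
    qed (use C N0 in auto)
    finally have upper: "fibre_sum ?u y \<le> \<dots>" .
    have "real (card (F -` {y})) * ((ln (r / 2) - \<kappa>) / e - \<tau>) \<le> (\<Sum>x\<in>F -` {y}. G x)"
    proof (rule sum_bounded_below)
      fix x assume x: "x \<in> F -` {y}"
      have "x \<noteq> 0" using x yreg by (auto simp: reg_def)
      then have "(ln (norm y) - \<kappa>) / e - \<tau> \<le> G x" using G_bnd(2)[of x] x by auto
      moreover have "ln (r / 2) \<le> ln (norm y)" using y r by (intro ln_mono) auto
      then have "(ln (r / 2) - \<kappa>) / e \<le> (ln (norm y) - \<kappa>) / e" using e0 by (simp add: divide_right_mono)
      ultimately show "(ln (r / 2) - \<kappa>) / e - \<tau> \<le> G x" by linarith
    qed
    then have "C * (N * ((ln (r / 2) - \<kappa>) / e - \<tau>)) \<le> C * (\<Sum>x\<in>F -` {y}. G x)"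
      using C cardN[OF yreg] by (intro mult_left_mono) auto
    then have "fibre_sum w y \<le> (\<integral>z. ?p z * gdens z \<partial>lborel) + N * M * \<delta> + C * N * ((m1 - \<kappa>) / e + \<tau>) - C * (N * ((ln (r / 2) - \<kappa>) / e - \<tau>))"
      using upper split[of y] by linarith
    \<comment> \<open>The constant \<kappa> cancels between the upper and the lower bound for
      \<open>G\<close>, leaving only the gap
      \<open>(m1 - ln (r / 2)) / e + 2 * \<tau>\<close>.\<close>
    also have "\<dots> = R" using e0 by (simp add: R_def field_simps)
    finally show ?thesis .
  qed
  \<comment> \<open>The norm \<open>3 / 4 * r\<close> lies strictly inside the shell, which leaves
    room to move to points with \<open>Q \<noteq> 0\<close> and to return to \<open>y0\<close> by
    continuity.\<close>
  define y0 where "y0 = of_real (3 / 4 * r / norm z0) *s z0"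
  have z00: "z0 \<noteq> 0" using z0 by (auto simp: reg_def)
  have ny0: "norm y0 = 3 / 4 * r" using z00 r by (simp add: y0_def norm_vsmult norm_divide norm_mult)
  have c0: "complex_of_real (3 / 4 * r / norm z0) \<noteq> 0" using z00 r by simp
  have y0: "y0 \<in> reg" unfolding y0_def by (rule reg_vsmult[OF z0 c0])
  let ?S = "reg \<inter> {y. r / 2 < norm y} \<inter> {y. norm y < r}"
  have S: "open ?S" by (intro open_Int open_reg open_Collect_less continuous_intros)
  have y0S: "y0 \<in> ?S" using y0 ny0 r by simp
  have "fibre_sum w y0 \<le> R"
  proof (rule ccontr)
    assume "\<not> fibre_sum w y0 \<le> R"
    moreover have "isCont (fibre_sum w) y0"
      using continuous_on_fibre_sum[OF w(1)] y0 open_reg continuous_on_eq_continuous_at by blast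
    ultimately have "\<forall>\<^sub>F y in nhds y0. R < fibre_sum w y"
      by (intro order_tendstoD(1)[of _ "fibre_sum w y0"]) (auto simp: isCont_def tendsto_at_iff_tendsto_nhds)
    then have "\<forall>\<^sub>F y in nhds y0. R < fibre_sum w y \<and> y \<in> ?S"
      by (intro eventually_conj eventually_nhds_in_open[OF S y0S])
    then obtain W where W: "open W" "y0 \<in> W" "\<forall>y\<in>W. R < fibre_sum w y \<and> y \<in> ?S"
      unfolding eventually_nhds by blast
    obtain y1 where "Q y1 \<noteq> 0" using Q(2) by blast
    then obtain y where "y \<in> W" "Q y \<noteq> 0"
      using closure_polynomial_nonzero[OF Q(1)] open_Int_closure_eq_empty[OF W(1), of "{z. Q z \<noteq> 0}"] W(2) by auto
    then show False using W(3) main[of y] by force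
  qed
  moreover have "fibre_sum w y0 = fibre_sum w z0"
    unfolding y0_def by (rule fibre_sum_vsmult[OF w(3) c0])
  ultimately show ?thesis by (simp add: R_def N_def)
qed

end

section \<open>The distance to the indeterminate maps and the Green function\<close>

lemma coef_norm_diff_square:
  "(coef_norm d (\<lambda>i \<alpha>. c i \<alpha> - s * c' i \<alpha>))\<^sup>2 =
    (coef_norm d c)\<^sup>2 - 2 * Re (cnj s * coef_inner d c c') + (cmod s)\<^sup>2 * (coef_norm d c')\<^sup>2"
proof -
  have sq: "(coef_norm d c)\<^sup>2 = (\<Sum>i\<in>UNIV. \<Sum>\<alpha>\<in>Alpha d. (cmod (c i \<alpha>))\<^sup>2)" for c
    unfolding coef_norm_def by (intro real_sqrt_pow2 sum_nonneg) auto
  have eq: "(cmod (a - s * b))\<^sup>2 = (cmod a)\<^sup>2 - 2 * Re (cnj s * (a * cnj b)) + (cmod s)\<^sup>2 * (cmod b)\<^sup>2" for a b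
    unfolding cmod_power2 by (simp add: algebra_simps power2_eq_square)
  show ?thesis
    unfolding sq eq coef_inner_def
    by (simp only: sum.distrib sum_subtractf sum_distrib_left Re_sum)
qed

lemma coef_norm_nonneg: "0 \<le> coef_norm d c"
  unfolding coef_norm_def by (intro real_sqrt_ge_zero sum_nonneg) auto

lemma Alpha_subset_exps: "Alpha d \<subseteq> exps d"
proof
  fix \<alpha> :: "'a \<Rightarrow> nat" assume "\<alpha> \<in> Alpha d"
  then show "\<alpha> \<in> exps d" using member_le_sum[of _ UNIV \<alpha>] by (simp add: Alpha_def exps_iff)
qed

lemma finite_Alpha [simp]: "finite (Alpha d)"
  using finite_subset[OF Alpha_subset_exps finite_exps] .

lemma coef_norm_pos_iff: "0 < coef_norm d c \<longleftrightarrow> nonzero_coef d c"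
proof -
  have "coef_norm d c = 0 \<longleftrightarrow> (\<Sum>i\<in>UNIV. \<Sum>\<alpha>\<in>Alpha d. (cmod (c i \<alpha>))\<^sup>2) = 0"
    by (simp add: coef_norm_def)
  also have "\<dots> \<longleftrightarrow> \<not> nonzero_coef d c"
    unfolding nonzero_coef_def
    by (subst sum_nonneg_eq_0_iff) (auto simp: sum_nonneg_eq_0_iff sum_nonneg)
  finally show ?thesis using coef_norm_nonneg[of d c] by auto
qed

text \<open>Pythagoras: the subtracted multiple of \<open>c'\<close> is the orthogonal projection of
  \<open>c\<close> onto its line, so the left-hand side is the squared distance from
  \<open>c\<close> to that line.\<close>

lemma coef_norm_diff_best:
  assumes "nonzero_coef d c'"
  shows "(coef_norm d (\<lambda>i \<alpha>. c i \<alpha> - (coef_inner d c c' / of_real ((coef_norm d c')\<^sup>2)) * c' i \<alpha>))\<^sup>2 =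
    (coef_norm d c)\<^sup>2 - (cmod (coef_inner d c c') / coef_norm d c')\<^sup>2"
proof -
  define p where "p = coef_inner d c c'"
  define q where "q = coef_norm d c'"
  have q: "q > 0" using assms by (simp add: q_def coef_norm_pos_iff)
  have "Re (cnj (p / of_real (q\<^sup>2)) * p) = (cmod p)\<^sup>2 / q\<^sup>2"
  proof -
    have "cnj p * p = (complex_of_real (cmod p))\<^sup>2"
      by (metis complex_norm_square mult.commute of_real_power)
    then have "cnj (p / of_real (q\<^sup>2)) * p = of_real ((cmod p)\<^sup>2 / q\<^sup>2)"
      by simp
    then show ?thesis by (simp only: Re_complex_of_real)
  qed
  moreover have "(cmod (p / of_real (q\<^sup>2)))\<^sup>2 * q\<^sup>2 = (cmod p)\<^sup>2 / q\<^sup>2"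
    unfolding norm_divide norm_of_real abs_power2 using q by (simp add: power_divide field_simps power2_eq_square)
  ultimately show ?thesis
    unfolding coef_norm_diff_square p_def[symmetric] q_def[symmetric] power_divide[of "cmod p" q]
    by linarith
qed

lemma coef_Cauchy_Schwarz:
  assumes "nonzero_coef d c'"
  shows "cmod (coef_inner d c c') / coef_norm d c' \<le> coef_norm d c"
proof -
  have "0 \<le> (coef_norm d c)\<^sup>2 - (cmod (coef_inner d c c') / coef_norm d c')\<^sup>2"
    unfolding coef_norm_diff_best[OF assms, symmetric] by simp
  then show ?thesis using coef_norm_nonneg[of d c] by (simp add: power2_le_iff_abs_le abs_of_nonneg coef_norm_nonneg)
qed

lemma coef_cosine_bounds:
  assumes "nonzero_coef d c" "nonzero_coef d c'"
  shows "0 \<le> cmod (coef_inner d c c') / (coef_norm d c * coef_norm d c')"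
    "cmod (coef_inner d c c') / (coef_norm d c * coef_norm d c') \<le> 1"
proof -
  have pos: "coef_norm d c > 0" "coef_norm d c' > 0" using assms by (simp_all add: coef_norm_pos_iff)
  show "0 \<le> cmod (coef_inner d c c') / (coef_norm d c * coef_norm d c')" using pos by simp
  show "cmod (coef_inner d c c') / (coef_norm d c * coef_norm d c') \<le> 1"
    using coef_Cauchy_Schwarz[OF assms(2), of c] pos by (simp add: divide_le_eq mult.commute)
qed

lemma fs_dist_bounds:
  assumes "nonzero_coef d c" "nonzero_coef d c'"
  shows "0 \<le> fs_dist d c c'" "fs_dist d c c' \<le> 1"
proof -
  have "0 \<le> arccos (cmod (coef_inner d c c') / (coef_norm d c * coef_norm d c'))"
    by (rule arccos_lbound) (use coef_cosine_bounds[OF assms] in auto)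
  then show "0 \<le> fs_dist d c c'" unfolding fs_dist_def by simp
  have "arccos (cmod (coef_inner d c c') / (coef_norm d c * coef_norm d c')) \<le> pi / 2"
    by (rule arccos_le_pi2) (use coef_cosine_bounds[OF assms] in auto)
  then have "2 / pi * arccos (cmod (coef_inner d c c') / (coef_norm d c * coef_norm d c')) \<le> 2 / pi * (pi / 2)"
    by (intro mult_left_mono) auto
  then show "fs_dist d c c' \<le> 1" unfolding fs_dist_def by simp
qed

text \<open>Up to \<open>pi / 3\<close> the mean value theorem applies with derivative at least
  \<open>1 / 2\<close>; beyond it \<open>sin x\<close> is at least \<open>1 / 2\<close>. The factor
  \<open>pi\<close> combines with the normalization \<open>2 / pi\<close> of \<open>fs_dist\<close>
  into a factor 2.\<close>

lemma angle_le_pi_sin: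
  assumes "0 \<le> x" "x \<le> pi / 2" shows "x \<le> pi * sin x"
proof (cases "x \<le> pi / 3")
  case True
  show ?thesis
  proof (cases "x = 0")
    case False
    then have "0 < x" using assms by simp
    then obtain \<xi> where \<xi>: "0 < \<xi>" "\<xi> < x" "sin x - sin 0 = (x - 0) * cos \<xi>"
      using MVT2[of 0 x sin cos] by (auto simp: DERIV_sin)
    have "cos (pi / 3) \<le> cos \<xi>" by (rule cos_monotone_0_pi_le) (use \<xi> True assms pi_gt_zero in auto)
    then have "x * (1 / 2) \<le> sin x" using \<xi> assms by (simp add: cos_60 mult_left_mono)
    moreover have "2 * sin x \<le> pi * sin x"
      using pi_gt3 sin_ge_zero[of x] assms by (intro mult_right_mono) auto
    ultimately show ?thesis by linarith
  qed simp
next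
  case False
  have "sin (pi / 6) \<le> sin x" by (rule sin_monotone_2pi_le) (use False assms pi_gt_zero in auto)
  then have "pi * (1 / 2) \<le> pi * sin x" by (intro mult_left_mono) (auto simp: sin_30)
  then show ?thesis using assms by linarith
qed

text \<open>The norm of \<open>c\<close> times the sine of the angle is the distance from
  \<open>c\<close> to the complex line of \<open>c'\<close>, hence at most the distance from
  \<open>c\<close> to \<open>c'\<close> itself.\<close>

lemma fs_dist_le:
  assumes c: "nonzero_coef d c" and c': "nonzero_coef d c'"
  shows "fs_dist d c c' * coef_norm d c \<le> 2 * coef_norm d (\<lambda>i \<alpha>. c i \<alpha> - c' i \<alpha>)"
proof -
  define p where "p = cmod (coef_inner d c c')"
  define q where "q = coef_norm d c'"
  define s where "s = coef_norm d c"
  define t where "t = p / (s * q)"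
  have pos: "s > 0" "q > 0" using c c' by (simp_all add: s_def q_def coef_norm_pos_iff)
  have t: "0 \<le> t" "t \<le> 1" unfolding t_def p_def s_def q_def using coef_cosine_bounds[OF c c'] by auto
  have "arccos t \<le> pi * sin (arccos t)"
    by (rule angle_le_pi_sin) (use arccos_lbound[of t] arccos_le_pi2[of t] t in auto)
  also have "sin (arccos t) = sqrt (1 - t\<^sup>2)" by (rule sin_arccos) (use t in auto)
  finally have "2 / pi * arccos t \<le> 2 / pi * (pi * sqrt (1 - t\<^sup>2))" by (intro mult_left_mono) auto
  then have "fs_dist d c c' \<le> 2 * sqrt (1 - t\<^sup>2)"
    by (simp add: fs_dist_def t_def p_def s_def q_def)
  then have "fs_dist d c c' * s \<le> 2 * (sqrt (1 - t\<^sup>2) * s)" using pos by simp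
  also have "sqrt (1 - t\<^sup>2) * s = sqrt (s\<^sup>2 - (p / q)\<^sup>2)"
  proof -
    have "s\<^sup>2 - (p / q)\<^sup>2 = (1 - t\<^sup>2) * s\<^sup>2" using pos by (simp add: t_def field_simps)
    then show ?thesis using pos by (simp add: real_sqrt_mult)
  qed
  also have "\<dots> \<le> coef_norm d (\<lambda>i \<alpha>. c i \<alpha> - c' i \<alpha>)"
  proof (rule real_le_lsqrt)
    have "(coef_norm d (\<lambda>i \<alpha>. c i \<alpha> - c' i \<alpha>))\<^sup>2 = s\<^sup>2 - 2 * Re (coef_inner d c c') + q\<^sup>2"
      using coef_norm_diff_square[of d c 1 c'] by (simp add: s_def q_def)
    moreover have "Re (coef_inner d c c') \<le> p" unfolding p_def by (rule complex_Re_le_cmod)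
    moreover have "0 \<le> (p / q - q)\<^sup>2" by simp
    then have "- (p / q)\<^sup>2 \<le> - 2 * p + q\<^sup>2" using pos by (simp add: power2_diff)
    ultimately show "s\<^sup>2 - (p / q)\<^sup>2 \<le> (coef_norm d (\<lambda>i \<alpha>. c i \<alpha> - c' i \<alpha>))\<^sup>2" by linarith
  qed (rule coef_norm_nonneg)
  finally show ?thesis by (simp add: s_def)
qed

section \<open>The size of a map compared with its distance to the indeterminate maps\<close>

lemma hpoly_map_nth: "hpoly_map d c x $ i = (\<Sum>\<alpha>\<in>Alpha d. c i \<alpha> * monomial \<alpha> x)"
  by (simp add: hpoly_map_def monomial_def)

lemma hpoly_map_vsmult: "hpoly_map d c (s *s x) = s ^ d *s hpoly_map d c x"
proof -
  have "monomial \<alpha> (s *s x) = s ^ d * monomial \<alpha> x" if "\<alpha> \<in> Alpha d" for \<alpha>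
    using that by (simp add: monomial_def power_mult_distrib prod.distrib power_sum[symmetric] Alpha_def)
  then show ?thesis
    by (simp add: vec_eq_iff hpoly_map_nth sum_distrib_left mult_ac)
qed

lemma hpoly_map_diff:
  "hpoly_map d (\<lambda>i \<alpha>. c i \<alpha> - s * c' i \<alpha>) x = hpoly_map d c x - s *s hpoly_map d c' x"
  by (simp add: vec_eq_iff hpoly_map_nth left_diff_distrib sum_subtractf sum_distrib_left mult.assoc)

lemma norm_hpoly_map_le:
  fixes c :: "'n::finite \<Rightarrow> ('n \<Rightarrow> nat) \<Rightarrow> complex"
  assumes "norm x = 1"
  shows "norm (hpoly_map d c x) \<le> real CARD('n) * real (card (Alpha d :: ('n \<Rightarrow> nat) set)) * coef_norm d c"
proof -
  have le: "cmod (c i \<alpha>) \<le> coef_norm d c" if "\<alpha> \<in> Alpha d" for i \<alpha>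
  proof -
    have "(cmod (c i \<alpha>))\<^sup>2 \<le> (\<Sum>\<alpha>\<in>Alpha d. (cmod (c i \<alpha>))\<^sup>2)" by (rule member_le_sum) (use that in auto)
    also have "\<dots> \<le> (\<Sum>i\<in>UNIV. \<Sum>\<alpha>\<in>Alpha d. (cmod (c i \<alpha>))\<^sup>2)"
      by (rule member_le_sum[of i UNIV "\<lambda>i. \<Sum>\<alpha>\<in>Alpha d. (cmod (c i \<alpha>))\<^sup>2"]) (auto intro: sum_nonneg)
    finally show ?thesis unfolding coef_norm_def by (rule real_le_rsqrt)
  qed
  have mono: "cmod (monomial \<alpha> x) \<le> 1" for \<alpha>
  proof -
    have "cmod (x $ l) ^ \<alpha> l \<le> 1" for l
      using Finite_Cartesian_Product.norm_nth_le[of x l] assms by (intro power_le_one) auto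
    then show ?thesis by (simp add: monomial_def prod_norm[symmetric] norm_power prod_le_1)
  qed
  have "cmod (hpoly_map d c x $ i) \<le> real (card (Alpha d :: ('n \<Rightarrow> nat) set)) * coef_norm d c" for i
  proof -
    have "cmod (hpoly_map d c x $ i) \<le> (\<Sum>\<alpha>\<in>Alpha d. cmod (c i \<alpha> * monomial \<alpha> x))"
      unfolding hpoly_map_nth by (rule norm_sum)
    also have "\<dots> \<le> real (card (Alpha d :: ('n \<Rightarrow> nat) set)) * coef_norm d c"
    proof (rule sum_bounded_above)
      fix \<alpha> :: "'n \<Rightarrow> nat" assume "\<alpha> \<in> Alpha d"
      then have "cmod (c i \<alpha>) * cmod (monomial \<alpha> x) \<le> coef_norm d c * 1"
        by (intro mult_mono le mono) (auto simp: coef_norm_nonneg)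
      then show "cmod (c i \<alpha> * monomial \<alpha> x) \<le> coef_norm d c" by (simp add: norm_mult)
    qed
    finally show ?thesis .
  qed
  then have "(\<Sum>i\<in>UNIV. cmod (hpoly_map d c x $ i)) \<le> real CARD('n) * (real (card (Alpha d :: ('n \<Rightarrow> nat) set)) * coef_norm d c)"
    by (intro sum_bounded_above)
  moreover have "norm (hpoly_map d c x) \<le> (\<Sum>i\<in>UNIV. cmod (hpoly_map d c x $ i))"
    unfolding norm_vec_def by (rule L2_set_le_sum) simp
  ultimately show ?thesis by (simp add: mult.assoc)
qed

text \<open>This makes the infimum \<open>dist_M\<close> meaningful. With two coordinates available,
  the map whose components all equal \<open>x_i ^ d\<close> vanishes at another coordinate
  vector.\<close>

lemma indet_nonempty:
  assumes "CARD('n::finite) \<ge> 2" "0 < d"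
  shows "indet d \<noteq> ({} :: ('n \<Rightarrow> ('n \<Rightarrow> nat) \<Rightarrow> complex) set)"
proof -
  have "\<not> CARD('n) \<le> Suc 0" using assms by simp
  then obtain i j :: 'n where ij: "i \<noteq> j" using card_le_Suc0_iff_eq[of "UNIV :: 'n set"] by auto
  define c :: "'n \<Rightarrow> ('n \<Rightarrow> nat) \<Rightarrow> complex" where "c = (\<lambda>_ \<alpha>. if \<alpha> = (\<lambda>l. if l = i then d else 0) then 1 else 0)"
  have mem: "(\<lambda>l. if l = i then d else 0) \<in> Alpha d" by (simp add: Alpha_def)
  have "nonzero_coef d c" unfolding nonzero_coef_def using mem by (auto simp: c_def)
  moreover have "hpoly_map d c (axis j 1) = 0"
  proof (subst vec_eq_iff, intro allI)
    fix k
    have "monomial (\<lambda>l. if l = i then d else 0) (axis j (1::complex)) = 0"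
      unfolding monomial_def using ij assms by (intro prod_zero bexI[of _ i]) (auto simp: axis_def)
    then show "hpoly_map d c (axis j 1) $ k = 0 $ k"
      by (auto simp: hpoly_map_nth c_def intro!: sum.neutral)
  qed
  moreover have "axis j (1::complex) \<noteq> (0 :: complex^'n)" by (simp add: axis_eq_0_iff)
  ultimately have "c \<in> indet d" unfolding indet_def by blast
  then show ?thesis by blast
qed

lemma dist_M_le:
  assumes "nonzero_coef d c" "c' \<in> indet d" shows "dist_M d c \<le> fs_dist d c c'"
  unfolding dist_M_def
proof (rule cInf_lower)
  show "bdd_below (fs_dist d c ` indet d)"
    by (rule bdd_belowI[of _ 0]) (use fs_dist_bounds[OF assms(1)] in \<open>auto simp: indet_def\<close>)
qed (use assms in auto)

lemma dist_M_le_1: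
  fixes c :: "'n::finite \<Rightarrow> ('n \<Rightarrow> nat) \<Rightarrow> complex"
  assumes "CARD('n) \<ge> 2" "0 < d" "nonzero_coef d c" shows "dist_M d c \<le> 1"
proof -
  obtain c' :: "'n \<Rightarrow> ('n \<Rightarrow> nat) \<Rightarrow> complex" where c': "c' \<in> indet d" using indet_nonempty[OF assms(1,2)] by blast
  then have "fs_dist d c c' \<le> 1" using fs_dist_bounds(2)[OF assms(3)] by (auto simp: indet_def)
  then show ?thesis using dist_M_le[OF assms(3) c'] by simp
qed

text \<open>Subtracting a multiple of a single monomial makes the map vanish at a prescribed point.\<close>

lemma dist_M_le_norm_hpoly_map:
  fixes c :: "'n::finite \<Rightarrow> ('n \<Rightarrow> nat) \<Rightarrow> complex"
  assumes n: "CARD('n) \<ge> 2" and d: "0 < d" and c: "nonzero_coef d c" and x: "norm x = 1"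
  shows "dist_M d c * coef_norm d c \<le> 2 * real CARD('n) ^ d * norm (hpoly_map d c x)"
proof -
  define v where "v = hpoly_map d c x"
  define N where "N = real CARD('n)"
  have N: "N > 0" by (simp add: N_def)
  \<comment> \<open>The sum of the moduli of the \<open>N\<close> coordinates dominates the norm,
    which is 1. The coordinate found here supplies the monomial, and its size controls the cost of
    the correction.\<close>
  have "\<exists>l. 1 / N \<le> cmod (x $ l)"
  proof (rule ccontr)
    assume "\<not> ?thesis"
    then have "(\<Sum>l\<in>UNIV. cmod (x $ l)) < (\<Sum>l\<in>(UNIV::'n set). 1 / N)" by (intro sum_strict_mono) (auto simp: not_le)
    also have "\<dots> = 1" by (simp add: N_def)
    also have "1 \<le> (\<Sum>l\<in>UNIV. cmod (x $ l))"
      unfolding x[symmetric] norm_vec_def by (rule L2_set_le_sum) simp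
    finally show False by simp
  qed
  then obtain l where l: "1 / N \<le> cmod (x $ l)" by blast
  have xl: "x $ l \<noteq> 0" using l N by (auto simp: divide_le_0_iff)
  define \<alpha>0 where "\<alpha>0 = (\<lambda>j. if j = l then d else (0::nat))"
  have \<alpha>0: "\<alpha>0 \<in> Alpha d" by (simp add: Alpha_def \<alpha>0_def)
  have mon0: "monomial \<alpha>0 x = (x $ l) ^ d"
    unfolding monomial_def \<alpha>0_def by (subst prod.remove[of UNIV l]) (auto intro: prod.neutral)
  define b :: "'n \<Rightarrow> ('n \<Rightarrow> nat) \<Rightarrow> complex" where "b = (\<lambda>i \<alpha>. if \<alpha> = \<alpha>0 then v $ i / (x $ l) ^ d else 0)"
  have norm_b: "coef_norm d b = norm v / cmod (x $ l) ^ d"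
  proof -
    have "(\<Sum>\<alpha>\<in>Alpha d. (cmod (b i \<alpha>))\<^sup>2) = (cmod (v $ i / (x $ l) ^ d))\<^sup>2" for i
      using \<alpha>0 by (subst sum.remove[OF _ \<alpha>0]) (auto simp: b_def intro!: sum.neutral)
    then have "coef_norm d b = sqrt ((\<Sum>i\<in>UNIV. (cmod (v $ i))\<^sup>2) / (cmod (x $ l) ^ d)\<^sup>2)"
      by (simp add: coef_norm_def norm_divide norm_power power_divide sum_divide_distrib)
    then show ?thesis by (simp add: real_sqrt_divide norm_vec_def L2_set_def)
  qed
  have "(1 / N) ^ d \<le> cmod (x $ l) ^ d" using l N by (intro power_mono) auto
  then have "1 / cmod (x $ l) ^ d \<le> N ^ d" using N xl by (simp add: power_divide field_simps)
  then have b_le: "coef_norm d b \<le> N ^ d * norm v"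
    unfolding norm_b using mult_right_mono[of "1 / cmod (x $ l) ^ d" "N ^ d" "norm v"] by simp
  define c' where "c' = (\<lambda>i \<alpha>. c i \<alpha> - 1 * b i \<alpha>)"
  have "hpoly_map d b x = v"
  proof (subst vec_eq_iff, intro allI)
    fix i
    have "hpoly_map d b x $ i = b i \<alpha>0 * monomial \<alpha>0 x"
      unfolding hpoly_map_nth using \<alpha>0 by (subst sum.remove[OF _ \<alpha>0]) (auto simp: b_def intro!: sum.neutral)
    then show "hpoly_map d b x $ i = v $ i" using xl by (simp add: b_def mon0)
  qed
  then have c'x: "hpoly_map d c' x = 0" unfolding c'_def hpoly_map_diff by (simp add: v_def)
  have "dist_M d c * coef_norm d c \<le> 2 * coef_norm d b"
  proof (cases "nonzero_coef d c'")
    case True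
    have "x \<noteq> 0" using x by auto
    then have "c' \<in> indet d" using True c'x unfolding indet_def by blast
    then have "dist_M d c * coef_norm d c \<le> fs_dist d c c' * coef_norm d c"
      by (intro mult_right_mono dist_M_le[OF c] coef_norm_nonneg)
    also have "\<dots> \<le> 2 * coef_norm d (\<lambda>i \<alpha>. c i \<alpha> - c' i \<alpha>)" by (rule fs_dist_le[OF c True])
    also have "(\<lambda>i \<alpha>. c i \<alpha> - c' i \<alpha>) = b" by (simp add: c'_def)
    finally show ?thesis .
  next
    \<comment> \<open>If the corrected coefficients all vanish they define no point of projective
      space; but then \<open>c\<close> coincides with the correction \<open>b\<close>, and
      \<open>dist_M \<le> 1\<close> suffices.\<close>
    case False
    then have "c i \<alpha> = b i \<alpha>" if "\<alpha> \<in> Alpha d" for i \<alpha> using that by (auto simp: nonzero_coef_def c'_def)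
    then have "coef_norm d c = coef_norm d b" by (simp add: coef_norm_def)
    then show ?thesis
      using mult_right_mono[OF dist_M_le_1[OF n d c] coef_norm_nonneg[of d b]] coef_norm_nonneg[of d b] by simp
  qed
  also have "\<dots> \<le> 2 * (N ^ d * norm v)" using b_le by simp
  finally show ?thesis by (simp add: v_def N_def)
qed

text \<open>At a zero of \<open>c'\<close> all combinations \<open>c - \<lambda> c'\<close> take the
  same value as \<open>c\<close>. The minimum of the map of \<open>c\<close> on the unit sphere
  therefore bounds from below the distance from \<open>c\<close> to the line of \<open>c'\<close>,
  uniformly in \<open>c'\<close>. Positivity is what gives the logarithms of \<open>dist_M\<close>
  their meaning.\<close>

lemma dist_M_pos:
  fixes c :: "'n::finite \<Rightarrow> ('n \<Rightarrow> nat) \<Rightarrow> complex"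
  assumes n: "CARD('n) \<ge> 2" and d: "0 < d" and c: "holo d c"
  shows "0 < dist_M d c"
proof -
  have nz: "nonzero_coef d c" using c by (simp add: holo_def)
  define K where "K = real CARD('n) * real (card (Alpha d :: ('n \<Rightarrow> nat) set)) + 1"
  have K: "K > 0" unfolding K_def by (intro add_nonneg_pos) auto
  have cont: "continuous_on (sphere 0 1) (\<lambda>x. norm (hpoly_map d c x))"
    unfolding hpoly_map_def by (intro continuous_intros)
  have ne: "(SOME b. b \<in> Basis) \<in> sphere (0::complex^'n) 1" by (simp add: norm_Basis SOME_Basis)
  obtain a where a: "a \<in> sphere 0 1" "\<And>x. x \<in> sphere 0 1 \<Longrightarrow> norm (hpoly_map d c a) \<le> norm (hpoly_map d c x)"
    using continuous_attains_inf[OF compact_sphere _ cont] ne by blast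
  define m where "m = norm (hpoly_map d c a)"
  have "a \<noteq> 0" using a by auto
  then have m: "m > 0" using c by (auto simp: m_def holo_def)
  define s where "s = coef_norm d c"
  have s: "s > 0" using nz by (simp add: s_def coef_norm_pos_iff)
  \<comment> \<open>A uniform lower bound for the squared sine of the angle; the cap at 1 keeps
    \<open>1 - \<eta>\<close> nonnegative under the square root.\<close>
  define \<eta> where "\<eta> = min 1 ((m / (K * s))\<^sup>2)"
  have \<eta>: "0 < \<eta>" "\<eta> \<le> 1" using m K s by (auto simp: \<eta>_def)
  have lower: "2 / pi * arccos (sqrt (1 - \<eta>)) \<le> fs_dist d c c'" if c': "c' \<in> indet d" for c'
  proof -
    obtain x where x: "x \<noteq> 0" "hpoly_map d c' x = 0" and nz': "nonzero_coef d c'" using c' by (auto simp: indet_def)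
    define x1 where "x1 = of_real (1 / norm x) *s x"
    have x1: "norm x1 = 1" unfolding x1_def by (rule norm_normalize_eq_1[OF x(1)])
    have c'x1: "hpoly_map d c' x1 = 0" by (simp add: x1_def hpoly_map_vsmult x)
    define lam where "lam = coef_inner d c c' / of_real ((coef_norm d c')\<^sup>2)"
    define t where "t = cmod (coef_inner d c c') / (coef_norm d c * coef_norm d c')"
    have t: "0 \<le> t" "t \<le> 1" unfolding t_def using coef_cosine_bounds[OF nz nz'] by auto
    let ?b = "\<lambda>i \<alpha>. c i \<alpha> - lam * c' i \<alpha>"
    have "m \<le> norm (hpoly_map d ?b x1)"
      using a(2)[of x1] x1 unfolding hpoly_map_diff by (simp add: m_def c'x1)
    also have "\<dots> \<le> K * coef_norm d ?b"
      using norm_hpoly_map_le[OF x1, of d ?b] coef_norm_nonneg[of d ?b] by (simp add: K_def distrib_right)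
    finally have "m / K \<le> coef_norm d ?b" using K by (simp add: divide_le_eq mult.commute)
    then have "(m / K)\<^sup>2 \<le> (coef_norm d ?b)\<^sup>2" using m K by (intro power_mono) auto
    also have "\<dots> = s\<^sup>2 * (1 - t\<^sup>2)"
      unfolding lam_def coef_norm_diff_best[OF nz'] using s by (simp add: t_def s_def[symmetric] power_divide power_mult_distrib right_diff_distrib)
    finally have "(m / K)\<^sup>2 / s\<^sup>2 \<le> s\<^sup>2 * (1 - t\<^sup>2) / s\<^sup>2" by (intro divide_right_mono) auto
    then have "(m / (K * s))\<^sup>2 \<le> 1 - t\<^sup>2" using s by (simp add: power_divide power_mult_distrib)
    then have "\<eta> \<le> 1 - t\<^sup>2" unfolding \<eta>_def by (rule order.trans[OF min.cobounded2])
    then have "t\<^sup>2 \<le> 1 - \<eta>" by simp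
    then have "t \<le> sqrt (1 - \<eta>)" by (rule real_le_rsqrt)
    then have "arccos (sqrt (1 - \<eta>)) \<le> arccos t" using t \<eta> by (intro arccos_le_arccos) auto
    then show ?thesis unfolding fs_dist_def t_def[symmetric] by (intro mult_left_mono) auto
  qed
  have "arccos 1 < arccos (sqrt (1 - \<eta>))" using \<eta> by (intro arccos_less_arccos) (auto simp: real_sqrt_lt_1_iff intro: order.trans[of _ 0])
  then have "0 < 2 / pi * arccos (sqrt (1 - \<eta>))" by simp
  also have "\<dots> \<le> dist_M d c"
    unfolding dist_M_def by (rule cInf_greatest) (use indet_nonempty[OF n d] lower in auto)
  finally show ?thesis .
qed

text \<open>The coefficients give the upper estimate, and closeness to a map vanishing at
  \<open>x\<close> the lower one. The constant \<open>K\<close> does not depend on the map: all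
  degeneration is measured by the single term \<open>- ln (dist_M d c)\<close>, which is where (A)
  can enter.\<close>

lemma ln_norm_hpoly_map_bound:
  fixes d :: nat
  assumes n: "CARD('n::finite) \<ge> 2" and d: "0 < d"
  shows "\<exists>K\<ge>0. \<forall>(c :: 'n \<Rightarrow> ('n \<Rightarrow> nat) \<Rightarrow> complex) x. holo d c \<longrightarrow> x \<noteq> 0 \<longrightarrow>
    \<bar>ln (norm (hpoly_map d c x)) - (d * ln (norm x) + ln (coef_norm d c))\<bar> \<le> K - ln (dist_M d c)"
proof -
  define K1 where "K1 = real CARD('n) * real (card (Alpha d :: ('n \<Rightarrow> nat) set)) + 1"
  define K2 where "K2 = 2 * real CARD('n) ^ d"
  have K1: "K1 > 0" unfolding K1_def by (intro add_nonneg_pos) auto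
  have K2: "K2 > 0" unfolding K2_def by simp
  show ?thesis
  proof (intro exI[of _ "\<bar>ln K1\<bar> + \<bar>ln K2\<bar>"] conjI allI impI)
    fix c :: "'n \<Rightarrow> ('n \<Rightarrow> nat) \<Rightarrow> complex" and x :: "complex^'n"
    assume c: "holo d c" and x: "x \<noteq> 0"
    have nz: "nonzero_coef d c" using c by (simp add: holo_def)
    then have s: "coef_norm d c > 0" by (simp add: coef_norm_pos_iff)
    have D: "0 < dist_M d c" "dist_M d c \<le> 1" using dist_M_pos[OF n d c] dist_M_le_1[OF n d nz] by auto
    define y where "y = of_real (1 / norm x) *s x"
    have y: "norm y = 1" unfolding y_def by (rule norm_normalize_eq_1[OF x])
    have "y \<noteq> 0" using y by auto
    then have fy: "norm (hpoly_map d c y) > 0" using c by (auto simp: holo_def)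
    have "x = of_real (norm x) *s y" using x by (simp add: y_def vec_eq_iff)
    then have "hpoly_map d c x = of_real (norm x) ^ d *s hpoly_map d c y" by (metis hpoly_map_vsmult)
    then have "norm (hpoly_map d c x) = norm x ^ d * norm (hpoly_map d c y)" by (simp add: norm_vsmult norm_power)
    then have eq: "ln (norm (hpoly_map d c x)) = d * ln (norm x) + ln (norm (hpoly_map d c y))"
      using x fy by (simp add: ln_mult ln_realpow)
    have "norm (hpoly_map d c y) \<le> K1 * coef_norm d c"
      using norm_hpoly_map_le[OF y, of d c] s by (simp add: K1_def distrib_right)
    then have "ln (norm (hpoly_map d c y)) \<le> ln (K1 * coef_norm d c)" using fy by (intro ln_mono) auto
    then have up: "ln (norm (hpoly_map d c y)) \<le> ln K1 + ln (coef_norm d c)" using K1 s by (simp add: ln_mult)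
    have "ln (dist_M d c * coef_norm d c) \<le> ln (K2 * norm (hpoly_map d c y))"
      using dist_M_le_norm_hpoly_map[OF n d nz y] D s by (intro ln_mono) (auto simp: K2_def)
    then have lo: "ln (dist_M d c) + ln (coef_norm d c) \<le> ln K2 + ln (norm (hpoly_map d c y))"
      using D s K2 fy by (simp add: ln_mult)
    have "ln (dist_M d c) \<le> 0" using D by simp
    then show "\<bar>ln (norm (hpoly_map d c x)) - (d * ln (norm x) + ln (coef_norm d c))\<bar> \<le> \<bar>ln K1\<bar> + \<bar>ln K2\<bar> - ln (dist_M d c)"
      using up lo unfolding eq by (simp add: abs_le_iff) linarith
  qed simp
qed

section \<open>Iterated lifts and the Green function\<close>

lemma Flift_vsmult: "Flift d f n (s *s x) = s ^ (d ^ n) *s Flift d f n x"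
  by (induction n) (simp_all add: hpoly_map_vsmult power_mult[symmetric] mult.commute)

lemma hpoly_map_0: "0 < d \<Longrightarrow> hpoly_map d c 0 = 0"
  using hpoly_map_vsmult[of d c 0 0] by (simp add: power_0_left)

lemma Flift_eq_0_iff:
  assumes "0 < d" "\<And>j. holo d (f j)" shows "Flift d f n x = 0 \<longleftrightarrow> x = 0"
  by (induction n) (use assms in \<open>auto simp: hpoly_map_0 holo_def\<close>)

lemma Flift_add: "Flift d f (n + k) x = Flift d (\<lambda>j. f (j + n)) k (Flift d f n x)"
  by (induction k) (simp_all add: add.commute)

lemma polynomial_hpoly_map: "polynomial d (\<lambda>x. hpoly_map d c x $ i)"
  unfolding hpoly_map_nth
  by (intro polynomial_sum polynomial_cmult polynomial_monomial) (use Alpha_subset_exps in auto)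

lemma polynomial_Flift: "\<exists>q. \<forall>i. polynomial q (\<lambda>x. Flift d f n x $ i)"
proof (induction n)
  case 0
  show ?case unfolding Flift.simps id_apply by (intro exI[of _ 1] allI polynomial_coord)
next
  case (Suc n)
  then obtain q where q: "\<And>i. polynomial q (\<lambda>x. Flift d f n x $ i)" by blast
  have "polynomial (CARD('a) * d * q) (\<lambda>x. hpoly_map d (f n) (Flift d f n x) $ i)" for i
    by (rule polynomial_compose[OF polynomial_hpoly_map q])
  then show ?case by auto
qed

lemma homogeneous_map_Flift:
  assumes "0 < d" "\<And>j. holo d (f j)"
  shows "\<exists>q q' A. homogeneous_map (Flift d f n) (d ^ n) q q' A"
proof -
  obtain q where q: "\<And>i. polynomial q (\<lambda>x. Flift d f n x $ i)" using polynomial_Flift by blast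
  obtain q' A where A: "\<And>i j. polynomial q' (\<lambda>x. A x $ i $ j)"
    "\<And>x. (Flift d f n has_derivative (\<lambda>h. A x *v h)) (at x)"
    using polynomial_map_jacobian[OF q] by blast
  have "homogeneous_map (Flift d f n) (d ^ n) q q' A"
    by unfold_locales (use assms q A Flift_vsmult Flift_eq_0_iff[OF assms] in auto)
  then show ?thesis by blast
qed

text \<open>The additive constant accumulated in \<open>ln |F_n|\<close> because the coefficient
  vectors are not normalized. Removing it leaves increments controlled by
  \<open>dist_M\<close>.\<close>

primrec lift_scale :: "nat \<Rightarrow> (nat \<Rightarrow> 'n::finite \<Rightarrow> ('n \<Rightarrow> nat) \<Rightarrow> complex) \<Rightarrow> nat \<Rightarrow> real" where
  "lift_scale d f 0 = 0"
| "lift_scale d f (Suc n) = d * lift_scale d f n + ln (coef_norm d (f n))"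

text \<open>\<open>G\<close> is the limit of \<open>(ln |F_n| - lift_scale d f n) / d ^ n\<close>.
  Consecutive terms differ by at most \<open>b n\<close>, a linearly growing numerator over
  \<open>d ^ (n + 1)\<close>, so convergence is uniform; continuity and logarithmic homogeneity pass
  to the limit.\<close>

lemma Green_function:
  fixes f :: "nat \<Rightarrow> 'n::finite \<Rightarrow> ('n \<Rightarrow> nat) \<Rightarrow> complex"
  assumes n: "CARD('n) \<ge> 2" and d: "d \<ge> 2" and holo: "\<And>j. holo d (f j)"
    and condA: "liminf (\<lambda>n. ereal ((1 / real n) * (\<Sum>j<n. ln (dist_M d (f j))))) > - \<infinity>"
  obtains G \<tau> where "continuous_on (- {0}) G" "\<And>c x. c \<noteq> 0 \<Longrightarrow> x \<noteq> 0 \<Longrightarrow> G (c *s x) = G x + ln (cmod c)"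
    "\<tau> \<longlonglongrightarrow> 0" "\<And>n x. x \<noteq> 0 \<Longrightarrow> \<bar>G x - (ln (norm (Flift d f n x)) - lift_scale d f n) / real (d ^ n)\<bar> \<le> \<tau> n"
proof -
  have d0: "0 < d" using d by simp
  obtain K where K: "K \<ge> 0" "\<And>(c :: 'n \<Rightarrow> ('n \<Rightarrow> nat) \<Rightarrow> complex) x. holo d c \<Longrightarrow> x \<noteq> 0 \<Longrightarrow>
    \<bar>ln (norm (hpoly_map d c x)) - (d * ln (norm x) + ln (coef_norm d c))\<bar> \<le> K - ln (dist_M d c)"
    using ln_norm_hpoly_map_bound[OF n d0] by blast
  define \<delta> where "\<delta> j = ln (dist_M d (f j))" for j
  have \<delta>: "\<delta> j \<le> 0" for j
    using dist_M_pos[OF n d0 holo[of j]] dist_M_le_1[OF n d0, of "f j"] holo[of j] by (simp add: \<delta>_def holo_def)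
  obtain r where r: "ereal r < liminf (\<lambda>n. ereal ((1 / real n) * (\<Sum>j<n. \<delta> j)))"
    using condA unfolding \<delta>_def by (metis MInfty_neq_ereal(1) ereal_dense2 less_ereal.simps(2))
  then have "\<forall>\<^sub>F n in sequentially. ereal r < ereal ((1 / real n) * (\<Sum>j<n. \<delta> j))"
    by (rule less_LiminfD)
  then obtain n0 where n0: "\<And>n. n \<ge> n0 \<Longrightarrow> r < (1 / real n) * (\<Sum>j<n. \<delta> j)"
    by (auto simp: eventually_sequentially)
  \<comment> \<open>Every \<delta> is nonpositive, so a single term is at least the whole partial
    sum, which (A) bounds below linearly in the number of terms.\<close>
  have lower: "- \<delta> j \<le> \<bar>r\<bar> * real (Suc j)" if "j \<ge> n0" for j
  proof -
    have "r < (1 / real (Suc j)) * (\<Sum>i<Suc j. \<delta> i)" using that by (intro n0) simp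
    then have "r * real (Suc j) < (\<Sum>i<Suc j. \<delta> i)" by (simp only: times_divide_eq_left mult_1 pos_less_divide_eq of_nat_0_less_iff zero_less_Suc)
    also have "\<dots> \<le> \<delta> j" using \<delta> by (simp add: sum_nonpos)
    finally have "- \<delta> j \<le> - r * real (Suc j)" by simp
    also have "\<dots> \<le> \<bar>r\<bar> * real (Suc j)" by (intro mult_right_mono) auto
    finally show ?thesis .
  qed
  define b where "b j = (K - \<delta> j) / real d ^ Suc j" for j
  have b0: "0 \<le> b j" for j using K(1) \<delta>[of j] by (simp add: b_def)
  have "summable b"
  proof (rule summable_comparison_test_ev)
    show "\<forall>\<^sub>F j in sequentially. norm (b j) \<le> (K + \<bar>r\<bar>) * (real (Suc j) * (1 / 2) ^ j)"
      unfolding eventually_sequentially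
    proof (intro exI allI impI)
      fix j assume j: "n0 \<le> j"
      have "K - \<delta> j \<le> K * real (Suc j) + \<bar>r\<bar> * real (Suc j)"
        using lower[OF j] K(1) mult_left_mono[of 1 "real (Suc j)" K] by simp
      then have 1: "K - \<delta> j \<le> (K + \<bar>r\<bar>) * real (Suc j)" by (simp only: distrib_right)
      have "(2::real) ^ j \<le> 2 ^ Suc j" by simp
      also have "\<dots> \<le> real d ^ Suc j" using d by (intro power_mono) auto
      finally have 2: "1 / real d ^ Suc j \<le> (1 / 2) ^ j" by (simp add: power_one_over frac_le)
      have "b j = (K - \<delta> j) * (1 / real d ^ Suc j)" by (simp add: b_def)
      also have "\<dots> \<le> ((K + \<bar>r\<bar>) * real (Suc j)) * (1 / 2) ^ j"
        using K(1) \<delta>[of j] by (intro mult_mono 1 2) auto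
      finally show "norm (b j) \<le> (K + \<bar>r\<bar>) * (real (Suc j) * (1 / 2) ^ j)"
        using b0[of j] by (simp add: mult.assoc)
    qed
    show "summable (\<lambda>j. (K + \<bar>r\<bar>) * (real (Suc j) * (1 / 2) ^ j))"
      using geometric_deriv_sums[of "1/2 :: real"] by (intro summable_mult) (auto simp: sums_iff)
  qed
  define L where "L n x = (ln (norm (Flift d f n x)) - lift_scale d f n) / real d ^ n" for n and x :: "complex^'n"
  have step: "\<bar>L (Suc n) x - L n x\<bar> \<le> b n" if "x \<noteq> 0" for n x
  proof -
    define y where "y = Flift d f n x"
    have y: "y \<noteq> 0" unfolding y_def using Flift_eq_0_iff[where f = f, OF d0 holo] that by blast
    have "L n x = (real d * ln (norm y) - real d * lift_scale d f n) / real d ^ Suc n"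
      using d0 by (simp add: L_def y_def right_diff_distrib[symmetric])
    then have "L (Suc n) x - L n x = (ln (norm (hpoly_map d (f n) y)) - (d * ln (norm y) + ln (coef_norm d (f n)))) / real d ^ Suc n"
      by (simp add: L_def y_def diff_divide_distrib[symmetric] algebra_simps)
    then show ?thesis
      using K(2)[OF holo[of n] y] by (simp add: b_def \<delta>_def abs_divide divide_right_mono)
  qed
  define S where "S n = (\<Sum>i<n. b i)" for n
  \<comment> \<open>The tail of the majorizing series: an error bound uniform in
    \<open>x\<close>.\<close>
  define \<tau> where "\<tau> n = suminf b - S n" for n
  have Slim: "S \<longlonglongrightarrow> suminf b" unfolding S_def by (rule summable_LIMSEQ[OF \<open>summable b\<close>])
  then have \<tau>: "\<tau> \<longlonglongrightarrow> 0" unfolding \<tau>_def by (auto intro!: tendsto_eq_intros)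
  have S_le: "S n \<le> suminf b" for n
    unfolding S_def by (rule sum_le_suminf) (use \<open>summable b\<close> b0 in auto)
  have diff: "\<bar>L m x - L n x\<bar> \<le> S m - S n" if "x \<noteq> 0" "n \<le> m" for m n x
    using that(2)
  proof (induction m rule: dec_induct)
    case (step m)
    then show ?case using \<open>\<And>n x. x \<noteq> 0 \<Longrightarrow> \<bar>L (Suc n) x - L n x\<bar> \<le> b n\<close>[OF that(1), of m] by (simp add: S_def)
  qed simp
  define G where "G x = L 0 x + (\<Sum>n. L (Suc n) x - L n x)" for x
  have LG: "(\<lambda>n. L n x) \<longlonglongrightarrow> G x" if "x \<noteq> 0" for x
  proof -
    have "summable (\<lambda>n. L (Suc n) x - L n x)"
      by (rule summable_comparison_test'[OF \<open>summable b\<close>, of 0]) (use step[OF that] in auto)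
    then have "(\<lambda>n. L 0 x + (\<Sum>i<n. L (Suc i) x - L i x)) \<longlonglongrightarrow> G x"
      unfolding G_def by (intro tendsto_add tendsto_const summable_LIMSEQ)
    then show ?thesis using sum_lessThan_telescope[of "\<lambda>i. L i x"] by simp
  qed
  have GL: "\<bar>G x - L n x\<bar> \<le> \<tau> n" if "x \<noteq> 0" for x n
  proof (rule LIMSEQ_le_const2)
    show "(\<lambda>m. \<bar>L m x - L n x\<bar>) \<longlonglongrightarrow> \<bar>G x - L n x\<bar>" by (intro tendsto_intros LG that)
    show "\<exists>N. \<forall>m\<ge>N. \<bar>L m x - L n x\<bar> \<le> \<tau> n"
      using diff[OF that] S_le unfolding \<tau>_def by (meson diff_right_mono order.trans)
  qed
  have contL: "continuous_on (- {0}) (L n)" for n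
  proof -
    obtain q where q: "\<And>i. polynomial q (\<lambda>x. Flift d f n x $ i)" using polynomial_Flift by blast
    have "continuous_on UNIV (\<lambda>x. \<chi> i. Flift d f n x $ i)"
      by (intro continuous_on_vec_lambda continuous_on_polynomial[OF q])
    then have "continuous_on UNIV (Flift d f n)" by simp
    then have "continuous_on (- {0}) (Flift d f n)" by (rule continuous_on_subset) simp
    then show ?thesis unfolding L_def
      using Flift_eq_0_iff[where f = f and n = n, OF d0 holo] d0
      by (intro continuous_on_divide continuous_on_diff continuous_on_ln continuous_on_norm continuous_on_const) auto
  qed
  have "uniform_limit (- {0}) L G sequentially"
  proof (rule uniform_limitI)
    fix e :: real assume "0 < e"
    have "\<forall>\<^sub>F n in sequentially. \<tau> n < e" by (rule order_tendstoD(2)[OF \<tau> \<open>0 < e\<close>])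
    then show "\<forall>\<^sub>F n in sequentially. \<forall>x\<in>- {0}. dist (L n x) (G x) < e"
    proof eventually_elim
      case (elim n)
      then show ?case using GL[of _ n] by (auto simp: dist_real_def abs_minus_commute intro: order.strict_trans1)
    qed
  qed
  then have contG: "continuous_on (- {0}) G"
    by (rule uniform_limit_theorem[rotated]) (auto simp: contL)
  have Gs: "G (c *s x) = G x + ln (cmod c)" if cx: "c \<noteq> 0" "x \<noteq> 0" for c x
  proof -
    have Ls: "L n (c *s x) = L n x + ln (cmod c)" for n
    proof -
      have "norm (Flift d f n x) > 0" using Flift_eq_0_iff[where f = f and n = n, OF d0 holo] cx by simp
      then have "ln (norm (Flift d f n (c *s x))) = real d ^ n * ln (cmod c) + ln (norm (Flift d f n x))"
        using cx by (simp add: Flift_vsmult norm_vsmult norm_power ln_mult ln_realpow)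
      then show ?thesis using d0 by (simp add: L_def field_simps)
    qed
    have "c *s x \<noteq> 0" using cx by (auto simp: vec_eq_iff)
    from LG[OF this] have "(\<lambda>n. L n x + ln (cmod c)) \<longlonglongrightarrow> G (c *s x)" by (simp only: Ls)
    moreover have "(\<lambda>n. L n x + ln (cmod c)) \<longlonglongrightarrow> G x + ln (cmod c)" by (intro tendsto_intros LG cx)
    ultimately show ?thesis by (rule LIMSEQ_unique)
  qed
  show ?thesis
    by (rule that[OF contG Gs \<tau>]) (use GL in \<open>auto simp: L_def\<close>)
qed

section \<open>Projective space and the Fubini--Study measure\<close>

lemma open_pspace: "open pspace"
  unfolding pspace_def by (intro open_Collect_neq continuous_intros)

lemma pspace_borel [measurable]: "pspace \<in> sets borel"
  by (rule borel_open[OF open_pspace])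

lemma pspace_eq: "pspace = - {0}"
  by (auto simp: pspace_def)

lemma cone_sets_vsmult_iff:
  assumes "A \<in> cone_sets" "c \<noteq> 0" shows "c *s x \<in> A \<longleftrightarrow> x \<in> A"
proof
  assume "c *s x \<in> A"
  moreover have "\<forall>x\<in>A. \<forall>c. c \<noteq> 0 \<longrightarrow> c *s x \<in> A" using assms(1) by (simp add: cone_sets_def)
  ultimately have "inverse c *s (c *s x) \<in> A" using assms(2) nonzero_imp_inverse_nonzero by blast
  then show "x \<in> A" using assms(2) by simp
qed (use assms in \<open>auto simp: cone_sets_def\<close>)

lemma cone_setsI:
  assumes "A \<in> sets borel" "A \<subseteq> pspace" "\<And>x c. x \<in> A \<Longrightarrow> c \<noteq> 0 \<Longrightarrow> c *s x \<in> A"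
  shows "A \<in> cone_sets"
  using assms by (auto simp: cone_sets_def)

lemma sigma_algebra_cone_sets: "sigma_algebra pspace cone_sets"
proof (rule sigma_algebra_iff2[THEN iffD2], intro conjI ballI allI impI)
  show "cone_sets \<subseteq> Pow pspace" by (auto simp: cone_sets_def)
  show "{} \<in> cone_sets" by (auto simp: cone_sets_def)
  fix A :: "(complex^'n) set" assume A: "A \<in> cone_sets"
  show "pspace - A \<in> cone_sets"
  proof (rule cone_setsI)
    show "pspace - A \<in> sets borel" using A pspace_borel by (auto simp: cone_sets_def intro: sets.Diff)
    show "c *s x \<in> pspace - A" if "x \<in> pspace - A" "c \<noteq> 0" for x c
      using that cone_sets_vsmult_iff[OF A that(2), of x] by (auto simp: pspace_def)
  qed auto
next
  fix A :: "nat \<Rightarrow> (complex^'n) set" assume "range A \<subseteq> cone_sets"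
  then have A: "A i \<in> cone_sets" for i by blast
  show "(\<Union>i. A i) \<in> cone_sets"
  proof (rule cone_setsI)
    show "c *s x \<in> (\<Union>i. A i)" if "x \<in> (\<Union>i. A i)" "c \<noteq> 0" for x c
      using that cone_sets_vsmult_iff[OF A] by blast
  qed (use A in \<open>auto simp: cone_sets_def\<close>)
qed

abbreviation cone_space :: "(complex^'n::finite) measure" where
  "cone_space \<equiv> sigma pspace cone_sets"

lemma sets_cone_space [simp]: "sets cone_space = cone_sets"
  by (rule sigma_algebra.sets_measure_of_eq[OF sigma_algebra_cone_sets])

lemma space_cone_space [simp]: "space cone_space = pspace"
  by (rule sigma_algebra.space_measure_of_eq[OF sigma_algebra_cone_sets])

lemma space_eq_pspace: "sets M = cone_sets \<Longrightarrow> space M = pspace"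
  using sets_eq_imp_space_eq[of M cone_space] by simp

lemma cont_Pk_measurable:
  assumes "cont_Pk \<phi>" "sets M = cone_sets" shows "\<phi> \<in> borel_measurable M"
proof (rule borel_measurableI)
  fix S :: "real set" assume S: "open S"
  have "open (\<phi> -` S \<inter> pspace)"
    using continuous_open_preimage[OF _ open_pspace S, of \<phi>] assms(1) by (simp add: cont_Pk_def Int_commute)
  then have "\<phi> -` S \<inter> pspace \<in> cone_sets"
    using assms(1) by (intro cone_setsI) (auto simp: cont_Pk_def pspace_def)
  then show "\<phi> -` S \<inter> space M \<in> sets M" using assms(2) space_eq_pspace[OF assms(2)] by simp
qed

lemma cont_Pk_vsmult: "cont_Pk \<phi> \<Longrightarrow> x \<noteq> 0 \<Longrightarrow> c \<noteq> 0 \<Longrightarrow> \<phi> (c *s x) = \<phi> x"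
  by (auto simp: cont_Pk_def pspace_def)

lemma cont_Pk_bounded:
  assumes "cont_Pk \<phi>" obtains M where "0 \<le> M" "\<And>x. x \<noteq> 0 \<Longrightarrow> \<bar>\<phi> x\<bar> \<le> M"
proof -
  have "compact (\<phi> ` sphere 0 1)"
    using assms by (intro compact_continuous_image compact_sphere)
      (auto simp: cont_Pk_def pspace_def elim!: continuous_on_subset)
  then obtain M where M: "\<forall>y\<in>\<phi> ` sphere 0 1. norm y \<le> M" using compact_imp_bounded bounded_iff by metis
  have "\<bar>\<phi> x\<bar> \<le> max 0 M" if x: "x \<noteq> 0" for x
  proof -
    have "\<phi> (of_real (1 / norm x) *s x) = \<phi> x" by (rule cont_Pk_vsmult[OF assms x]) (use x in simp)
    moreover have "of_real (1 / norm x) *s x \<in> sphere 0 1" using norm_normalize_eq_1[OF x] by simp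
    ultimately show ?thesis using M by (metis imageI max.coboundedI2 real_norm_def)
  qed
  then show ?thesis using that[of "max 0 M"] by auto
qed

lemma cont_Pk_integrable:
  assumes "cont_Pk \<phi>" "sets M = cone_sets" "finite_measure M" shows "integrable M \<phi>"
proof -
  obtain B where B: "\<And>x. x \<noteq> 0 \<Longrightarrow> \<bar>\<phi> x\<bar> \<le> B" using cont_Pk_bounded[OF assms(1)] by blast
  show ?thesis
    by (rule finite_measure.integrable_const_bound[OF assms(3), of _ B])
      (use B space_eq_pspace[OF assms(2)] cont_Pk_measurable[OF assms(1,2)] in \<open>auto simp: pspace_def\<close>)
qed

lemma cont_Pk_const: "cont_Pk (\<lambda>_. c)"
  by (auto simp: cont_Pk_def)

lemma cont_Pk_add: "cont_Pk f \<Longrightarrow> cont_Pk g \<Longrightarrow> cont_Pk (\<lambda>x. f x + g x)"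
  by (auto simp: cont_Pk_def intro: continuous_intros)

lemma cont_Pk_mult: "cont_Pk f \<Longrightarrow> cont_Pk g \<Longrightarrow> cont_Pk (\<lambda>x. f x * g x)"
  by (auto simp: cont_Pk_def intro: continuous_intros)

section \<open>The measure induced by the Gaussian on projective space\<close>

text \<open>The image under the identity only coarsens the sigma-algebra, from Borel sets of the
  punctured space to invariant ones.\<close>

definition fs_measure :: "(complex^'n::finite) measure" where
  "fs_measure = distr (restrict_space (density lborel (\<lambda>z. ennreal (gdens z))) pspace) cone_space (\<lambda>x. x)"

lemma sets_fs_measure [simp]: "sets fs_measure = cone_sets"
  by (simp add: fs_measure_def)

lemma space_fs_measure [simp]: "space fs_measure = pspace"
  by (simp add: fs_measure_def)

lemma measurable_id_cone_space:
  "(\<lambda>x. x) \<in> measurable (restrict_space (density lborel (\<lambda>z. ennreal (gdens z))) pspace) cone_space"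
proof (rule measurableI)
  fix A :: "(complex^'n) set" assume "A \<in> sets cone_space"
  then have "A \<in> cone_sets" by simp
  then have "A \<in> sets borel" "A \<subseteq> pspace" by (simp_all add: cone_sets_def)
  then show "(\<lambda>x. x) -` A \<inter> space (restrict_space (density lborel (\<lambda>z. ennreal (gdens z))) pspace)
      \<in> sets (restrict_space (density lborel (\<lambda>z. ennreal (gdens z))) pspace)"
    by (auto simp: space_restrict_space sets_restrict_space_iff Int_absorb2)
qed (simp add: space_restrict_space)

lemma emeasure_fs_measure:
  assumes "A \<in> cone_sets"
  shows "emeasure fs_measure A = (\<integral>\<^sup>+z. ennreal (gdens z) * indicator A z \<partial>lborel)"
proof -
  have A: "A \<in> sets borel" "A \<subseteq> pspace" using assms by (auto simp: cone_sets_def)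
  have "emeasure fs_measure A = emeasure (restrict_space (density lborel (\<lambda>z. ennreal (gdens z))) pspace) A"
    unfolding fs_measure_def using A assms
    by (subst emeasure_distr[OF measurable_id_cone_space]) (auto simp: space_restrict_space Int_absorb2)
  also have "\<dots> = emeasure (density lborel (\<lambda>z. ennreal (gdens z))) A"
    using A by (intro emeasure_restrict_space) auto
  also have "\<dots> = (\<integral>\<^sup>+z. ennreal (gdens z) * indicator A z \<partial>lborel)"
    using A by (intro emeasure_density) auto
  finally show ?thesis .
qed

lemma AE_neq_0_lborel: "AE z::'a::euclidean_space in lborel. z \<noteq> 0"
  using AE_not_in[of "{0::'a}" lborel] by (simp add: finite_imp_null_set_lborel)

text \<open>The integrand will be a push-forward, whose values are controlled only at almost every
  point; it is exchanged for an explicit Borel function \<open>g\<close>, which need not be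
  scale-invariant.\<close>

lemma integral_fs_measure:
  fixes \<psi> :: "complex^'n::finite \<Rightarrow> real"
  assumes "\<psi> \<in> borel_measurable fs_measure" and [measurable]: "g \<in> borel_measurable borel"
    and eq: "AE z in lborel. z \<noteq> 0 \<longrightarrow> \<psi> z = g z"
  shows "(\<integral>z. \<psi> z \<partial>fs_measure) = (\<integral>z. g z * gdens z \<partial>lborel)"
proof -
  let ?\<nu> = "density lborel (\<lambda>z::complex^'n. ennreal (gdens z))"
  have "borel_measurable (fs_measure :: (complex^'n) measure) = (borel_measurable cone_space :: (complex^'n \<Rightarrow> real) set)"
    by (rule measurable_cong_sets) simp_all
  then have m: "\<psi> \<in> borel_measurable cone_space" using assms(1) by blast
  have m': "\<psi> \<in> borel_measurable (restrict_space ?\<nu> pspace)"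
    using measurable_compose[OF measurable_id_cone_space m] .
  then have m2: "(\<lambda>z. indicator pspace z *\<^sub>R \<psi> z) \<in> borel_measurable ?\<nu>"
    by (subst (asm) borel_measurable_restrict_space_iff) auto
  have "(\<integral>z. \<psi> z \<partial>fs_measure) = (\<integral>z. \<psi> z \<partial>restrict_space ?\<nu> pspace)"
    unfolding fs_measure_def by (rule integral_distr[OF measurable_id_cone_space m])
  also have "\<dots> = (\<integral>z. indicator pspace z *\<^sub>R \<psi> z \<partial>?\<nu>)"
    by (rule integral_restrict_space) simp
  also have "\<dots> = (\<integral>z. gdens z *\<^sub>R (indicator pspace z *\<^sub>R \<psi> z) \<partial>lborel)"
    by (rule integral_density) (use m2 in auto)
  also have "\<dots> = (\<integral>z. g z * gdens z \<partial>lborel)"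
  proof (rule integral_cong_AE)
    show "(\<lambda>z. gdens z *\<^sub>R (indicator pspace z *\<^sub>R \<psi> z)) \<in> borel_measurable lborel"
    proof (rule borel_measurable_scaleR)
      show "(\<lambda>z. indicator pspace z *\<^sub>R \<psi> z) \<in> borel_measurable lborel" using m2 by simp
    qed simp
    show "AE z in lborel. gdens z *\<^sub>R (indicator pspace z *\<^sub>R \<psi> z) = g z * gdens z"
      using AE_neq_0_lborel eq by eventually_elim (simp add: pspace_def mult.commute)
  qed simp
  finally show ?thesis .
qed

lemma smooth_on_const: "smooth_on S (\<lambda>_. c)"
proof -
  show ?thesis
  proof (coinduction arbitrary: c rule: smooth_on.coinduct)
    case smooth_on
    then show ?case by (auto simp: frechet_derivative_const)
  qed
qed

lemma smooth_prob_fs_measure: "smooth_prob (fs_measure :: (complex^'n::finite) measure)"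
  unfolding smooth_prob_def
proof (intro conjI)
  have "emeasure fs_measure (pspace :: (complex^'n) set) = (\<integral>\<^sup>+z. ennreal (gdens (z::complex^'n)) * indicator pspace z \<partial>lborel)"
    by (rule emeasure_fs_measure) (auto simp: cone_sets_def pspace_def[symmetric], auto simp: pspace_def)
  also have "\<dots> = (\<integral>\<^sup>+z. ennreal (gdens (z::complex^'n)) \<partial>lborel)"
    by (rule nn_integral_cong_AE) (use AE_neq_0_lborel in \<open>eventually_elim, simp add: pspace_def\<close>)
  also have "\<dots> = 1"
    by (subst nn_integral_eq_integral[OF integrable_gdens]) (auto simp: integral_gdens)
  finally show "prob_space (fs_measure :: (complex^'n) measure)" by (intro prob_spaceI) simp
  define m where "m = (\<integral>z. exp (- (norm (z :: complex^'n))\<^sup>2) \<partial>lborel)"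
  have m: "m > 0" unfolding m_def by (rule integral_exp_neg_norm_square_pos)
  define c where "c = pi ^ CARD('n) / m"
  have c: "c * gauss z = gdens z" for z :: "complex^'n"
    by (simp add: c_def gauss_def gdens_def m_def)
  have c0: "0 \<le> c" using m by (simp add: c_def)
  show "\<exists>\<rho>. smooth_on pspace \<rho> \<and> (\<forall>x\<in>pspace. 0 \<le> \<rho> x) \<and>
     (\<forall>x\<in>pspace. \<forall>c::complex. c \<noteq> 0 \<longrightarrow> \<rho> (c *s x) = \<rho> x) \<and>
     (\<forall>A\<in>cone_sets. emeasure fs_measure A = (\<integral>\<^sup>+ z. ennreal (\<rho> z * gauss (z::complex^'n)) * indicator A z \<partial>lborel))"
    by (intro exI[of _ "\<lambda>_. c"]) (use c0 in \<open>auto simp: smooth_on_const c emeasure_fs_measure\<close>)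
qed simp

section \<open>Rays, and push-forwards as fibre sums\<close>

lemma ray_eq_iff: "x \<in> ray y \<longleftrightarrow> (\<exists>c. c \<noteq> 0 \<and> x = c *s y)"
  by (auto simp: ray_def)

lemma ray_vsmult: assumes "c \<noteq> 0" shows "ray (c *s y) = ray y"
proof -
  have "x \<in> ray (c *s y) \<longleftrightarrow> x \<in> ray y" for x
  proof
    assume "x \<in> ray (c *s y)"
    then obtain a where "a \<noteq> 0" "x = a *s (c *s y)" by (auto simp: ray_eq_iff)
    then show "x \<in> ray y" unfolding ray_eq_iff using assms by (intro exI[of _ "a * c"]) simp
  next
    assume "x \<in> ray y"
    then obtain a where "a \<noteq> 0" "x = a *s y" by (auto simp: ray_eq_iff)
    then show "x \<in> ray (c *s y)" unfolding ray_eq_iff using assms by (intro exI[of _ "a / c"]) simp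
  qed
  then show ?thesis by blast
qed

lemma self_in_ray: "x \<in> ray x"
  unfolding ray_eq_iff by (intro exI[of _ 1]) simp

context homogeneous_map
begin

text \<open>Two preimages of the same vector on one ray differ by an \<open>e\<close>-th root of
  unity.\<close>

lemma card_fibre_ray:
  assumes "F x0 = y" "y \<noteq> 0"
  shows "card {x \<in> F -` {y}. ray x = ray x0} = e"
proof -
  have x0: "x0 \<noteq> 0" using assms by auto
  have "{x \<in> F -` {y}. ray x = ray x0} = (\<lambda>w. w *s x0) ` {w. w ^ e = 1}"
  proof
    show "(\<lambda>w. w *s x0) ` {w. w ^ e = 1} \<subseteq> {x \<in> F -` {y}. ray x = ray x0}"
    proof (rule image_subsetI)
      fix w :: complex assume "w \<in> {w. w ^ e = 1}"
      then have w: "w ^ e = 1" by simp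
      then have "w \<noteq> 0" using e_pos by (auto simp: power_0_left)
      then show "w *s x0 \<in> {x \<in> F -` {y}. ray x = ray x0}"
        using w assms(1) by (simp add: homogeneous ray_vsmult)
    qed
    show "{x \<in> F -` {y}. ray x = ray x0} \<subseteq> (\<lambda>w. w *s x0) ` {w. w ^ e = 1}"
    proof
      fix x assume "x \<in> {x \<in> F -` {y}. ray x = ray x0}"
      then have x: "ray x = ray x0" and y: "y = F x" by auto
      obtain w where w: "x = w *s x0" using self_in_ray[of x] x by (auto simp: ray_eq_iff)
      have "w ^ e *s y = y" using w assms(1) y homogeneous by metis
      moreover obtain i where "y $ i \<noteq> 0" using assms(2) by (auto simp: vec_eq_iff)
      ultimately have "w ^ e = 1" by (metis mult_cancel_right1 vector_smult_component)
      then show "x \<in> (\<lambda>w. w *s x0) ` {w. w ^ e = 1}" using w by blast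
    qed
  qed
  moreover have "inj_on (\<lambda>w. w *s x0) {w. w ^ e = 1}"
  proof (rule inj_onI)
    fix a b assume "a *s x0 = b *s x0"
    then have "(a - b) *s x0 = 0" by (simp add: vec_eq_iff left_diff_distrib)
    then show "a = b" using x0 by simp
  qed
  ultimately show ?thesis using card_roots_unity_eq[OF e_pos] by (simp add: card_image)
qed

text \<open>Grouping the lifted fibre by rays counts every point of the projective fibre
  \<open>e\<close> times. This links the push-forward, stated over rays, to the sums over lifts for
  which submean inequalities hold.\<close>

lemma push_fun_eq_fibre_sum:
  assumes fin: "finite (F -` {y})" and y: "y \<noteq> 0"
    and inv: "\<And>x c. x \<noteq> 0 \<Longrightarrow> c \<noteq> 0 \<Longrightarrow> \<phi> (c *s x) = \<phi> x"
  shows "real e * push_fun F \<phi> y = (\<Sum>x\<in>F -` {y}. \<phi> x)"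
proof -
  let ?X = "F -` {y}"
  have R: "{ray x | x. x \<in> pspace \<and> F x \<in> ray y} = ray ` ?X"
  proof
    show "ray ` ?X \<subseteq> {ray x | x. x \<in> pspace \<and> F x \<in> ray y}" using y by (auto simp: pspace_def self_in_ray)
    show "{ray x | x. x \<in> pspace \<and> F x \<in> ray y} \<subseteq> ray ` ?X"
    proof clarify
      fix x assume x: "x \<in> pspace" "F x \<in> ray y"
      then obtain c where c: "c \<noteq> 0" "F x = c *s y" by (auto simp: ray_eq_iff)
      obtain l where l: "l ^ e = inverse c" using complex_root_exists[OF e_pos] by blast
      then have "l \<noteq> 0" using c e_pos by (auto simp: power_0_left)
      then have "ray x = ray (l *s x)" "l *s x \<in> ?X" using l c by (auto simp: homogeneous ray_vsmult)
      then show "ray x \<in> ray ` ?X" by blast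
    qed
  qed
  have "(\<Sum>x\<in>?X. \<phi> x) = (\<Sum>P\<in>ray ` ?X. \<Sum>x\<in>{x \<in> ?X. ray x = P}. \<phi> x)"
    by (rule sum.image_gen[OF fin])
  also have "\<dots> = (\<Sum>P\<in>ray ` ?X. real e * \<phi> (SOME x. x \<in> P))"
  proof (rule sum.cong[OF refl])
    fix P assume "P \<in> ray ` ?X"
    then obtain x0 where x0: "x0 \<in> ?X" "P = ray x0" by blast
    have x00: "x0 \<noteq> 0" using x0(1) y by auto
    have val: "\<phi> x = \<phi> x0" if "x \<in> ray x0" for x using that inv[OF x00] by (auto simp: ray_eq_iff)
    have "(SOME x. x \<in> P) \<in> ray x0" unfolding x0(2) by (rule someI[of _ x0]) (rule self_in_ray)
    then have "\<phi> (SOME x. x \<in> P) = \<phi> x0" by (rule val)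
    moreover have "(\<Sum>x\<in>{x \<in> ?X. ray x = P}. \<phi> x) = (\<Sum>x\<in>{x \<in> ?X. ray x = ray x0}. \<phi> x0)"
      unfolding x0(2) by (intro sum.cong refl val) (use self_in_ray in auto)
    ultimately show "(\<Sum>x\<in>{x \<in> ?X. ray x = P}. \<phi> x) = real e * \<phi> (SOME x. x \<in> P)"
      using card_fibre_ray[of x0 y] x0 y by simp
  qed
  finally show ?thesis by (simp add: push_fun_def R sum_distrib_left)
qed

end

section \<open>Differences of plurisubharmonic functions\<close>

text \<open>Such \<open>u\<close> are the continuous potentials, on the lift, of positive closed
  (1,1)-currents on projective space in \<open>C\<close> times the hyperplane class.\<close>

definition homogeneous_psh :: "real \<Rightarrow> (complex^'n::finite \<Rightarrow> real) \<Rightarrow> bool" where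
  "homogeneous_psh C u \<longleftrightarrow> 0 \<le> C \<and> psh u \<and> (\<forall>x c. x \<noteq> 0 \<longrightarrow> c \<noteq> 0 \<longrightarrow> u (c *s x) = u x + C * ln (cmod c))"

definition psh_difference :: "(complex^'n::finite \<Rightarrow> real) \<Rightarrow> bool" where
  "psh_difference \<phi> \<longleftrightarrow> (\<exists>C u v. homogeneous_psh C u \<and> homogeneous_psh C v \<and> \<phi> = (\<lambda>x. u x - v x))"

lemma homogeneous_psh_add: "homogeneous_psh C u \<Longrightarrow> homogeneous_psh C' v \<Longrightarrow> homogeneous_psh (C + C') (\<lambda>x. u x + v x)"
  by (auto simp: homogeneous_psh_def psh_add distrib_right)

lemma homogeneous_psh_max: "homogeneous_psh C u \<Longrightarrow> homogeneous_psh C v \<Longrightarrow> homogeneous_psh C (\<lambda>x. max (u x) (v x))"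
  by (auto simp: homogeneous_psh_def psh_max)

lemma homogeneous_psh_const: "homogeneous_psh 0 (\<lambda>_. c)"
  by (simp add: homogeneous_psh_def psh_const)

lemma psh_difference_const: "psh_difference (\<lambda>_. c)"
  unfolding psh_difference_def
  by (intro exI[of _ 0] exI[of _ "\<lambda>_. c"] exI[of _ "\<lambda>_. 0"]) (simp add: homogeneous_psh_const)

lemma psh_difference_uminus:
  assumes "psh_difference \<phi>" shows "psh_difference (\<lambda>x. - \<phi> x)"
proof -
  obtain C u v where "homogeneous_psh C u" "homogeneous_psh C v" "\<phi> = (\<lambda>x. u x - v x)"
    using assms by (auto simp: psh_difference_def)
  then show ?thesis unfolding psh_difference_def by (intro exI[of _ C] exI[of _ v] exI[of _ u]) auto
qed

lemma psh_difference_add: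
  assumes "psh_difference \<phi>" "psh_difference \<psi>" shows "psh_difference (\<lambda>x. \<phi> x + \<psi> x)"
proof -
  obtain C u v where 1: "homogeneous_psh C u" "homogeneous_psh C v" "\<phi> = (\<lambda>x. u x - v x)"
    using assms by (auto simp: psh_difference_def)
  obtain C' u' v' where 2: "homogeneous_psh C' u'" "homogeneous_psh C' v'" "\<psi> = (\<lambda>x. u' x - v' x)"
    using assms by (auto simp: psh_difference_def)
  show ?thesis unfolding psh_difference_def
    by (intro exI[of _ "C + C'"] exI[of _ "\<lambda>x. u x + u' x"] exI[of _ "\<lambda>x. v x + v' x"])
      (use 1 2 in \<open>auto intro: homogeneous_psh_add\<close>)
qed

text \<open>Adding \<open>v + v'\<close> to both entries moves the maximum onto plurisubharmonic
  functions of common weight \<open>C + C'\<close>.\<close>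

lemma psh_difference_max:
  assumes "psh_difference \<phi>" "psh_difference \<psi>" shows "psh_difference (\<lambda>x. max (\<phi> x) (\<psi> x))"
proof -
  obtain C u v where 1: "homogeneous_psh C u" "homogeneous_psh C v" "\<phi> = (\<lambda>x. u x - v x)"
    using assms by (auto simp: psh_difference_def)
  obtain C' u' v' where 2: "homogeneous_psh C' u'" "homogeneous_psh C' v'" "\<psi> = (\<lambda>x. u' x - v' x)"
    using assms by (auto simp: psh_difference_def)
  have "homogeneous_psh (C + C') (\<lambda>x. max (u x + v' x) (v x + u' x))"
    by (intro homogeneous_psh_max homogeneous_psh_add 1 2)
  moreover have "homogeneous_psh (C + C') (\<lambda>x. v x + v' x)" by (intro homogeneous_psh_add 1 2)
  moreover have "(\<lambda>x. max (\<phi> x) (\<psi> x)) = (\<lambda>x. max (u x + v' x) (v x + u' x) - (v x + v' x))"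
    using 1(3) 2(3) by (auto simp: fun_eq_iff max_def)
  ultimately show ?thesis unfolding psh_difference_def by blast
qed

lemma psh_difference_min:
  assumes "psh_difference \<phi>" "psh_difference \<psi>" shows "psh_difference (\<lambda>x. min (\<phi> x) (\<psi> x))"
proof -
  have "(\<lambda>x. min (\<phi> x) (\<psi> x)) = (\<lambda>x. - max (- \<phi> x) (- \<psi> x))" by (auto simp: fun_eq_iff min_def max_def)
  then show ?thesis using assms by (simp add: psh_difference_uminus psh_difference_max)
qed

lemma psh_difference_of_nat_mult:
  assumes "psh_difference \<phi>" shows "psh_difference (\<lambda>x. real j * \<phi> x)"
proof (induction j)
  case (Suc j)
  have "(\<lambda>x. real (Suc j) * \<phi> x) = (\<lambda>x. \<phi> x + real j * \<phi> x)" by (simp add: algebra_simps)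
  then show ?case using psh_difference_add[OF assms Suc] by simp
qed (simp add: psh_difference_const)

lemma psh_difference_cont_Pk: "psh_difference \<phi> \<Longrightarrow> cont_Pk \<phi>"
  by (auto simp: psh_difference_def homogeneous_psh_def psh_def cont_Pk_def pspace_eq intro: continuous_on_diff)

lemma homogeneous_psh_ln_max:
  fixes a :: "complex^'n::finite"
  assumes "0 < s" shows "homogeneous_psh 1 (\<lambda>x. ln (max (cmod (cip x a)) (s * norm x)))"
  unfolding homogeneous_psh_def
proof (intro conjI allI impI psh_ln_max assms)
  fix x :: "complex^'n" and c :: complex assume x: "x \<noteq> 0" "c \<noteq> 0"
  have "max (cmod (cip (c *s x) a)) (s * norm (c *s x)) = cmod c * max (cmod (cip x a)) (s * norm x)"
    by (simp add: cip_vsmult norm_vsmult norm_mult max_mult_distrib_left mult_ac)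
  moreover have "0 < max (cmod (cip x a)) (s * norm x)" using assms x by (simp add: less_max_iff_disj)
  ultimately show "ln (max (cmod (cip (c *s x) a)) (s * norm (c *s x))) = ln (max (cmod (cip x a)) (s * norm x)) + 1 * ln (cmod c)"
    using x by (simp add: ln_mult)
qed simp

section \<open>Generating the invariant Borel sets by differences of plurisubharmonic
  functions\<close>

text \<open>Intersections of these sets correspond to minima, so they form a \<pi>-system; and their
  indicators are limits of \<open>min 1 (j * max \<phi> 0)\<close>, which are again differences of
  plurisubharmonic functions.\<close>

definition positive_sets :: "(complex^'n::finite) set set" where
  "positive_sets = {{x \<in> pspace. 0 < \<phi> x} | \<phi>. psh_difference \<phi>}"

text \<open>For a unit vector \<open>a\<close> and \<open>s < 1\<close> this is the Fubini-Study
  ball about the ray of \<open>a\<close> whose angular radius has cosine \<open>s\<close>.\<close>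

lemma cap_positive_sets:
  assumes "0 < s" shows "{x \<in> pspace. s * norm x < cmod (cip x a)} \<in> positive_sets"
proof -
  \<comment> \<open>With the vector 0, the second potential reduces to
    \<open>ln (s * norm x)\<close>, so \<phi> is positive exactly where the linear form wins the
    maximum.\<close>
  define \<phi> where "\<phi> x = ln (max (cmod (cip x a)) (s * norm x)) - ln (max (cmod (cip x 0)) (s * norm x))" for x
  have "psh_difference \<phi>"
    unfolding psh_difference_def \<phi>_def[abs_def] using homogeneous_psh_ln_max[OF assms] by blast
  moreover have "0 < \<phi> x \<longleftrightarrow> s * norm x < cmod (cip x a)" if "x \<in> pspace" for x
  proof -
    have "0 < s * norm x" using assms that by (simp add: pspace_def)
    moreover have "cip x 0 = 0" by (simp add: cip_def)
    ultimately have "0 < \<phi> x \<longleftrightarrow> s * norm x < max (cmod (cip x a)) (s * norm x)"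
      by (simp add: \<phi>_def)
    then show ?thesis by (auto simp: less_max_iff_disj)
  qed
  ultimately show ?thesis unfolding positive_sets_def by blast
qed

lemma Re_cip: "Re (cip x a) = x \<bullet> a"
  by (simp add: cip_def inner_vec_def inner_complex_def)

text \<open>Caps form a base of the topology of projective space, and the Lindelof property reduces
  a union of caps to a countable one.\<close>

lemma open_cone_in_sigma:
  assumes "open S" and "S \<in> cone_sets" shows "S \<in> sigma_sets pspace positive_sets"
proof -
  define \<F> where "\<F> = {T. \<exists>a s. T = {x \<in> pspace. s * norm x < cmod (cip x a)} \<and> 0 < s \<and> T \<subseteq> S}"
  have "open T" if TF: "T \<in> \<F>" for T
  proof -
    obtain a s where "T = {x \<in> pspace. s * norm x < cmod (cip x a)}" using TF unfolding \<F>_def by blast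
    then have T: "T = pspace \<inter> {x. s * norm x < cmod (cip x a)}" by auto
    show ?thesis unfolding T by (intro open_Int open_pspace open_Collect_less continuous_intros)
  qed
  then obtain \<G> where \<G>: "\<G> \<subseteq> \<F>" "countable \<G>" "\<Union>\<G> = \<Union>\<F>" by (rule Lindelof)
  have "x \<in> \<Union>\<F>" if x: "x \<in> S" for x
  proof -
    have x0: "x \<noteq> 0" using x assms(2) by (auto simp: cone_sets_def pspace_def)
    define a where "a = of_real (1 / norm x) *s x"
    have na: "norm a = 1" unfolding a_def by (rule norm_normalize_eq_1[OF x0])
    have "a \<in> S" unfolding a_def using cone_sets_vsmult_iff[OF assms(2), of "of_real (1 / norm x)" x] x x0 by simp
    then obtain e where e: "e > 0" "ball a e \<subseteq> S" using assms(1) open_contains_ball by blast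
    \<comment> \<open>For unit vectors \<open>|y - a|^2 = 2 - 2 (y \<bullet> a)\<close>, so an inner
      product above \<open>1 - e\<^sup>2 / 2\<close> puts \<open>y\<close> in the ball of radius
      \<open>e\<close>; the bound \<open>1 / 2\<close> keeps \<open>s\<close> positive.\<close>
    define s where "s = max (1 - e\<^sup>2 / 2) (1 / 2)"
    have s: "0 < s" "s < 1" "1 - e\<^sup>2 / 2 \<le> s" using e by (auto simp: s_def)
    let ?T = "{y \<in> pspace. s * norm y < cmod (cip y a)}"
    have "?T \<subseteq> S"
    proof
      fix y assume "y \<in> ?T"
      then have y: "y \<noteq> 0" "s * norm y < cmod (cip y a)" by (auto simp: pspace_def)
      define \<rho> where "\<rho> = cip y a"
      have "0 \<le> s * norm y" using s by simp
      then have "0 < cmod \<rho>" using y(2) unfolding \<rho>_def by linarith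
      then have \<rho>0: "\<rho> \<noteq> 0" by simp
      \<comment> \<open>Normalizes \<open>y\<close> to length 1 and turns its phase so that its
        Hermitian product with \<open>a\<close> becomes positive, turning the bound on the modulus
        into one on the real inner product.\<close>
      define c where "c = cnj \<rho> / of_real (cmod \<rho> * norm y)"
      have c0: "c \<noteq> 0" using \<rho>0 y by (simp add: c_def)
      have nc: "cmod c = 1 / norm y" using \<rho>0 y by (simp add: c_def norm_divide norm_mult)
      have n1: "norm (c *s y) = 1" using y by (simp add: norm_vsmult nc)
      have "cip (c *s y) a = cnj \<rho> * \<rho> / of_real (cmod \<rho> * norm y)" by (simp add: cip_vsmult c_def \<rho>_def)
      also have "cnj \<rho> * \<rho> = of_real ((cmod \<rho>)\<^sup>2)" by (metis complex_norm_square mult.commute)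
      also have "of_real ((cmod \<rho>)\<^sup>2) / of_real (cmod \<rho> * norm y) = complex_of_real (cmod \<rho> / norm y)"
        using \<rho>0 by (simp add: power2_eq_square)
      finally have "(c *s y) \<bullet> a = cmod \<rho> / norm y" by (simp flip: Re_cip)
      moreover have "s < cmod \<rho> / norm y" using y by (simp add: \<rho>_def pos_less_divide_eq)
      moreover have "(norm (c *s y - a))\<^sup>2 = (norm (c *s y))\<^sup>2 + (norm a)\<^sup>2 - 2 * ((c *s y) \<bullet> a)"
        by (simp add: power2_norm_eq_inner inner_diff_left inner_diff_right inner_commute)
      ultimately have "(norm (c *s y - a))\<^sup>2 < e\<^sup>2" using s n1 na by simp
      then have "norm (c *s y - a) < e" using e by (intro power_less_imp_less_base[of _ 2 e]) auto
      then have "c *s y \<in> S" using e by (auto simp: dist_norm norm_minus_commute)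
      then show "y \<in> S" using cone_sets_vsmult_iff[OF assms(2) c0] by simp
    qed
    moreover have "x \<in> ?T"
    proof -
      have "cip x a = of_real (norm x)"
        unfolding a_def cip_vsmult_right cip_self using x0 by (simp add: power2_eq_square)
      then show ?thesis using s x0 by (simp add: pspace_def)
    qed
    ultimately show ?thesis using s unfolding \<F>_def by blast
  qed
  then have "S = \<Union>\<G>" using \<G>(3) by (auto simp: \<F>_def)
  moreover have "\<Union>\<G> \<in> sigma_sets pspace positive_sets"
    by (rule sigma_sets_UNION[OF \<G>(2)]) (use \<G>(1) cap_positive_sets in \<open>auto simp: \<F>_def intro!: sigma_sets.Basic\<close>)
  ultimately show ?thesis by simp
qed

text \<open>The scaled columns of the projection matrix \<open>x x\<^sup>* / |x|\<^sup>2\<close> are scale-invariant continuous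
  sections, so invariant Borel sets are pulled back from Borel sets.\<close>

lemma cone_sets_subset_sigma: "cone_sets \<subseteq> sigma_sets pspace positive_sets"
proof
  fix A :: "(complex^'n) set" assume A: "A \<in> cone_sets"
  let ?M = "sigma pspace positive_sets :: (complex^'n) measure"
  have sub: "positive_sets \<subseteq> Pow (pspace :: (complex^'n) set)" by (auto simp: positive_sets_def)
  have setsM: "sets ?M = sigma_sets pspace positive_sets" "space ?M = pspace" using sub by simp_all
  define p where "p l x = (cnj (x $ l) / of_real ((norm x)\<^sup>2)) *s x" for l and x :: "complex^'n"
  have contp: "continuous_on pspace (p l)" for l
    unfolding p_def by (intro continuous_intros) (auto simp: pspace_def)
  have pinv: "p l (c *s x) = p l x" if "c \<noteq> 0" for l c x
  proof -
    have "cnj (c * x $ l) / of_real ((cmod c * norm x)\<^sup>2) * c = cnj (x $ l) / of_real ((norm x)\<^sup>2)"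
    proof -
      have "cnj (c * x $ l) / of_real ((cmod c * norm x)\<^sup>2) * c = (c * cnj c) * cnj (x $ l) / (of_real ((cmod c)\<^sup>2) * of_real ((norm x)\<^sup>2))"
        by (simp add: power_mult_distrib mult_ac)
      also have "\<dots> = cnj (x $ l) / of_real ((norm x)\<^sup>2)"
        unfolding complex_norm_square[symmetric] using that by simp
      finally show ?thesis .
    qed
    then show ?thesis unfolding p_def vector_smult_component norm_vsmult by (simp add: vector_smult_assoc)
  qed
  have meas: "p l \<in> borel_measurable ?M" for l
  proof (rule borel_measurableI)
    fix S :: "(complex^'n) set" assume S: "open S"
    have "open (p l -` S \<inter> pspace)"
      using continuous_open_preimage[OF contp open_pspace S] by (simp add: Int_commute)
    moreover from this have "p l -` S \<inter> pspace \<in> cone_sets"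
      by (intro cone_setsI) (auto simp: pinv pspace_def)
    ultimately show "p l -` S \<inter> space ?M \<in> sets ?M" using open_cone_in_sigma setsM by simp
  qed
  \<comment> \<open>On the chart where \<open>x $ l\<close> is nonzero, \<open>p l x\<close> is a
    nonzero multiple of \<open>x\<close>, so membership in the invariant set \<open>A\<close> may be
    tested on \<open>p l x\<close>; finitely many charts cover the space.\<close>
  have "A = (\<Union>l. p l -` A \<inter> pspace)"
  proof
    show "A \<subseteq> (\<Union>l. p l -` A \<inter> pspace)"
    proof
      fix x assume x: "x \<in> A"
      then have x0: "x \<noteq> 0" using A by (auto simp: cone_sets_def pspace_def)
      then obtain l where "x $ l \<noteq> 0" by (auto simp: vec_eq_iff)
      then have "p l x \<in> A"
        unfolding p_def using cone_sets_vsmult_iff[OF A] x x0 by (subst cone_sets_vsmult_iff[OF A]) auto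
      then show "x \<in> (\<Union>l. p l -` A \<inter> pspace)" using x0 by (auto simp: pspace_def)
    qed
    show "(\<Union>l. p l -` A \<inter> pspace) \<subseteq> A"
    proof clarify
      fix l x assume x: "p l x \<in> A" "x \<in> pspace"
      have "p l x \<noteq> 0" using x(1) A by (auto simp: cone_sets_def pspace_def)
      then have "cnj (x $ l) / of_real ((norm x)\<^sup>2) \<noteq> 0" unfolding p_def by simp
      then show "x \<in> A" using x(1) cone_sets_vsmult_iff[OF A] unfolding p_def by blast
    qed
  qed
  moreover have "p l -` A \<inter> pspace \<in> sets ?M" for l
    using measurable_sets[OF meas, of A l] A setsM(2) by (simp add: cone_sets_def)
  then have "(\<Union>l. p l -` A \<inter> pspace) \<in> sets ?M" by (intro sets.finite_UN) auto
  ultimately show "A \<in> sigma_sets pspace positive_sets" using setsM by simp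
qed

lemma Int_stable_positive_sets: "Int_stable (positive_sets :: (complex^'n::finite) set set)"
proof (rule Int_stableI)
  fix A B :: "(complex^'n) set" assume "A \<in> positive_sets" "B \<in> positive_sets"
  then obtain \<phi> \<psi> where \<phi>: "psh_difference \<phi>" "A = {x \<in> pspace. 0 < \<phi> x}"
    and \<psi>: "psh_difference \<psi>" "B = {x \<in> pspace. 0 < \<psi> x}"
    unfolding positive_sets_def by blast
  have "A \<inter> B = {x \<in> pspace. 0 < min (\<phi> x) (\<psi> x)}" unfolding \<phi>(2) \<psi>(2) by auto
  with psh_difference_min[OF \<phi>(1) \<psi>(1)] show "A \<inter> B \<in> positive_sets"
    unfolding positive_sets_def by (intro CollectI exI[of _ "\<lambda>x. min (\<phi> x) (\<psi> x)"] conjI)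
qed

lemma positive_sets_subset: "positive_sets \<subseteq> cone_sets"
proof
  fix A :: "(complex^'n) set" assume "A \<in> positive_sets"
  then obtain \<phi> where \<phi>: "cont_Pk \<phi>" "A = {x \<in> pspace. 0 < \<phi> x}"
    unfolding positive_sets_def using psh_difference_cont_Pk by blast
  have "\<phi> \<in> borel_measurable cone_space" by (rule cont_Pk_measurable[OF \<phi>(1)]) simp
  from measurable_sets[OF this, of "{0<..}"] show "A \<in> cone_sets"
    by (simp add: \<phi>(2) vimage_def Int_def conj_commute)
qed

lemma tendsto_min_of_nat_mult:
  fixes t :: real shows "(\<lambda>j. min 1 (real j * max t 0)) \<longlonglongrightarrow> (if 0 < t then 1 else 0)"
proof (cases "0 < t")
  case True
  obtain n where n: "1 < real n * t" using reals_Archimedean3[OF True] by blast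
  have "min 1 (real j * max t 0) = 1" if "j \<ge> n" for j
  proof -
    have "real n * t \<le> real j * t" using that True by (intro mult_right_mono) auto
    then have "1 \<le> real j * t" using n by linarith
    then have "1 \<le> real j * max t 0" using True by simp
    then show ?thesis by (rule min_absorb1)
  qed
  then have "\<forall>\<^sub>F j in sequentially. min 1 (real j * max t 0) = 1" unfolding eventually_sequentially by blast
  then show ?thesis using True by (simp add: tendsto_eventually)
qed simp

text \<open>Induction over the \<pi>-system \<open>positive_sets\<close>; finiteness of the measure
  reduces disjoint countable unions to finite ones. The approximation is needed because convergence
  to \<mu> is known for continuous functions, whereas asymptotic sets are merely measurable.\<close>

lemma cone_set_L1_approx:
  fixes M :: "(complex^'n::finite) measure"
  assumes M: "sets M = cone_sets" "finite_measure M" and A: "A \<in> cone_sets" and "0 < \<delta>"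
  shows "\<exists>\<eta>. cont_Pk \<eta> \<and> (\<forall>x. 0 \<le> \<eta> x \<and> \<eta> x \<le> 1) \<and> (\<integral>x. \<bar>indicator A x - \<eta> x\<bar> \<partial>M) \<le> \<delta>"
proof -
  interpret finite_measure M by fact
  have space: "space M = pspace" by (rule space_eq_pspace[OF M(1)])
  \<comment> \<open>The tolerance is quantified inside the property, so that the inductive cases may
    call it with \<open>\<delta> / 2\<close>.\<close>
  define P where "P A \<longleftrightarrow> A \<in> cone_sets \<and> (\<forall>\<delta>>0. \<exists>\<eta>. cont_Pk \<eta> \<and> (\<forall>x. 0 \<le> \<eta> x \<and> \<eta> x \<le> 1) \<and> (\<integral>x. \<bar>indicator A x - \<eta> x\<bar> \<partial>M) \<le> \<delta>)" for A
  have intg: "integrable M (\<lambda>x. \<bar>indicator A x - \<eta> x\<bar> :: real)" if "A \<in> cone_sets" "cont_Pk \<eta>" for A \<eta>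
    using that M cont_Pk_integrable[OF that(2) M]
    by (intro integrable_abs Bochner_Integration.integrable_diff integrable_real_indicator) (auto simp: emeasure_eq_measure)
  have P_Un: "P (A \<union> B)" if PAB: "P A" "P B" for A B
    unfolding P_def
  proof (intro conjI allI impI)
    have AB: "A \<in> cone_sets" "B \<in> cone_sets" using that by (auto simp: P_def)
    then show ABc: "A \<union> B \<in> cone_sets" using sets.Un[of A M B] M by simp
    fix \<delta> :: real assume "0 < \<delta>"
    then have "0 < \<delta> / 2" by simp
    obtain a where a: "cont_Pk a" "\<forall>x. 0 \<le> a x \<and> a x \<le> 1" "(\<integral>x. \<bar>indicator A x - a x\<bar> \<partial>M) \<le> \<delta> / 2"
      using PAB(1) \<open>0 < \<delta> / 2\<close> unfolding P_def by blast
    obtain b where b: "cont_Pk b" "\<forall>x. 0 \<le> b x \<and> b x \<le> 1" "(\<integral>x. \<bar>indicator B x - b x\<bar> \<partial>M) \<le> \<delta> / 2"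
      using PAB(2) \<open>0 < \<delta> / 2\<close> unfolding P_def by blast
    have cm: "cont_Pk (\<lambda>x. max (a x) (b x))" using a(1) b(1) by (auto simp: cont_Pk_def intro: continuous_on_max)
    have "(\<integral>x. \<bar>indicator (A \<union> B) x - max (a x) (b x)\<bar> \<partial>M) \<le> (\<integral>x. \<bar>indicator A x - a x\<bar> + \<bar>indicator B x - b x\<bar> \<partial>M)"
    proof (intro integral_mono intg ABc cm Bochner_Integration.integrable_add AB a(1) b(1))
      fix x
      show "\<bar>indicator (A \<union> B) x - max (a x) (b x)\<bar> \<le> \<bar>indicator A x - a x\<bar> + \<bar>indicator B x - b x\<bar>"
        using a(2)[rule_format, of x] b(2)[rule_format, of x] by (auto simp: indicator_def max_def)
    qed
    also have "\<dots> \<le> \<delta>"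
      using a(3) b(3) by (subst Bochner_Integration.integral_add) (auto intro!: intg AB a(1) b(1))
    finally show "\<exists>\<eta>. cont_Pk \<eta> \<and> (\<forall>x. 0 \<le> \<eta> x \<and> \<eta> x \<le> 1) \<and> (\<integral>x. \<bar>indicator (A \<union> B) x - \<eta> x\<bar> \<partial>M) \<le> \<delta>"
      using cm a(2) b(2) by (intro exI[of _ "\<lambda>x. max (a x) (b x)"]) (auto simp: le_max_iff_disj)
  qed
  have P_empty: "P {}"
    unfolding P_def by (intro conjI allI impI exI[of _ "\<lambda>_. 0"]) (auto simp: cone_sets_def cont_Pk_const)
  have sub: "positive_sets \<subseteq> Pow (pspace :: (complex^'n) set)" by (auto simp: positive_sets_def)
  have "A \<in> sigma_sets pspace positive_sets" using A cone_sets_subset_sigma by blast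
  with Int_stable_positive_sets sub have "P A"
  proof (induction rule: sigma_sets_induct_disjoint)
    case (basic A)
    then obtain \<phi> where \<phi>: "psh_difference \<phi>" "A = {x \<in> pspace. 0 < \<phi> x}" unfolding positive_sets_def by blast
    have c: "cont_Pk \<phi>" by (rule psh_difference_cont_Pk[OF \<phi>(1)])
    have Ac: "A \<in> cone_sets" using basic positive_sets_subset by blast
    define \<eta> where "\<eta> j x = min 1 (real j * max (\<phi> x) 0)" for j x
    have cj: "cont_Pk (\<eta> j)" for j
      using c unfolding \<eta>_def cont_Pk_def by (auto intro!: continuous_on_min continuous_on_max continuous_intros)
    have "(\<lambda>j. \<integral>x. \<bar>indicator A x - \<eta> j x\<bar> \<partial>M) \<longlonglongrightarrow> (\<integral>x. 0 \<partial>M)"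
    proof (rule integral_dominated_convergence[where w = "\<lambda>_. 1"])
      show "(\<lambda>x. \<bar>indicator A x - \<eta> j x\<bar>) \<in> borel_measurable M" for j
        using intg[OF Ac cj] by auto
      show "AE x in M. (\<lambda>j. \<bar>indicator A x - \<eta> j x\<bar>) \<longlonglongrightarrow> 0"
      proof (rule AE_I2)
        fix x assume "x \<in> space M"
        then have ind: "indicator A x = (if 0 < \<phi> x then 1 else (0::real))" by (simp add: space \<phi>(2))
        have "(\<lambda>j. \<bar>(if 0 < \<phi> x then 1 else 0) - \<eta> j x\<bar>) \<longlonglongrightarrow> \<bar>(if 0 < \<phi> x then 1 else 0) - (if 0 < \<phi> x then 1 else 0)\<bar>"
          unfolding \<eta>_def by (intro tendsto_rabs tendsto_diff tendsto_const tendsto_min_of_nat_mult)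
        then show "(\<lambda>j. \<bar>indicator A x - \<eta> j x\<bar>) \<longlonglongrightarrow> 0" unfolding ind by simp
      qed
      show "AE x in M. norm \<bar>indicator A x - \<eta> j x\<bar> \<le> 1" for j
        by (rule AE_I2) (auto simp: indicator_def \<eta>_def)
    qed auto
    then have lim: "(\<lambda>j. \<integral>x. \<bar>indicator A x - \<eta> j x\<bar> \<partial>M) \<longlonglongrightarrow> 0" by simp
    show ?case unfolding P_def
    proof (intro conjI allI impI Ac)
      fix \<delta> :: real assume "0 < \<delta>"
      then obtain j where "(\<integral>x. \<bar>indicator A x - \<eta> j x\<bar> \<partial>M) < \<delta>"
        using order_tendstoD(2)[OF lim] by (force simp: eventually_sequentially)
      then show "\<exists>\<eta>. cont_Pk \<eta> \<and> (\<forall>x. 0 \<le> \<eta> x \<and> \<eta> x \<le> 1) \<and> (\<integral>x. \<bar>indicator A x - \<eta> x\<bar> \<partial>M) \<le> \<delta>"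
        using cj by (intro exI[of _ "\<eta> j"]) (auto simp: \<eta>_def)
    qed
  next
    case empty
    show ?case by (rule P_empty)
  next
    case (compl A)
    have Ac: "pspace - A \<in> cone_sets" using compl sets.compl_sets[of A M] by (simp add: P_def M(1) space)
    show ?case unfolding P_def
    proof (intro conjI allI impI Ac)
      fix \<delta> :: real assume "0 < \<delta>"
      then obtain a where a: "cont_Pk a" "\<forall>x. 0 \<le> a x \<and> a x \<le> 1" "(\<integral>x. \<bar>indicator A x - a x\<bar> \<partial>M) \<le> \<delta>"
        using compl unfolding P_def by blast
      have "(\<integral>x. \<bar>indicator (pspace - A) x - (1 - a x)\<bar> \<partial>M) = (\<integral>x. \<bar>indicator A x - a x\<bar> \<partial>M)"
        by (intro Bochner_Integration.integral_cong) (auto simp: space indicator_def)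
      moreover have "cont_Pk (\<lambda>x. 1 - a x)" using a(1) by (auto simp: cont_Pk_def intro: continuous_intros)
      ultimately show "\<exists>\<eta>. cont_Pk \<eta> \<and> (\<forall>x. 0 \<le> \<eta> x \<and> \<eta> x \<le> 1) \<and> (\<integral>x. \<bar>indicator (pspace - A) x - \<eta> x\<bar> \<partial>M) \<le> \<delta>"
        using a by (intro exI[of _ "\<lambda>x. 1 - a x"]) auto
    qed
  next
    case (union B)
    then have PB: "P (B i)" for i by blast
    have fin: "P (\<Union>i<n. B i)" for n
      by (induction n) (use P_empty P_Un[OF PB] in \<open>auto simp: lessThan_Suc\<close>)
    define U where "U = (\<Union>i. B i)"
    have Bm: "B i \<in> sets M" for i using PB M by (simp add: P_def)
    then have Um: "U \<in> sets M" unfolding U_def by blast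
    have UnM: "(\<Union>i<n. B i) \<in> sets M" for n using Bm by blast
    have "(\<lambda>n. measure M (\<Union>i<n. B i)) \<longlonglongrightarrow> measure M (\<Union>n. \<Union>i<n. B i)"
      by (rule finite_Lim_measure_incseq) (use UnM in \<open>auto simp: incseq_def intro: less_le_trans\<close>)
    moreover have "(\<Union>n. \<Union>i<n. B i) = U" unfolding U_def by blast
    ultimately have lim: "(\<lambda>n. measure M (\<Union>i<n. B i)) \<longlonglongrightarrow> measure M U" by simp
    show ?case unfolding P_def U_def[symmetric]
    proof (intro conjI allI impI)
      show Uc: "U \<in> cone_sets" using Um M by simp
      fix \<delta> :: real assume "0 < \<delta>"
      then have "0 < \<delta> / 2" by simp
      then have "measure M U - \<delta> / 2 < measure M U" by simp
      then obtain n where n: "measure M U - \<delta> / 2 < measure M (\<Union>i<n. B i)"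
        using order_tendstoD(1)[OF lim] by (force simp: eventually_sequentially)
      let ?V = "\<Union>i<n. B i"
      obtain a where a: "cont_Pk a" "\<forall>x. 0 \<le> a x \<and> a x \<le> 1" "(\<integral>x. \<bar>indicator ?V x - a x\<bar> \<partial>M) \<le> \<delta> / 2"
        using fin[of n] \<open>0 < \<delta> / 2\<close> unfolding P_def by blast
      have VU: "?V \<subseteq> U" unfolding U_def by blast
      have Vc: "?V \<in> cone_sets" using UnM[of n] M by simp
      have D: "U - ?V \<in> sets M" using Um UnM[of n] by blast
      have intD: "integrable M (indicator (U - ?V) :: _ \<Rightarrow> real)"
        using D by (intro integrable_real_indicator) (auto simp: emeasure_eq_measure)
      have "(\<integral>x. \<bar>indicator U x - a x\<bar> \<partial>M) \<le> (\<integral>x. \<bar>indicator ?V x - a x\<bar> + indicator (U - ?V) x \<partial>M)"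
        by (intro integral_mono intg Uc a(1) Bochner_Integration.integrable_add Vc intD)
          (use VU a(2) in \<open>auto simp: indicator_def abs_if\<close>)
      also have "\<dots> = (\<integral>x. \<bar>indicator ?V x - a x\<bar> \<partial>M) + measure M (U - ?V)"
        using D by (subst Bochner_Integration.integral_add) (auto intro!: intg Vc a(1) intD)
      also have "measure M (U - ?V) = measure M U - measure M ?V"
        by (rule finite_measure_Diff[OF Um UnM VU])
      finally have "(\<integral>x. \<bar>indicator U x - a x\<bar> \<partial>M) \<le> \<delta>" using n a(3) by linarith
      then show "\<exists>\<eta>. cont_Pk \<eta> \<and> (\<forall>x. 0 \<le> \<eta> x \<and> \<eta> x \<le> 1) \<and> (\<integral>x. \<bar>indicator U x - \<eta> x\<bar> \<partial>M) \<le> \<delta>"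
        using a by blast
    qed
  qed
  then show ?thesis using \<open>0 < \<delta>\<close> unfolding P_def by blast
qed

section \<open>Exactness\<close>

lemma (in nondegenerate_map) AE_reg: "AE z in lborel. z \<in> reg"
proof -
  obtain q2 Q where Q: "polynomial q2 Q" "\<exists>y. Q y \<noteq> 0" "\<And>y. Q y \<noteq> 0 \<Longrightarrow> y \<in> reg"
    using critical_value_polynomial by metis
  obtain a where "Q a \<noteq> 0" using Q(2) by blast
  then have "{x. Q x = 0} \<in> null_sets lborel" by (rule null_set_polynomial[OF Q(1)])
  then have "AE x in lborel. x \<notin> {x. Q x = 0}" by (rule AE_not_in)
  then show ?thesis by eventually_elim (use Q(3) in auto)
qed

lemma (in nondegenerate_map) reg_nonempty: "reg \<noteq> {}"
  using critical_value_polynomial by blast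

text \<open>The factor \<open>1 / e\<close> undoes the multiplicity of the lifted fibre. The
  integrability hypothesis supplies measurability of the push-forward for the invariant
  sigma-algebra.\<close>

lemma (in nondegenerate_map) integral_push_fun:
  assumes \<phi>: "cont_Pk \<phi>" and int: "integrable fs_measure (push_fun F \<phi>)"
  shows "(\<integral>y. push_fun F \<phi> y \<partial>fs_measure) = (\<integral>z. fibre_sum_reg \<phi> z * gdens z \<partial>lborel) / e"
proof -
  have cont: "continuous_on (- {0}) \<phi>" using \<phi> by (simp add: cont_Pk_def pspace_eq)
  have m [measurable]: "fibre_sum_reg \<phi> \<in> borel_measurable borel" by (rule borel_measurable_fibre_sum_reg[OF cont])
  have "(\<integral>y. push_fun F \<phi> y \<partial>fs_measure) = (\<integral>z. (fibre_sum_reg \<phi> z / e) * gdens z \<partial>lborel)"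
  proof (rule integral_fs_measure)
    show "push_fun F \<phi> \<in> borel_measurable fs_measure" using int by simp
    show "AE z in lborel. z \<noteq> 0 \<longrightarrow> push_fun F \<phi> z = fibre_sum_reg \<phi> z / e"
      using AE_reg
    proof eventually_elim
      case (elim z)
      have "real e * push_fun F \<phi> z = fibre_sum \<phi> z"
        unfolding fibre_sum_def
        by (rule push_fun_eq_fibre_sum[OF finite_fibre[OF elim]])
          (use elim cont_Pk_vsmult[OF \<phi>] in \<open>auto simp: reg_def\<close>)
      then show ?case using e_pos elim by (simp add: fibre_sum_reg_def field_simps)
    qed
  qed simp
  then show ?thesis by simp
qed

lemma (in nondegenerate_map) integrable_fibre_sum_reg:
  assumes \<phi>: "cont_Pk \<phi>" shows "integrable lborel (\<lambda>z. fibre_sum_reg \<phi> z * gdens z)"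
proof -
  have cont: "continuous_on (- {0}) \<phi>" using \<phi> by (simp add: cont_Pk_def pspace_eq)
  obtain M where M: "0 \<le> M" "\<And>x. x \<noteq> 0 \<Longrightarrow> \<bar>\<phi> x\<bar> \<le> M" using cont_Pk_bounded[OF \<phi>] by blast
  obtain z0 where z0: "z0 \<in> reg" using reg_nonempty by blast
  have "integrable lborel (\<lambda>z. fibre_sum_reg \<phi> z * gdens (z - 0))"
    by (rule integrable_growth_gdens[of _ "real (card (F -` {z0})) * M" 0])
      (use borel_measurable_fibre_sum_reg[OF cont] abs_fibre_sum_reg_le[OF M(2,1) z0] in auto)
  then show ?thesis by simp
qed

lemma push_fun_add: "push_fun G (\<lambda>x. \<phi> x + \<psi> x) y = push_fun G \<phi> y + push_fun G \<psi> y"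
  by (simp add: push_fun_def sum.distrib)

lemma norm_gdens_moment:
  obtains m1 where "\<And>y::complex^'n::finite. norm y \<le> 1 \<Longrightarrow> (\<integral>z. norm z * gdens (z - y) \<partial>lborel) \<le> m1"
proof -
  define m where "m = (\<integral>z. exp (- (norm (z :: complex^'n))\<^sup>2) \<partial>lborel)"
  have m: "m > 0" unfolding m_def by (rule integral_exp_neg_norm_square_pos)
  let ?h = "\<lambda>z::complex^'n. exp 1 / m * ((1 + norm z) ^ 1 * exp (- (1/2 * (norm z)\<^sup>2)))"
  have int: "integrable lborel ?h"
    by (intro integrable_mult_right integrable_power_mult_gaussian) simp
  show ?thesis
  proof (rule that[of "\<integral>z. ?h z \<partial>lborel"])
    fix y :: "complex^'n" assume y: "norm y \<le> 1"
    show "(\<integral>z. norm z * gdens (z - y) \<partial>lborel) \<le> (\<integral>z. ?h z \<partial>lborel)"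
    proof (rule integral_mono[OF _ int])
      show "integrable lborel (\<lambda>z. norm z * gdens (z - y))" by (rule integrable_growth_gdens[of _ 1 1]) auto
      fix z :: "complex^'n"
      have "(norm y)\<^sup>2 \<le> 1" using y by (simp add: power_le_one)
      then have "exp (- (norm (z - y))\<^sup>2) \<le> exp 1 * exp (- (1/2 * (norm z)\<^sup>2))"
        by (intro order.trans[OF gaussian_shift_le] mult_right_mono) auto
      then have "gdens (z - y) \<le> exp 1 * exp (- (1/2 * (norm z)\<^sup>2)) / m"
        unfolding gdens_def m_def[symmetric] using m by (intro divide_right_mono) auto
      then have "norm z * gdens (z - y) \<le> (1 + norm z) * (exp 1 * exp (- (1/2 * (norm z)\<^sup>2)) / m)"
        by (intro mult_mono) auto
      then show "norm z * gdens (z - y) \<le> ?h z" by (simp add: mult_ac)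
    qed
  qed
qed

section \<open>The sequential system: nondegeneracy and number of preimages\<close>

locale sequential_system =
  fixes d :: nat and f :: "nat \<Rightarrow> 'n::finite \<Rightarrow> ('n \<Rightarrow> nat) \<Rightarrow> complex" and \<mu> :: "(complex^'n) measure"
  assumes card_ge_2: "CARD('n) \<ge> 2" and degree_ge_2: "d \<ge> 2" and holo: "\<And>j. holo d (f j)"
    and condA: "liminf (\<lambda>n. ereal ((1 / real n) * (\<Sum>j<n. ln (dist_M d (f j))))) > - \<infinity>"
    and mu_prob: "prob_space \<mu>" and mu_sets: "sets \<mu> = cone_sets"
    and mu_limit: "\<And>\<nu> \<phi>. smooth_prob \<nu> \<Longrightarrow> cont_Pk \<phi> \<Longrightarrow>
        (\<lambda>n. (\<integral>y. push_fun (Flift d f n) \<phi> y \<partial>\<nu>) / real d ^ (n * (CARD('n) - 1)))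
          \<longlonglongrightarrow> (\<integral>x. \<phi> x \<partial>\<mu>)"
begin

sublocale \<mu>: prob_space \<mu> by (rule mu_prob)

abbreviation "F \<equiv> Flift d f"

text \<open>With \<open>CARD('n) = k + 1\<close> this is \<open>d ^ (n k)\<close>, the expected
  number of preimages on projective space.\<close>

definition growth_factor :: "nat \<Rightarrow> real" where
  "growth_factor n = real d ^ (n * (CARD('n) - 1))"

lemma growth_factor_pos: "0 < growth_factor n"
  using degree_ge_2 by (simp add: growth_factor_def)

lemma limit:
  "cont_Pk \<phi> \<Longrightarrow> (\<lambda>n. (\<integral>y. push_fun (F n) \<phi> y \<partial>fs_measure) / growth_factor n) \<longlonglongrightarrow> (\<integral>x. \<phi> x \<partial>\<mu>)"
  unfolding growth_factor_def by (rule mu_limit[OF smooth_prob_fs_measure])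

lemma space_mu: "space \<mu> = pspace"
  by (rule space_eq_pspace[OF mu_sets])

lemma integrable_mu: "cont_Pk \<phi> \<Longrightarrow> integrable \<mu> \<phi>"
  using cont_Pk_integrable[OF _ mu_sets] \<mu>.finite_measure_axioms by blast

lemma eventually_integrable_of_nonzero:
  assumes "cont_Pk \<phi>" "(\<integral>x. \<phi> x \<partial>\<mu>) \<noteq> 0"
  shows "\<forall>\<^sub>F n in sequentially. (\<integral>y. push_fun (F n) \<phi> y \<partial>fs_measure) \<noteq> 0 \<and> integrable fs_measure (push_fun (F n) \<phi>)"
  using tendsto_imp_eventually_ne[OF limit[OF assms(1)] assms(2)]
proof eventually_elim
  case (elim n)
  then have "(\<integral>y. push_fun (F n) \<phi> y \<partial>fs_measure) \<noteq> 0" by auto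
  then show ?case using not_integrable_integral_eq by blast
qed

text \<open>A non-measurable integrand has Bochner integral \<open>0\<close>, so the assumed convergence to a nonzero
  limit forces the push-forwards to be eventually measurable.\<close>

lemma eventually_integrable:
  assumes "cont_Pk \<phi>" shows "\<forall>\<^sub>F n in sequentially. integrable fs_measure (push_fun (F n) \<phi>)"
proof (cases "(\<integral>x. \<phi> x \<partial>\<mu>) = 0")
  case False
  then show ?thesis using eventually_integrable_of_nonzero[OF assms False] by (auto elim: eventually_mono)
next
  \<comment> \<open>When the limit is 0, test with \<open>\<phi> + 1\<close> and with 1, whose
    limits are nonzero, and subtract.\<close>
  case True
  have c1: "cont_Pk (\<lambda>x::complex^'n. 1)" by (rule cont_Pk_const)
  have "(\<integral>x. \<phi> x + 1 \<partial>\<mu>) = 1" using True integrable_mu[OF assms] by (simp add: \<mu>.prob_space)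
  then have 1: "\<forall>\<^sub>F n in sequentially. integrable fs_measure (push_fun (F n) (\<lambda>x. \<phi> x + 1))"
    using eventually_integrable_of_nonzero[OF cont_Pk_add[OF assms c1]] by (auto elim: eventually_mono)
  have 2: "\<forall>\<^sub>F n in sequentially. integrable fs_measure (push_fun (F n) (\<lambda>x. 1))"
    using eventually_integrable_of_nonzero[OF c1] by (auto simp: \<mu>.prob_space elim: eventually_mono)
  from 1 2 show ?thesis
  proof eventually_elim
    case (elim n)
    have "push_fun (F n) \<phi> = (\<lambda>y. push_fun (F n) (\<lambda>x. \<phi> x + 1) y - push_fun (F n) (\<lambda>x. 1) y)"
      by (simp add: fun_eq_iff push_fun_add)
    then show ?case using Bochner_Integration.integrable_diff[OF elim] by simp
  qed
qed

definition Jac :: "nat \<Rightarrow> complex^'n \<Rightarrow> complex^'n^'n" where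
  "Jac n = (SOME A. \<exists>q q'. homogeneous_map (F n) (d ^ n) q q' A)"

lemma homogeneous_map_F: "\<exists>q q'. homogeneous_map (F n) (d ^ n) q q' (Jac n)"
proof -
  have "\<exists>A q q'. homogeneous_map (F n) (d ^ n) q q' A"
    using homogeneous_map_Flift[of d f n] degree_ge_2 holo by auto
  then show ?thesis unfolding Jac_def by (rule someI_ex)
qed

definition nondegenerate :: "nat \<Rightarrow> bool" where
  "nondegenerate n \<longleftrightarrow> (\<exists>x. det (Jac n x) \<noteq> 0)"

lemma nondegenerate_map_F:
  "nondegenerate n \<Longrightarrow> \<exists>q q'. nondegenerate_map (F n) (d ^ n) q q' (Jac n)"
  using homogeneous_map_F[of n] unfolding nondegenerate_map_def nondegenerate_map_axioms_def nondegenerate_def by blast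

text \<open>Otherwise the image of \<open>F n\<close> would be a null set by Sard's theorem, and the total mass would be lost.\<close>

lemma eventually_nondegenerate: "\<forall>\<^sub>F n in sequentially. nondegenerate n"
proof -
  have "(\<integral>x. 1 \<partial>\<mu>) \<noteq> (0::real)" by (simp add: \<mu>.prob_space)
  from eventually_integrable_of_nonzero[OF cont_Pk_const this] show ?thesis
  proof eventually_elim
    case (elim n)
    obtain q q' where hm: "homogeneous_map (F n) (d ^ n) q q' (Jac n)" using homogeneous_map_F by blast
    interpret homogeneous_map "F n" "d ^ n" q q' "Jac n" by (rule hm)
    show ?case
    proof (rule ccontr)
      assume "\<not> nondegenerate n"
      then have "{x. det (Jac n x) = 0} = UNIV" by (auto simp: nondegenerate_def)
      then have neg: "negligible (range (F n))" using negligible_critical_values[OF has_derivative_F] by simp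
      have "closed (range (F n))" by (rule closed_image) simp
      then have "range (F n) \<in> sets lborel" by simp
      then have "range (F n) \<in> null_sets lborel"
        using neg by (simp add: negligible_iff_null_sets null_sets_completion_iff)
      then have AE: "AE z in lborel. z \<notin> range (F n)" by (rule AE_not_in)
      \<comment> \<open>Over points off the null image the fibre is empty, so the push-forward of 1
        vanishes almost everywhere, against its nonzero integral.\<close>
      have "(\<integral>y. push_fun (F n) (\<lambda>_. 1) y \<partial>fs_measure) = (\<integral>z. 0 * gdens (z::complex^'n) \<partial>lborel)"
      proof (rule integral_fs_measure)
        show "push_fun (F n) (\<lambda>_. 1) \<in> borel_measurable fs_measure" using elim by auto
        show "AE z in lborel. z \<noteq> 0 \<longrightarrow> push_fun (F n) (\<lambda>_. 1) z = (0::real)"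
          using AE
        proof eventually_elim
          case (elim z)
          then have fib: "F n -` {z} = {}" by auto
          have "real (d ^ n) * push_fun (F n) (\<lambda>_. 1) z = 0" if "z \<noteq> 0"
            using push_fun_eq_fibre_sum[of z "\<lambda>_. 1"] that unfolding fib by simp
          then show ?case using degree_ge_2 by auto
        qed
      qed simp
      then show False using elim by simp
    qed
  qed
qed

text \<open>Agrees with \<open>reg\<close> in the interpretation at \<open>n\<close>, but is
  available for all \<open>n\<close> at once, as needed when two iterates are compared.\<close>

definition Reg :: "nat \<Rightarrow> (complex^'n) set" where
  "Reg n = {y. y \<noteq> 0 \<and> (\<forall>x. F n x = y \<longrightarrow> det (Jac n x) \<noteq> 0)}"

definition fibre_card :: "nat \<Rightarrow> real" where
  "fibre_card n = real (card (F n -` {SOME z. z \<in> Reg n}))"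

text \<open>Replaces the exact count of Bezout's theorem.\<close>

lemma fibre_card_asymptotics:
  "(\<lambda>n. fibre_card n / (real (d ^ n) * growth_factor n)) \<longlonglongrightarrow> 1"
proof -
  have "(\<lambda>n. (\<integral>y. push_fun (F n) (\<lambda>_. 1) y \<partial>fs_measure) / growth_factor n) \<longlonglongrightarrow> 1"
    using limit[OF cont_Pk_const[of 1]] by (simp add: \<mu>.prob_space)
  moreover have "\<forall>\<^sub>F n in sequentially. (\<integral>y. push_fun (F n) (\<lambda>_. 1) y \<partial>fs_measure) / growth_factor n = fibre_card n / (real (d ^ n) * growth_factor n)"
    using eventually_nondegenerate eventually_integrable[OF cont_Pk_const[of 1]]
  proof eventually_elim
    case (elim n)
    obtain q q' where "nondegenerate_map (F n) (d ^ n) q q' (Jac n)" using nondegenerate_map_F elim by blast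
    then interpret nondegenerate_map "F n" "d ^ n" q q' "Jac n" .
    have regR: "reg = Reg n" by (simp add: reg_def Reg_def)
    have some: "(SOME z. z \<in> Reg n) \<in> reg" using reg_nonempty unfolding regR by (metis ex_in_conv someI_ex)
    have card: "fibre_sum_reg (\<lambda>_. 1) z = fibre_card n" if "z \<in> reg" for z
      using that card_fibre_eq[OF that some] by (simp add: fibre_sum_reg_def fibre_sum_def fibre_card_def)
    have "(\<integral>z. fibre_sum_reg (\<lambda>_. 1) z * gdens z \<partial>lborel) = (\<integral>z. fibre_card n * gdens (z::complex^'n) \<partial>lborel)"
    proof (rule integral_cong_AE)
      show "AE z in lborel. fibre_sum_reg (\<lambda>_. 1) z * gdens z = fibre_card n * gdens z"
        using AE_reg by eventually_elim (simp add: card)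
      show "(\<lambda>z. fibre_sum_reg (\<lambda>_. 1) z * gdens z) \<in> borel_measurable lborel"
        using integrable_fibre_sum_reg[OF cont_Pk_const[of 1]] by (rule borel_measurable_integrable)
    qed simp
    also have "\<dots> = fibre_card n" by (simp add: integral_gdens)
    finally show ?case using integral_push_fun[OF cont_Pk_const elim(2)] by simp
  qed
  ultimately show ?thesis by (rule Lim_transform_eventually)
qed

section \<open>Asymptotic bounds for fibre averages and their pairing with functions of
  \<open>F n\<close>\<close>

definition green :: "(complex^'n \<Rightarrow> real) \<Rightarrow> (nat \<Rightarrow> real) \<Rightarrow> bool" where
  "green G \<tau> \<longleftrightarrow> continuous_on (- {0}) G \<and>
    (\<forall>c x. c \<noteq> 0 \<longrightarrow> x \<noteq> 0 \<longrightarrow> G (c *s x) = G x + ln (cmod c)) \<and> \<tau> \<longlonglongrightarrow> 0 \<and>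
    (\<forall>n x. x \<noteq> 0 \<longrightarrow> \<bar>G x - (ln (norm (F n x)) - lift_scale d f n) / real (d ^ n)\<bar> \<le> \<tau> n)"

lemma green_exists: "\<exists>G \<tau>. green G \<tau>"
proof -
  obtain G \<tau> where "continuous_on (- {0}) G" "\<And>c x. c \<noteq> 0 \<Longrightarrow> x \<noteq> 0 \<Longrightarrow> G (c *s x) = G x + ln (cmod c)"
    "\<tau> \<longlonglongrightarrow> 0" "\<And>n x. x \<noteq> 0 \<Longrightarrow> \<bar>G x - (ln (norm (F n x)) - lift_scale d f n) / real (d ^ n)\<bar> \<le> \<tau> n"
    using Green_function[OF card_ge_2 degree_ge_2 holo condA] by blast
  then show ?thesis unfolding green_def by blast
qed

lemma cont_Pk_minus_green:
  assumes "green G \<tau>" "homogeneous_psh C u" shows "cont_Pk (\<lambda>x. u x - C * G x)"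
  using assms unfolding green_def homogeneous_psh_def psh_def cont_Pk_def pspace_eq
  by (auto intro!: continuous_intros simp: algebra_simps)

text \<open>After division by the number of preimages, the bound
  \<open>fibre_sum_le_gaussian_mean\<close> has three errors: the Gaussian shift, made small by a
  radius \<open>r\<close> chosen independently of \<open>n\<close>; the term with
  \<open>ln (r / 2)\<close>, which is divided by \<open>d ^ n\<close>; and the error
  \<open>\<tau> n\<close> of the Green function. The estimate is uniform over all regular
  values.\<close>

lemma eventually_fibre_average_le:
  assumes G: "green G \<tau>" and u: "homogeneous_psh C u" and \<epsilon>: "0 < \<epsilon>"
  defines "w \<equiv> \<lambda>x. u x - C * G x"
  shows "\<forall>\<^sub>F n in sequentially. \<forall>z\<in>Reg n. (\<Sum>x\<in>F n -` {z}. w x) \<le> ((\<integral>x. w x \<partial>\<mu>) + \<epsilon>) * real (card (F n -` {z}))"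
proof -
  define I where "I = (\<integral>x. w x \<partial>\<mu>)"
  have w: "cont_Pk w" unfolding w_def by (rule cont_Pk_minus_green[OF G u])
  have C: "0 \<le> C" using u by (simp add: homogeneous_psh_def)
  have psh: "psh (\<lambda>x. w x + C * G x)" using u by (simp add: w_def homogeneous_psh_def)
  obtain M where M: "0 \<le> M" "\<And>x. x \<noteq> 0 \<Longrightarrow> \<bar>w x\<bar> \<le> M" using cont_Pk_bounded[OF w] by blast
  \<comment> \<open>Makes the shift error \<open>M * \<delta>\<close> at most
    \<open>\<epsilon> / 2\<close>; the summand 1 covers \<open>M = 0\<close>.\<close>
  define \<delta> where "\<delta> = \<epsilon> / (2 * (M + 1))"
  have \<delta>: "0 < \<delta>" using \<epsilon> M by (simp add: \<delta>_def)
  have "M * \<delta> \<le> (M + 1) * \<delta>" using \<delta> by simp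
  also have "\<dots> = \<epsilon> / 2" using M by (simp add: \<delta>_def field_simps)
  finally have M\<delta>: "M * \<delta> < \<epsilon>" using \<epsilon> by simp
  obtain r0 where r0: "r0 > 0" "\<And>y::complex^'n. norm y \<le> r0 \<Longrightarrow> (\<integral>z. \<bar>gdens (z - y) - gdens z\<bar> \<partial>lborel) \<le> \<delta>"
    using gdens_translate_L1[OF \<delta>] by blast
  define r where "r = min r0 1"
  have r: "0 < r" "r \<le> 1" using r0 by (auto simp: r_def)
  obtain m1 where m1: "\<And>y::complex^'n. norm y \<le> 1 \<Longrightarrow> (\<integral>z. norm z * gdens (z - y) \<partial>lborel) \<le> m1"
    using norm_gdens_moment by blast
  \<comment> \<open>\<open>X / Y\<close> is the Gaussian mean of the fibre average of
    \<open>w\<close>: the normalization \<open>d ^ n * growth_factor n\<close> cancels, and the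
    limit is \<open>I / 1\<close>.\<close>
  define X where "X n = (\<integral>y. push_fun (F n) w y \<partial>fs_measure) / growth_factor n" for n
  define Y where "Y n = fibre_card n / (real (d ^ n) * growth_factor n)" for n
  define E where "E n = X n / Y n + (M * \<delta> + C * ((m1 - ln (r / 2)) / real (d ^ n) + 2 * \<tau> n))" for n
  have X: "X \<longlonglongrightarrow> I" unfolding X_def I_def by (rule limit[OF w])
  have Y: "Y \<longlonglongrightarrow> 1" unfolding Y_def by (rule fibre_card_asymptotics)
  have \<tau>: "\<tau> \<longlonglongrightarrow> 0" using G by (simp add: green_def)
  have dn: "(\<lambda>n. (m1 - ln (r / 2)) / real (d ^ n)) \<longlonglongrightarrow> 0"
  proof -
    have "(\<lambda>n. (1 / real d) ^ n) \<longlonglongrightarrow> 0" using degree_ge_2 by (intro LIMSEQ_power_zero) auto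
    from tendsto_mult_right_zero[OF this, of "m1 - ln (r / 2)"] show ?thesis by (simp add: power_divide)
  qed
  have "E \<longlonglongrightarrow> I / 1 + (M * \<delta> + C * (0 + 2 * 0))"
    unfolding E_def by (intro tendsto_intros X Y \<tau> dn) auto
  then have E: "\<forall>\<^sub>F n in sequentially. E n < I + \<epsilon>"
    by (rule order_tendstoD(2)) (use M\<delta> in simp)
  have Ypos: "\<forall>\<^sub>F n in sequentially. 0 < Y n" by (rule order_tendstoD(1)[OF Y]) simp
  from E Ypos eventually_nondegenerate eventually_integrable[OF w] show ?thesis
  proof eventually_elim
    case (elim n)
    obtain q q' where "nondegenerate_map (F n) (d ^ n) q q' (Jac n)" using nondegenerate_map_F elim by blast
    then interpret nondegenerate_map "F n" "d ^ n" q q' "Jac n" .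
    have regR: "reg = Reg n" by (simp add: reg_def Reg_def)
    have some: "(SOME z. z \<in> Reg n) \<in> reg" using reg_nonempty unfolding regR by (metis ex_in_conv someI_ex)
    have dn0: "0 < real (d ^ n)" using degree_ge_2 by simp
    show ?case
    proof
      fix z0 assume z0: "z0 \<in> Reg n"
      then have z0r: "z0 \<in> reg" by (simp add: regR)
      define N where "N = real (card (F n -` {z0}))"
      have N: "N = fibre_card n" unfolding N_def fibre_card_def using card_fibre_eq[OF z0r some] by simp
      have "fibre_sum w z0 \<le> (\<integral>z. fibre_sum_reg w z * gdens z \<partial>lborel)
         + real (card (F n -` {z0})) * (M * \<delta> + C * ((m1 - ln (r / 2)) / real (d ^ n) + 2 * \<tau> n))"
      proof (rule fibre_sum_le_gaussian_mean[where G = G and \<kappa> = "lift_scale d f n"])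
        show "continuous_on (- {0}) w" using w by (simp add: cont_Pk_def pspace_eq)
        show "w (c *s x) = w x" if "c \<noteq> 0" for x c
          by (cases "x = 0") (use cont_Pk_vsmult[OF w _ that] in auto)
        show "\<bar>G x - (ln (norm (F n x)) - lift_scale d f n) / real (d ^ n)\<bar> \<le> \<tau> n" if "x \<noteq> 0" for x
          using G that by (simp add: green_def)
        show "(\<integral>z. \<bar>gdens (z - y) - gdens z\<bar> \<partial>lborel) \<le> \<delta>" if "norm y \<le> r" for y :: "complex^'n"
          by (rule r0(2)) (use that in \<open>simp add: r_def\<close>)
      qed (use M C psh r m1 z0r in auto)
      also have "(\<integral>z. fibre_sum_reg w z * gdens z \<partial>lborel) = real (d ^ n) * growth_factor n * X n"
        using integral_push_fun[OF w elim(4)] growth_factor_pos[of n] dn0 by (simp add: X_def)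
      also have "real (d ^ n) * growth_factor n = N / Y n"
        unfolding N Y_def using elim(2) growth_factor_pos[of n] dn0 by (auto simp: Y_def zero_less_divide_iff)
      finally have "fibre_sum w z0 \<le> N * E n"
        by (simp add: N_def[symmetric] E_def distrib_left)
      also have "\<dots> \<le> N * (I + \<epsilon>)" using elim(1) by (intro mult_left_mono) (auto simp: N_def)
      finally show "(\<Sum>x\<in>F n -` {z0}. w x) \<le> ((\<integral>x. w x \<partial>\<mu>) + \<epsilon>) * real (card (F n -` {z0}))"
        by (simp add: fibre_sum_def I_def N_def mult.commute)
    qed
  qed
qed

text \<open>By the chain rule the Jacobian of \<open>F (n + k)\<close> factors through that of
  \<open>F n\<close>, so a critical point of \<open>F n\<close> remains critical for
  \<open>F (n + k)\<close>, and points with the same value under \<open>F n\<close> keep a common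
  value afterwards.\<close>

lemma Reg_factor:
  assumes "F (n + k) x \<in> Reg (n + k)" shows "F n x \<in> Reg n"
proof -
  define H where "H = Flift d (\<lambda>j. f (j + n)) k"
  have fact: "F (n + k) y = H (F n y)" for y unfolding H_def by (rule Flift_add)
  obtain q q' A where "homogeneous_map H (d ^ k) q q' A"
    using homogeneous_map_Flift[of d "\<lambda>j. f (j + n)" k] degree_ge_2 holo unfolding H_def by auto
  then interpret H: homogeneous_map H "d ^ k" q q' A .
  obtain q1 q1' where "homogeneous_map (F n) (d ^ n) q1 q1' (Jac n)" using homogeneous_map_F by blast
  then interpret n: homogeneous_map "F n" "d ^ n" q1 q1' "Jac n" .
  obtain q2 q2' where "homogeneous_map (F (n + k)) (d ^ (n + k)) q2 q2' (Jac (n + k))" using homogeneous_map_F by blast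
  then interpret m: homogeneous_map "F (n + k)" "d ^ (n + k)" q2 q2' "Jac (n + k)" .
  have inj_iff: "det B \<noteq> 0 \<longleftrightarrow> inj ((*v) B)" for B :: "complex^'n^'n"
    by (simp add: invertible_det_nz[symmetric] invertible_left_inverse matrix_left_invertible_injective)
  have "det (Jac n y) \<noteq> 0" if y: "F n y = F n x" for y
  proof -
    have "F (n + k) y = F (n + k) x" using y by (simp add: fact)
    then have "det (Jac (n + k) y) \<noteq> 0" using assms by (auto simp: Reg_def)
    then have inj: "inj ((*v) (Jac (n + k) y))" by (simp add: inj_iff)
    have "((\<lambda>y. H (F n y)) has_derivative (\<lambda>h. A (F n y) *v (Jac n y *v h))) (at y)"
      by (rule has_derivative_compose[OF n.has_derivative_F H.has_derivative_F])
    moreover have "((\<lambda>y. H (F n y)) has_derivative (\<lambda>h. Jac (n + k) y *v h)) (at y)"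
      using m.has_derivative_F[of y] by (simp add: fact[abs_def])
    ultimately have eq: "Jac (n + k) y *v h = A (F n y) *v (Jac n y *v h)" for h
      by (metis has_derivative_unique)
    have "inj ((*v) (Jac n y))"
    proof (rule injI)
      fix a b assume "Jac n y *v a = Jac n y *v b"
      then have "Jac (n + k) y *v a = Jac (n + k) y *v b" by (simp add: eq)
      then show "a = b" using inj by (simp add: inj_eq)
    qed
    then show ?thesis by (simp add: inj_iff)
  qed
  moreover have "x \<noteq> 0" using assms by (auto simp: Reg_def)
  ultimately show ?thesis by (auto simp: Reg_def)
qed

lemma cont_Pk_compose_F:
  assumes "cont_Pk \<phi>" shows "cont_Pk (\<lambda>x. \<phi> (F n x))"
proof -
  obtain q q' where "homogeneous_map (F n) (d ^ n) q q' (Jac n)" using homogeneous_map_F by blast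
  then interpret homogeneous_map "F n" "d ^ n" q q' "Jac n" .
  have "continuous_on (- {0}) (\<lambda>x. \<phi> (F n x))"
    by (rule continuous_on_compose2[of "- {0}" \<phi>])
      (use assms in \<open>auto simp: cont_Pk_def pspace_eq intro!: continuous_on_F continuous_on_id\<close>)
  then show ?thesis
    using cont_Pk_vsmult[OF assms] by (auto simp: cont_Pk_def pspace_eq homogeneous)
qed

text \<open>For \<open>m \<ge> n\<close> a fibre of \<open>F m\<close> is a disjoint union of fibres
  of \<open>F n\<close>, on each of which \<open>\<eta> (F n x)\<close> is a nonnegative constant
  and the average bound applies. Integrating over the Gaussian and letting \<open>m\<close> tend to
  infinity transfers the inequality to \<mu>.\<close>

lemma pairing_le:
  assumes bound: "\<forall>z\<in>Reg n. (\<Sum>x\<in>F n -` {z}. w x) \<le> c * real (card (F n -` {z}))"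
    and w: "cont_Pk w" and \<eta>: "cont_Pk \<eta>" "\<And>x. 0 \<le> \<eta> x"
  shows "(\<integral>x. w x * \<eta> (F n x) \<partial>\<mu>) \<le> c * (\<integral>x. \<eta> (F n x) \<partial>\<mu>)"
proof -
  define \<psi>1 where "\<psi>1 x = w x * \<eta> (F n x)" for x
  define \<psi>2 where "\<psi>2 x = \<eta> (F n x)" for x
  have c2: "cont_Pk \<psi>2" unfolding \<psi>2_def by (rule cont_Pk_compose_F[OF \<eta>(1)])
  have c1: "cont_Pk \<psi>1" using cont_Pk_mult[OF w c2] by (simp add: \<psi>1_def[abs_def] \<psi>2_def)
  have ev: "\<forall>\<^sub>F m in sequentially. (\<integral>y. push_fun (F m) \<psi>1 y \<partial>fs_measure) / growth_factor m
      \<le> c * ((\<integral>y. push_fun (F m) \<psi>2 y \<partial>fs_measure) / growth_factor m)"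
    using eventually_nondegenerate eventually_integrable[OF c1] eventually_integrable[OF c2] eventually_ge_at_top[of n]
  proof eventually_elim
    case (elim m)
    then obtain k where m: "m = n + k" using le_Suc_ex by blast
    obtain q q' where "nondegenerate_map (F m) (d ^ m) q q' (Jac m)" using nondegenerate_map_F elim by blast
    then interpret nondegenerate_map "F m" "d ^ m" q q' "Jac m" .
    have regR: "reg = Reg m" by (simp add: reg_def Reg_def)
    have pt: "fibre_sum_reg \<psi>1 y \<le> c * fibre_sum_reg \<psi>2 y" for y
    proof (cases "y \<in> reg")
      case True
      let ?X = "F m -` {y}"
      have fin: "finite ?X" by (rule finite_fibre[OF True])
      have fib: "{x \<in> ?X. F n x = z} = F n -` {z}" if z: "z \<in> F n ` ?X" for z
      proof -
        have "F m x = y" if "F n x = z" for x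
        proof -
          obtain x0 where "F m x0 = y" "F n x0 = z" using z by auto
          then show ?thesis using that by (simp add: m Flift_add)
        qed
        then show ?thesis by auto
      qed
      have "fibre_sum \<psi>1 y = (\<Sum>z\<in>F n ` ?X. \<Sum>x\<in>{x \<in> ?X. F n x = z}. \<psi>1 x)"
        unfolding fibre_sum_def by (rule sum.image_gen[OF fin])
      also have "\<dots> \<le> (\<Sum>z\<in>F n ` ?X. \<Sum>x\<in>{x \<in> ?X. F n x = z}. c * \<psi>2 x)"
      proof (rule sum_mono)
        fix z assume z: "z \<in> F n ` ?X"
        then obtain x0 where x0: "F m x0 = y" "F n x0 = z" by auto
        have "F m x0 \<in> Reg m" using True x0(1) unfolding regR by simp
        then have "F (n + k) x0 \<in> Reg (n + k)" unfolding m .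
        then have zR: "z \<in> Reg n" using Reg_factor x0(2) by blast
        have "(\<Sum>x\<in>{x \<in> ?X. F n x = z}. \<psi>1 x) = \<eta> z * (\<Sum>x\<in>F n -` {z}. w x)"
          unfolding fib[OF z] by (simp add: \<psi>1_def sum_distrib_left mult.commute)
        also have "\<dots> \<le> \<eta> z * (c * real (card (F n -` {z})))"
          using bound zR \<eta>(2) by (intro mult_left_mono) auto
        also have "\<dots> = (\<Sum>x\<in>{x \<in> ?X. F n x = z}. c * \<psi>2 x)"
          unfolding fib[OF z] by (simp add: \<psi>2_def mult_ac)
        finally show "(\<Sum>x\<in>{x \<in> ?X. F n x = z}. \<psi>1 x) \<le> (\<Sum>x\<in>{x \<in> ?X. F n x = z}. c * \<psi>2 x)" .
      qed
      also have "\<dots> = (\<Sum>x\<in>?X. c * \<psi>2 x)" by (rule sum.image_gen[OF fin, symmetric])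
      also have "\<dots> = c * fibre_sum \<psi>2 y" by (simp add: fibre_sum_def sum_distrib_left)
      finally show ?thesis using True by (simp add: fibre_sum_reg_def)
    qed (simp add: fibre_sum_reg_def)
    have "(\<integral>z. fibre_sum_reg \<psi>1 z * gdens z \<partial>lborel) \<le> (\<integral>z. c * (fibre_sum_reg \<psi>2 z * gdens z) \<partial>lborel)"
    proof (rule integral_mono)
      show "fibre_sum_reg \<psi>1 z * gdens z \<le> c * (fibre_sum_reg \<psi>2 z * gdens z)" for z
        using mult_right_mono[OF pt gdens_nonneg] by (simp add: mult.assoc)
    qed (intro integrable_fibre_sum_reg c1 c2 integrable_mult_right)+
    then have "(\<integral>y. push_fun (F m) \<psi>1 y \<partial>fs_measure) \<le> c * (\<integral>y. push_fun (F m) \<psi>2 y \<partial>fs_measure)"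
      unfolding integral_push_fun[OF c1 elim(2)] integral_push_fun[OF c2 elim(3)]
      by (simp add: divide_right_mono)
    then show ?case using growth_factor_pos[of m] by (simp add: divide_right_mono)
  qed
  have "(\<integral>x. \<psi>1 x \<partial>\<mu>) \<le> c * (\<integral>x. \<psi>2 x \<partial>\<mu>)"
    by (rule tendsto_le[OF _ tendsto_mult[OF tendsto_const limit[OF c2]] limit[OF c1] ev]) simp
  then show ?thesis by (simp add: \<psi>1_def \<psi>2_def)
qed

section \<open>Independence of asymptotic sets\<close>

lemma vimage_F_cone_sets:
  assumes B: "B \<in> cone_sets" shows "F n -` B \<inter> pspace \<in> cone_sets"
proof -
  obtain q q' where "homogeneous_map (F n) (d ^ n) q q' (Jac n)" using homogeneous_map_F by blast
  then interpret homogeneous_map "F n" "d ^ n" q q' "Jac n" .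
  show ?thesis
  proof (rule cone_setsI)
    have "F n \<in> borel_measurable borel"
      by (rule borel_measurable_continuous_onI) (rule continuous_on_F[OF continuous_on_id])
    then have "F n -` B \<in> sets borel"
      using measurable_sets[of "F n" borel borel B] B by (simp add: cone_sets_def)
    then show "F n -` B \<inter> pspace \<in> sets borel" using pspace_borel by blast
    show "c *s x \<in> F n -` B \<inter> pspace" if "x \<in> F n -` B \<inter> pspace" "c \<noteq> 0" for x c
      using that cone_sets_vsmult_iff[OF B, of "c ^ (d ^ n)" "F n x"] by (simp add: homogeneous pspace_def)
  qed auto
qed

text \<open>The set \<open>B\<close> is approximated in the image of \<mu> under \<open>F n\<close>,
  rather than \<open>A\<close> in \<mu>, so that the approximants keep the form
  \<open>\<eta> (F n x)\<close> demanded by \<open>pairing_le\<close>. The two replacements of the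
  indicator cost \<open>\<delta> * (b + \<bar>c\<bar>)\<close>.\<close>

lemma pairing_sets_le:
  assumes bound: "\<forall>z\<in>Reg n. (\<Sum>x\<in>F n -` {z}. w x) \<le> c * real (card (F n -` {z}))"
    and w: "cont_Pk w" and B: "B \<in> cone_sets"
  defines "A \<equiv> F n -` B \<inter> pspace"
  shows "(\<integral>x. w x * indicator A x \<partial>\<mu>) \<le> c * measure \<mu> A"
proof -
  have A: "A \<in> sets \<mu>" unfolding A_def using vimage_F_cone_sets[OF B] mu_sets by simp
  have measF: "F n \<in> measurable \<mu> cone_space"
  proof (rule measurableI)
    show "F n x \<in> space cone_space" if "x \<in> space \<mu>" for x
    proof -
      have "F n x \<in> pspace"
        using that Flift_eq_0_iff[of d f n x] degree_ge_2 holo by (simp add: space_mu pspace_def)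
      then show ?thesis by (simp only: space_cone_space)
    qed
    show "F n -` S \<inter> space \<mu> \<in> sets \<mu>" if "S \<in> sets cone_space" for S
      using that vimage_F_cone_sets[of S n] by (simp add: space_mu mu_sets)
  qed
  let ?M = "distr \<mu> cone_space (F n)"
  have finM: "finite_measure ?M" using \<mu>.prob_space_distr[OF measF] by (simp add: prob_space_def)
  have setsM: "sets ?M = cone_sets" by simp
  obtain b where b: "0 \<le> b" "\<And>x. x \<noteq> 0 \<Longrightarrow> \<bar>w x\<bar> \<le> b" using cont_Pk_bounded[OF w] by blast
  have int_wA: "integrable \<mu> (\<lambda>x. w x * indicator A x)"
    using integrable_real_mult_indicator[OF A integrable_mu[OF w]] by (simp add: mult.commute)
  have int_A: "integrable \<mu> (indicator A :: _ \<Rightarrow> real)"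
    using A by (intro integrable_real_indicator) (auto simp: \<mu>.emeasure_eq_measure)
  have "(\<integral>x. w x * indicator A x \<partial>\<mu>) \<le> c * measure \<mu> A + \<delta> * (b + \<bar>c\<bar>)" if \<delta>: "0 < \<delta>" for \<delta>
  proof -
    obtain \<eta> where \<eta>: "cont_Pk \<eta>" "\<forall>x. 0 \<le> \<eta> x \<and> \<eta> x \<le> 1" "(\<integral>x. \<bar>indicator B x - \<eta> x\<bar> \<partial>?M) \<le> \<delta>"
      using cone_set_L1_approx[OF setsM finM B \<delta>] by blast
    have c\<eta>: "cont_Pk (\<lambda>x. \<eta> (F n x))" by (rule cont_Pk_compose_F[OF \<eta>(1)])
    have "(\<lambda>x. \<bar>indicator B x - \<eta> x\<bar> :: real) \<in> borel_measurable cone_space"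
      using B cont_Pk_measurable[OF \<eta>(1), of cone_space] by (intro borel_measurable_abs borel_measurable_diff borel_measurable_indicator) auto
    from integral_distr[OF measF this]
    have "(\<integral>x. \<bar>indicator B (F n x) - \<eta> (F n x)\<bar> \<partial>\<mu>) \<le> \<delta>" using \<eta>(3) by simp
    moreover have "(\<integral>x. \<bar>indicator B (F n x) - \<eta> (F n x)\<bar> \<partial>\<mu>) = (\<integral>x. \<bar>indicator A x - \<eta> (F n x)\<bar> \<partial>\<mu>)"
      by (intro Bochner_Integration.integral_cong) (auto simp: A_def space_mu indicator_def)
    ultimately have err: "(\<integral>x. \<bar>indicator A x - \<eta> (F n x)\<bar> \<partial>\<mu>) \<le> \<delta>" by simp
    have int_err: "integrable \<mu> (\<lambda>x. \<bar>indicator A x - \<eta> (F n x)\<bar>)"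
      by (intro integrable_abs Bochner_Integration.integrable_diff int_A integrable_mu c\<eta>)
    have int_w\<eta>: "integrable \<mu> (\<lambda>x. w x * \<eta> (F n x))" by (intro integrable_mu cont_Pk_mult w c\<eta>)
    have "(\<integral>x. w x * indicator A x \<partial>\<mu>) \<le> (\<integral>x. w x * \<eta> (F n x) + b * \<bar>indicator A x - \<eta> (F n x)\<bar> \<partial>\<mu>)"
    proof (rule integral_mono[OF int_wA])
      show "integrable \<mu> (\<lambda>x. w x * \<eta> (F n x) + b * \<bar>indicator A x - \<eta> (F n x)\<bar>)"
        by (intro Bochner_Integration.integrable_add int_w\<eta> integrable_mult_right int_err)
      fix x assume "x \<in> space \<mu>"
      then have x: "x \<noteq> 0" by (simp add: space_mu pspace_def)
      have "w x * (indicator A x - \<eta> (F n x)) \<le> \<bar>w x\<bar> * \<bar>indicator A x - \<eta> (F n x)\<bar>"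
        unfolding abs_mult[symmetric] by (rule abs_ge_self)
      also have "\<dots> \<le> b * \<bar>indicator A x - \<eta> (F n x)\<bar>" by (intro mult_right_mono b(2)[OF x]) simp
      finally show "w x * indicator A x \<le> w x * \<eta> (F n x) + b * \<bar>indicator A x - \<eta> (F n x)\<bar>"
        by (simp add: right_diff_distrib)
    qed
    also have "\<dots> = (\<integral>x. w x * \<eta> (F n x) \<partial>\<mu>) + b * (\<integral>x. \<bar>indicator A x - \<eta> (F n x)\<bar> \<partial>\<mu>)"
      by (subst Bochner_Integration.integral_add) (auto intro!: int_w\<eta> integrable_mult_right int_err)
    also have "\<dots> \<le> c * (\<integral>x. \<eta> (F n x) \<partial>\<mu>) + b * \<delta>"
      using pairing_le[OF bound w \<eta>(1)] \<eta>(2) b(1) err by (intro add_mono mult_left_mono) auto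
    also have "c * (\<integral>x. \<eta> (F n x) \<partial>\<mu>) \<le> c * measure \<mu> A + \<bar>c\<bar> * \<delta>"
    proof -
      have "\<bar>(\<integral>x. \<eta> (F n x) \<partial>\<mu>) - measure \<mu> A\<bar> = \<bar>\<integral>x. indicator A x - \<eta> (F n x) \<partial>\<mu>\<bar>"
        using A by (subst Bochner_Integration.integral_diff) (auto intro!: int_A integrable_mu c\<eta> simp: abs_minus_commute)
      also have "\<dots> \<le> (\<integral>x. \<bar>indicator A x - \<eta> (F n x)\<bar> \<partial>\<mu>)" by (rule integral_abs_bound)
      finally have "\<bar>(\<integral>x. \<eta> (F n x) \<partial>\<mu>) - measure \<mu> A\<bar> \<le> \<delta>" using err by simp
      then have "\<bar>c\<bar> * \<bar>(\<integral>x. \<eta> (F n x) \<partial>\<mu>) - measure \<mu> A\<bar> \<le> \<bar>c\<bar> * \<delta>" by (intro mult_left_mono) auto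
      then have "c * ((\<integral>x. \<eta> (F n x) \<partial>\<mu>) - measure \<mu> A) \<le> \<bar>c\<bar> * \<delta>"
        unfolding abs_mult[symmetric] using abs_ge_self order.trans by blast
      then show ?thesis by (simp add: right_diff_distrib)
    qed
    finally show ?thesis by (simp add: algebra_simps)
  qed
  then show ?thesis by (rule le_of_forall_eps_mult)
qed

lemma asymp_sets_cone: "A \<in> asymp_sets d f \<Longrightarrow> A \<in> cone_sets"
proof -
  assume "A \<in> asymp_sets d f"
  then obtain B where "B \<in> cone_sets" "A = F 0 -` B \<inter> pspace" unfolding asymp_sets_def by blast
  then show ?thesis using vimage_F_cone_sets by blast
qed

lemma asymp_sets_compl:
  assumes "A \<in> asymp_sets d f" shows "pspace - A \<in> asymp_sets d f"
  unfolding asymp_sets_def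
proof (intro CollectI allI)
  fix j
  obtain B where B: "B \<in> cone_sets" "A = F j -` B \<inter> pspace" using assms unfolding asymp_sets_def by blast
  have "pspace - B \<in> cone_sets" using sets.compl_sets[of B cone_space] B by simp
  moreover have "pspace - A = F j -` (pspace - B) \<inter> pspace"
    using B Flift_eq_0_iff[of d f j] degree_ge_2 holo by (auto simp: pspace_def)
  ultimately show "\<exists>B\<in>cone_sets. pspace - A = F j -` B \<inter> pspace" by blast
qed

text \<open>The average bound with error \<epsilon> holds only for large \<open>n\<close>; an
  asymptotic set is a preimage under every \<open>F n\<close>, so \<open>n\<close> may be chosen
  after \<epsilon>. The inequalities for \<open>A\<close> and its complement add up to an identity,
  hence both are equalities.\<close>

lemma independent_of_asymp_set:
  assumes G: "green G \<tau>" and u: "homogeneous_psh C u" and A: "A \<in> asymp_sets d f"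
  defines "w \<equiv> \<lambda>x. u x - C * G x"
  shows "(\<integral>x. w x * indicator A x \<partial>\<mu>) = (\<integral>x. w x \<partial>\<mu>) * measure \<mu> A"
proof -
  have w: "cont_Pk w" unfolding w_def by (rule cont_Pk_minus_green[OF G u])
  have le: "(\<integral>x. w x * indicator A x \<partial>\<mu>) \<le> (\<integral>x. w x \<partial>\<mu>) * measure \<mu> A" if A: "A \<in> asymp_sets d f" for A
  proof (rule le_of_forall_eps_mult)
    fix \<epsilon> :: real assume "0 < \<epsilon>"
    then have "\<forall>\<^sub>F n in sequentially. \<forall>z\<in>Reg n. (\<Sum>x\<in>F n -` {z}. w x) \<le> ((\<integral>x. w x \<partial>\<mu>) + \<epsilon>) * real (card (F n -` {z}))"
      unfolding w_def by (rule eventually_fibre_average_le[OF G u])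
    then obtain n where n: "\<forall>z\<in>Reg n. (\<Sum>x\<in>F n -` {z}. w x) \<le> ((\<integral>x. w x \<partial>\<mu>) + \<epsilon>) * real (card (F n -` {z}))"
      by (auto simp: eventually_sequentially)
    obtain B where B: "B \<in> cone_sets" "A = F n -` B \<inter> pspace" using A unfolding asymp_sets_def by blast
    show "(\<integral>x. w x * indicator A x \<partial>\<mu>) \<le> (\<integral>x. w x \<partial>\<mu>) * measure \<mu> A + \<epsilon> * measure \<mu> A"
      using pairing_sets_le[OF n w B(1)] unfolding B(2)[symmetric] by (simp add: distrib_right)
  qed
  have As: "A \<in> sets \<mu>" using asymp_sets_cone[OF A] mu_sets by simp
  have int_wA: "integrable \<mu> (\<lambda>x. w x * indicator A x)"
    using integrable_real_mult_indicator[OF As integrable_mu[OF w]] by (simp add: mult.commute)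
  have "(\<integral>x. w x * indicator (pspace - A) x \<partial>\<mu>) = (\<integral>x. w x - w x * indicator A x \<partial>\<mu>)"
    by (intro Bochner_Integration.integral_cong) (auto simp: space_mu indicator_def)
  also have "\<dots> = (\<integral>x. w x \<partial>\<mu>) - (\<integral>x. w x * indicator A x \<partial>\<mu>)"
    by (rule Bochner_Integration.integral_diff[OF integrable_mu[OF w] int_wA])
  finally have compl: "(\<integral>x. w x * indicator (pspace - A) x \<partial>\<mu>) = (\<integral>x. w x \<partial>\<mu>) - (\<integral>x. w x * indicator A x \<partial>\<mu>)" .
  have "measure \<mu> (pspace - A) = 1 - measure \<mu> A" using \<mu>.prob_compl[OF As] by (simp add: space_mu)
  then have "(\<integral>x. w x \<partial>\<mu>) * measure \<mu> (pspace - A) = (\<integral>x. w x \<partial>\<mu>) - (\<integral>x. w x \<partial>\<mu>) * measure \<mu> A"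
    by (simp add: right_diff_distrib)
  then show ?thesis using le[OF A] le[OF asymp_sets_compl[OF A]] compl by linarith
qed

text \<open>Both potentials have the same weight \<open>C\<close>, so
  \<open>\<phi> = (u - C G) - (v - C G)\<close> and the Green correction cancels.\<close>

lemma psh_difference_independent:
  assumes \<phi>: "psh_difference \<phi>" and A: "A \<in> asymp_sets d f"
  shows "(\<integral>x. \<phi> x * indicator A x \<partial>\<mu>) = (\<integral>x. \<phi> x \<partial>\<mu>) * measure \<mu> A"
proof -
  obtain G \<tau> where G: "green G \<tau>" using green_exists by blast
  obtain C u v where uv: "homogeneous_psh C u" "homogeneous_psh C v" "\<phi> = (\<lambda>x. u x - v x)"
    using \<phi> by (auto simp: psh_difference_def)
  define a where "a x = u x - C * G x" for x
  define b where "b x = v x - C * G x" for x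
  have c: "cont_Pk a" "cont_Pk b"
    unfolding a_def b_def using cont_Pk_minus_green[OF G] uv by blast+
  have \<phi>ab: "\<phi> x = a x - b x" for x by (simp add: uv(3) a_def b_def)
  have As: "A \<in> sets \<mu>" using asymp_sets_cone[OF A] mu_sets by simp
  have int: "integrable \<mu> (\<lambda>x. a x * indicator A x)" "integrable \<mu> (\<lambda>x. b x * indicator A x)"
    using integrable_real_mult_indicator[OF As integrable_mu] c by (simp_all add: mult.commute)
  have ind: "(\<integral>x. a x * indicator A x \<partial>\<mu>) = (\<integral>x. a x \<partial>\<mu>) * measure \<mu> A"
    "(\<integral>x. b x * indicator A x \<partial>\<mu>) = (\<integral>x. b x \<partial>\<mu>) * measure \<mu> A"
    unfolding a_def b_def using independent_of_asymp_set[OF G _ A] uv by blast+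
  have "(\<integral>x. \<phi> x * indicator A x \<partial>\<mu>) = (\<integral>x. a x * indicator A x \<partial>\<mu>) - (\<integral>x. b x * indicator A x \<partial>\<mu>)"
    unfolding \<phi>ab left_diff_distrib by (rule Bochner_Integration.integral_diff[OF int])
  moreover have "(\<integral>x. \<phi> x \<partial>\<mu>) = (\<integral>x. a x \<partial>\<mu>) - (\<integral>x. b x \<partial>\<mu>)"
    unfolding \<phi>ab by (rule Bochner_Integration.integral_diff[OF integrable_mu[OF c(1)] integrable_mu[OF c(2)]])
  ultimately show ?thesis by (simp add: ind left_diff_distrib)
qed

text \<open>The approximants of the indicator remain in the class of differences, so independence
  passes to the limit by dominated convergence, both over \<open>A\<close> and over the whole
  space.\<close>

lemma positive_set_independent:
  assumes E: "E \<in> positive_sets" and A: "A \<in> asymp_sets d f"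
  shows "measure \<mu> (E \<inter> A) = measure \<mu> E * measure \<mu> A"
proof -
  obtain \<phi> where \<phi>: "psh_difference \<phi>" "E = {x \<in> pspace. 0 < \<phi> x}" using E unfolding positive_sets_def by blast
  define \<eta> where "\<eta> j x = min 1 (real j * max (\<phi> x) 0)" for j x
  have pd: "psh_difference (\<eta> j)" for j
    unfolding \<eta>_def
    by (intro psh_difference_min psh_difference_const psh_difference_of_nat_mult psh_difference_max \<phi>(1))
  have int: "integrable \<mu> (\<eta> j)" for j by (rule integrable_mu[OF psh_difference_cont_Pk[OF pd]])
  have As: "A \<in> sets \<mu>" using asymp_sets_cone[OF A] mu_sets by simp
  have Es: "E \<in> sets \<mu>" using E positive_sets_subset mu_sets by blast
  have lim: "(\<lambda>j. \<eta> j x) \<longlonglongrightarrow> indicator E x" if "x \<in> space \<mu>" for x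
  proof -
    have "indicator E x = (if 0 < \<phi> x then 1 else (0::real))" using that by (simp add: \<phi>(2) space_mu)
    then show ?thesis unfolding \<eta>_def by (simp only: tendsto_min_of_nat_mult)
  qed
  have bnd: "\<bar>\<eta> j x\<bar> \<le> 1" for j x by (auto simp: \<eta>_def)
  have conv: "(\<lambda>j. \<integral>x. \<eta> j x * indicator S x \<partial>\<mu>) \<longlonglongrightarrow> (\<integral>x. indicator E x * indicator S x \<partial>\<mu>)" if S: "S \<in> sets \<mu>" for S
  proof (rule integral_dominated_convergence[where w = "\<lambda>_. 1"])
    show "AE x in \<mu>. (\<lambda>j. \<eta> j x * indicator S x) \<longlonglongrightarrow> indicator E x * indicator S x"
      by (intro AE_I2 tendsto_mult lim tendsto_const)
    show "AE x in \<mu>. norm (\<eta> j x * indicator S x) \<le> 1" for j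
      using bnd[of j] by (intro AE_I2) (auto simp: indicator_def)
    show "(\<lambda>x. \<eta> j x * indicator S x) \<in> borel_measurable \<mu>" for j
      using int[of j] S by (intro borel_measurable_times borel_measurable_indicator borel_measurable_integrable)
    show "(\<lambda>x. indicator E x * indicator S x :: real) \<in> borel_measurable \<mu>"
      using Es S by (intro borel_measurable_times borel_measurable_indicator)
  qed simp
  have "space \<mu> \<in> sets \<mu>" by simp
  from conv[OF this] have 1: "(\<lambda>j. \<integral>x. \<eta> j x \<partial>\<mu>) \<longlonglongrightarrow> measure \<mu> E"
  proof -
    have "(\<integral>x. \<eta> j x * indicator (space \<mu>) x \<partial>\<mu>) = (\<integral>x. \<eta> j x \<partial>\<mu>)" for j
      by (intro Bochner_Integration.integral_cong) auto
    moreover have "(\<integral>x. indicator E x * indicator (space \<mu>) x \<partial>\<mu>) = (\<integral>x. indicator E x \<partial>\<mu> :: real)"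
      by (intro Bochner_Integration.integral_cong) auto
    moreover have "(\<integral>x. indicator E x \<partial>\<mu> :: real) = measure \<mu> E" using Es by simp
    ultimately show ?thesis using conv[OF \<open>space \<mu> \<in> sets \<mu>\<close>] by simp
  qed
  have "(\<lambda>j. \<integral>x. \<eta> j x * indicator A x \<partial>\<mu>) \<longlonglongrightarrow> (\<integral>x. indicator E x * indicator A x \<partial>\<mu>)" by (rule conv[OF As])
  moreover have "(\<integral>x. indicator E x * indicator A x \<partial>\<mu> :: real) = measure \<mu> (E \<inter> A)"
    using Es As by (simp flip: indicator_inter_arith)
  ultimately have "(\<lambda>j. (\<integral>x. \<eta> j x \<partial>\<mu>) * measure \<mu> A) \<longlonglongrightarrow> measure \<mu> (E \<inter> A)"
    by (simp add: psh_difference_independent[OF pd A])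
  moreover have "(\<lambda>j. (\<integral>x. \<eta> j x \<partial>\<mu>) * measure \<mu> A) \<longlonglongrightarrow> measure \<mu> E * measure \<mu> A"
    by (intro tendsto_mult 1 tendsto_const)
  ultimately show ?thesis by (rule LIMSEQ_unique)
qed

lemma cone_set_independent:
  assumes E: "E \<in> cone_sets" and A: "A \<in> asymp_sets d f"
  shows "measure \<mu> (E \<inter> A) = measure \<mu> E * measure \<mu> A"
proof -
  have As: "A \<in> sets \<mu>" using asymp_sets_cone[OF A] mu_sets by simp
  have sub: "positive_sets \<subseteq> Pow (pspace :: (complex^'n) set)" by (auto simp: positive_sets_def)
  have "E \<in> sigma_sets pspace positive_sets" using E cone_sets_subset_sigma by blast
  with Int_stable_positive_sets sub have "E \<in> sets \<mu> \<and> measure \<mu> (E \<inter> A) = measure \<mu> E * measure \<mu> A"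
  proof (induction rule: sigma_sets_induct_disjoint)
    case (basic E)
    then show ?case using positive_set_independent[OF basic A] positive_sets_subset mu_sets by blast
  next
    case empty
    show ?case by simp
  next
    case (compl E)
    then have Es: "E \<in> sets \<mu>" by simp
    have c: "pspace - E \<in> sets \<mu>" using sets.compl_sets[OF Es] by (simp add: space_mu)
    have "A \<subseteq> pspace" using asymp_sets_cone[OF A] by (auto simp: cone_sets_def)
    then have "(pspace - E) \<inter> A = A - E \<inter> A" by auto
    moreover have "measure \<mu> (A - E \<inter> A) = measure \<mu> A - measure \<mu> (E \<inter> A)"
      using As Es by (intro \<mu>.finite_measure_Diff) auto
    moreover have "measure \<mu> (pspace - E) = 1 - measure \<mu> E" using \<mu>.prob_compl[OF Es] by (simp add: space_mu)
    ultimately show ?case using compl c by (simp add: left_diff_distrib)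
  next
    case (union B)
    then have Bs: "range B \<subseteq> sets \<mu>" and eq: "\<And>i. measure \<mu> (B i \<inter> A) = measure \<mu> (B i) * measure \<mu> A" by auto
    have "(\<lambda>i. measure \<mu> (B i)) sums measure \<mu> (\<Union>i. B i)"
      by (rule \<mu>.finite_measure_UNION[OF Bs union(1)])
    then have 1: "(\<lambda>i. measure \<mu> (B i) * measure \<mu> A) sums (measure \<mu> (\<Union>i. B i) * measure \<mu> A)"
      by (rule sums_mult2)
    have "(\<lambda>i. measure \<mu> (B i \<inter> A)) sums measure \<mu> (\<Union>i. B i \<inter> A)"
    proof (rule \<mu>.finite_measure_UNION)
      show "range (\<lambda>i. B i \<inter> A) \<subseteq> sets \<mu>" using Bs As by auto
      show "disjoint_family (\<lambda>i. B i \<inter> A)" using union(1) by (auto simp: disjoint_family_on_def)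
    qed
    then have "(\<lambda>i. measure \<mu> (B i) * measure \<mu> A) sums measure \<mu> ((\<Union>i. B i) \<inter> A)" by (simp add: eq)
    from sums_unique2[OF this 1] show ?case using Bs by auto
  qed
  then show ?thesis by blast
qed

lemma asymptotic_algebra_trivial:
  assumes A: "A \<in> asymp_sets d f" shows "measure \<mu> A = 0 \<or> measure \<mu> A = 1"
proof -
  have "measure \<mu> A * (1 - measure \<mu> A) = 0"
    using cone_set_independent[OF asymp_sets_cone[OF A] A] unfolding right_diff_distrib Int_absorb by linarith
  then show ?thesis unfolding mult_eq_0_iff by linarith
qed

end

theorem theorem2p5:
  fixes d :: nat
    and f :: "nat \<Rightarrow> 'n::finite \<Rightarrow> ('n \<Rightarrow> nat) \<Rightarrow> complex"
    and \<mu> :: "(complex^'n) measure"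
  assumes "d \<ge> 2"
    and holo: "\<And>j. holo d (f j)"
    and condA: "liminf (\<lambda>n. ereal ((1 / real n) * (\<Sum>j<n. ln (dist_M d (f j))))) > - \<infinity>"
    and condB: "liminf (\<lambda>j. ereal (ln (dist_M d (f j)) / real j)) = 0"
    and mu_prob: "prob_space \<mu>" and mu_sets: "sets \<mu> = cone_sets"
    and mu_limit: "\<And>\<nu> \<phi>. smooth_prob \<nu> \<Longrightarrow> cont_Pk \<phi> \<Longrightarrow>
        (\<lambda>n. (\<integral>y. push_fun (Flift d f n) \<phi> y \<partial>\<nu>) / real d ^ (n * (CARD('n) - 1)))
          \<longlonglongrightarrow> (\<integral>x. \<phi> x \<partial>\<mu>)"
  shows "\<forall>A\<in>asymp_sets d f. measure \<mu> A = 0 \<or> measure \<mu> A = 1"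
proof (cases "CARD('n) \<ge> 2")
  case True
  interpret sequential_system d f \<mu>
    by (intro sequential_system.intro True assms)
  show ?thesis using asymptotic_algebra_trivial by blast
next
  case False
  \<comment> \<open>Here projective space is a single point: the only invariant sets are the empty
    set and the whole punctured line.\<close>
  then have "CARD('n) = 1" using zero_less_card_finite[where 'a = 'n] by linarith
  then obtain i :: 'n where i: "UNIV = {i}" using card_1_singletonE by blast
  show ?thesis
  proof
    fix A assume "A \<in> asymp_sets d f"
    then obtain B where B: "B \<in> cone_sets" "A = Flift d f 0 -` B \<inter> pspace" unfolding asymp_sets_def by blast
    then have A: "A \<in> cone_sets" "A = B" by (auto simp: cone_sets_def)
    have "A = {} \<or> A = pspace"
    proof (cases "A = {}")
      case False
      then obtain a where a: "a \<in> A" by blast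
      have at_i: "v = w \<longleftrightarrow> v $ i = w $ i" for v w :: "complex^'n"
        unfolding vec_eq_iff using i by (metis UNIV_I singletonD)
      have "a \<noteq> 0" using a A(1) by (auto simp: cone_sets_def pspace_def)
      then have ai: "a $ i \<noteq> 0" using at_i[of a 0] by simp
      have "y \<in> A" if "y \<in> pspace" for y
      proof -
        have "y $ i \<noteq> 0" using that at_i[of y 0] by (simp add: pspace_def)
        moreover have "y = (y $ i / a $ i) *s a" using ai by (simp add: at_i)
        ultimately show ?thesis using cone_sets_vsmult_iff[OF A(1), of "y $ i / a $ i" a] a ai by simp
      qed
      then show ?thesis using A(1) by (auto simp: cone_sets_def)
    qed simp
    then show "measure \<mu> A = 0 \<or> measure \<mu> A = 1"
      using prob_space.prob_space[OF mu_prob] space_eq_pspace[OF mu_sets] by auto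
  qed
qed

end
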